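(* Let $n\ge1$, $\tau>0$ and $\beta>1$. Let $f:\mathbb{R}^n\to\mathbb{R}$ be twice differentiable with $f(x)\ge-C(1+|x|)$ for all $x\in\mathbb{R}^n$ and some $C>0$, $\Delta f\ge n\big(1-\frac1\beta\big)$ on $\mathbb{R}^n$, and $$\int_{\mathbb{R}^n}e^{2af}\frac{\gamma}{\gamma_{\beta(a)}}\,d\gamma<\infty\quad\text{for all sufficiently small }a>0,\qquad\text{where }\ \frac1{\beta(a)}:=1-a\Big(1-\frac1\beta\Big).$$ Then $$\big\|e^{Q_\tau f}\big\|_{L^\tau(\gamma)}\le T(\tau,\beta)\,e^{\int_{\mathbb{R}^n}f\,d\gamma},$$ where $$T(\tau,\beta):=\Big(e^{-1}\Big(1+\tau\Big(1-\frac1\beta\Big)\Big)^{\frac1{\tau(1-\frac1\beta)}}\Big)^{\frac n2(1-\frac1\beta)}\in(0,1).$$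
   Context: For $\alpha>0$, $\gamma_\alpha(x)=(2\pi\alpha)^{-n/2}e^{-|x|^2/(2\alpha)}$ on $\mathbb{R}^n$, $\gamma=\gamma_1$, $d\gamma=\gamma(x)\,dx$. For $r>0$, $\|g\|_{L^r(\gamma)}=(\int|g|^r\,d\gamma)^{1/r}$. The Hopf–Lax formula is $Q_\tau f(x)=\inf_{y\in\mathbb{R}^n}\{f(y)+\frac1{2\tau}|x-y|^2\}$ for $\tau>0$, $x\in\mathbb{R}^n$. *)

theory Defs
  imports "HOL-Analysis.Analysis"
begin

definition gauss_density :: "real \<Rightarrow> real ^ 'n \<Rightarrow> real"
  where "gauss_density \<alpha> x =
    (2 * pi * \<alpha>) powr (- (real CARD('n) / 2)) * exp (- (norm x)\<^sup>2 / (2 * \<alpha>))"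

definition gauss_measure :: "(real ^ 'n) measure"
  where "gauss_measure = density lborel (\<lambda>x. ennreal (gauss_density 1 x))"

text \<open>The integral below is a Bochner integral, which is 0 when the integrand is not integrable.
  A bound on \<open>gauss_norm r g\<close> is therefore only meaningful together with
  \<open>gauss_Lr r g\<close>, which says that the \<open>r\<close>-th power is integrable. Any \<open>r > 0\<close> is allowed,
  including \<open>r < 1\<close>, where this is not a norm.\<close>

definition gauss_Lr :: "real \<Rightarrow> (real ^ 'n \<Rightarrow> real) \<Rightarrow> bool"
  where "gauss_Lr r g \<longleftrightarrow>
    g \<in> borel_measurable lborel \<and> integrable gauss_measure (\<lambda>x. \<bar>g x\<bar> powr r)"

definition gauss_norm :: "real \<Rightarrow> (real ^ 'n \<Rightarrow> real) \<Rightarrow> real"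
  where "gauss_norm r g = (\<integral>x. \<bar>g x\<bar> powr r \<partial>gauss_measure) powr (1 / r)"

text \<open>The infimum is taken in the reals, so it is meaningful only if the set is bounded below;
  this holds for \<open>\<tau> > 0\<close> if \<open>f\<close> has an at most linearly decreasing lower bound.\<close>

definition hopf_lax :: "real \<Rightarrow> (real ^ 'n \<Rightarrow> real) \<Rightarrow> real ^ 'n \<Rightarrow> real"
  where "hopf_lax \<tau> f x = (INF y. f y + 1 / (2 * \<tau>) * (norm (x - y))\<^sup>2)"

definition grad :: "(real ^ 'n \<Rightarrow> real) \<Rightarrow> real ^ 'n \<Rightarrow> real ^ 'n"
  where "grad f x = (\<chi> i. frechet_derivative f (at x) (axis i 1))"

text \<open>Twice differentiable in the Frechet sense, without continuity of the second derivative.\<close>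

definition twice_differentiable :: "(real ^ 'n \<Rightarrow> real) \<Rightarrow> bool"
  where "twice_differentiable f \<longleftrightarrow>
    (\<forall>x. f differentiable at x) \<and> (\<forall>x. grad f differentiable at x)"

definition laplacian :: "(real ^ 'n \<Rightarrow> real) \<Rightarrow> real ^ 'n \<Rightarrow> real"
  where "laplacian f x = (\<Sum>i\<in>UNIV. frechet_derivative (grad f) (at x) (axis i 1) $ i)"

definition beta_a :: "real \<Rightarrow> real \<Rightarrow> real"
  where "beta_a \<beta> a = 1 / (1 - a * (1 - 1 / \<beta>))"

definition T_const :: "nat \<Rightarrow> real \<Rightarrow> real \<Rightarrow> real"
  where "T_const n \<tau> \<beta> =
    (exp (- 1) * (1 + \<tau> * (1 - 1 / \<beta>)) powr (1 / (\<tau> * (1 - 1 / \<beta>))))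
      powr (real n / 2 * (1 - 1 / \<beta>))"

end

(*
  Put kappa = 1 - 1/beta, s = tau * kappa, g = tau * f and theta = 1/(1+s). Monotone transport of
  the centred Gaussian of variance theta onto the density exp(u), together with
  -ln T' >= 1 + ln theta - theta * T' and an integration by parts, shows in dimension one that
  u(x) + x y <= G(y) for all x, y implies
    ln (int exp u) <= int G dgamma_theta + (ln (2 pi) - 1 - ln theta) / 2.
  This inequality tensorizes. Applied to u = Q_1 g - |x|^2/2 and G = g + |y|^2/2 it bounds
  ln (int exp (Q_1 g) dgamma) by int g dgamma_theta + n/2 * (theta - 1 - ln theta), without any
  hypothesis on the Laplacian. As f - kappa |x|^2/2 is subharmonic, its Gaussian means increase with
  the variance, hence int g dgamma_theta <= int g dgamma - n s (1 - theta) / 2; the choice of theta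
  makes the sum of the two bounds the logarithm of the constant.

  The second derivatives of f exist only pointwise, so integration by parts is not available for f.
  Instead, f - kappa |x|^2/2 is mollified with a tensor product of cubic B-splines, and the
  Laplacian of the mollification is shown to be nonnegative by successive refinement, as in
  Goursat's lemma.
*)

theory Submission
  imports Defs "HOL-Probability.Probability" "HOL-Real_Asymp.Real_Asymp"
begin

section \<open>The dual transport inequality in dimension one\<close>

text \<open>The model case is f(x) = kappa * |x|^2 / 2, where every inequality of the argument
  becomes an equality, up to truncation. There exp(u) is Gaussian of variance 1 + s, the transport
  from variance theta = 1 / (1 + s) is linear, and its slope 1 / theta is the point of tangency in
  the bound for -ln T'. For general f, theta minimises the sum of the two bounds over all variances.
  Two obstacles shape the second half. A translate of gamma is controlled by gamma only up to a
  factor exp(rho * |y|), so gamma-integrability of f would not dominate the mollified means; the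
  exponential moment is used to put f - kappa * |x|^2 / 2 into L^2(gamma), which does. And a
  pointwise Laplacian bound says nothing directly about an average over a ball. Cubic B-splines have
  a continuous second derivative and are also positive combinations of their own half-size copies,
  so a negative average is inherited by a smaller one and can be traced down to a point.\<close>

lemma continuous_antiderivative:
  fixes w :: "real \<Rightarrow> real"
  assumes "continuous_on UNIV w"
  obtains W where "\<And>x. (W has_real_derivative w x) (at x)"
proof -
  have "\<exists>F. \<forall>x :: real. -\<infinity> < ereal x \<longrightarrow> ereal x < \<infinity> \<longrightarrow> (F has_vector_derivative w x) (at x)"
    by (rule einterval_antiderivative)
       (use assms in \<open>auto simp: continuous_on_eq_continuous_at\<close>)
  then show ?thesis
    using that by (auto simp: has_real_derivative_iff_has_vector_derivative)
qed

text \<open>Equate the two cumulative functions. The factor \<open>q\<close> is the ratio of the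
  masses, so neither density has to be normalised, and the derivative formula is the one-dimensional
  Monge-Ampere equation.\<close>

lemma monotone_transport:
  fixes p w :: "real \<Rightarrow> real"
  assumes p: "continuous_on UNIV p" "\<And>x. p x > 0"
    and w: "continuous_on UNIV w" "\<And>x. w x > 0"
    and "a < b" "c < d"
  defines "q \<equiv> (LBINT x:{c..d}. w x) / (LBINT x:{a..b}. p x)"
  obtains T where "\<And>y. y \<in> {a..b} \<Longrightarrow> T y \<in> {c..d}"
    and "\<And>y. y \<in> {a..b} \<Longrightarrow> (T has_real_derivative q * p y / w (T y)) (at y)"
    and "q > 0"
proof -
  obtain P where P: "\<And>x. (P has_real_derivative p x) (at x)"
    using continuous_antiderivative[OF p(1)] by blast
  obtain W where W: "\<And>x. (W has_real_derivative w x) (at x)"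
    using continuous_antiderivative[OF w(1)] by blast
  have mP: "strict_mono P" and mW: "strict_mono W"
    using P W p(2) w(2) by (meson strict_monoI DERIV_pos_imp_increasing)+
  have q: "q = (W d - W c) / (P b - P a)"
  proof -
    have "(LBINT x:{c..d}. w x) = W d - W c"
      unfolding set_lebesgue_integral_def using \<open>c < d\<close> W w(1)
      by (intro integral_FTC_atLeastAtMost)
         (auto simp: has_real_derivative_iff_has_vector_derivative
           intro: has_vector_derivative_at_within continuous_on_subset)
    moreover have "(LBINT x:{a..b}. p x) = P b - P a"
      unfolding set_lebesgue_integral_def using \<open>a < b\<close> P p(1)
      by (intro integral_FTC_atLeastAtMost)
         (auto simp: has_real_derivative_iff_has_vector_derivative
           intro: has_vector_derivative_at_within continuous_on_subset)
    ultimately show ?thesis unfolding q_def by simp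
  qed
  have pos: "W d - W c > 0" "P b - P a > 0"
    using mP mW \<open>a < b\<close> \<open>c < d\<close> by (simp_all add: strict_mono_less)
  \<comment> \<open>Inverting \<open>W\<close> on the whole line, and not just on
    \<open>{c..d}\<close>, makes \<open>T\<close> differentiable from both sides at the end points
    as well.\<close>
  define T where "T y = inv W (W c + q * (P y - P a))" for y
  have injW: "inj W"
    using mW strict_mono_on_imp_inj_on by blast
  have contW: "continuous_on UNIV W"
    using W by (intro DERIV_continuous_on) (auto intro: has_field_derivative_at_within)
  have T: "T y \<in> {c..d} \<and> W (T y) = W c + q * (P y - P a)" if y: "y \<in> {a..b}" for y
  proof -
    have "P a \<le> P y" "P y \<le> P b"
      using y mP by (auto simp: strict_mono_less_eq)
    then have 1: "0 \<le> q * (P y - P a)" "q * (P y - P a) \<le> W d - W c"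
      using pos by (auto simp: q divide_simps)
    have "\<exists>x\<ge>c. x \<le> d \<and> W x = W c + q * (P y - P a)"
      using 1 \<open>c < d\<close> by (intro IVT') (auto intro: continuous_on_subset[OF contW])
    then obtain x where x: "x \<in> {c..d}" "W x = W c + q * (P y - P a)"
      by auto
    moreover have "T y = x"
      unfolding T_def x(2)[symmetric] using injW by simp
    ultimately show ?thesis by simp
  qed
  have dT: "(T has_real_derivative q * p y / w (T y)) (at y)" if y: "y \<in> {a..b}" for y
  proof -
    have "(inv W has_real_derivative inverse (w (T y))) (at (W (T y)))"
      unfolding has_field_derivative_def
    proof (rule has_derivative_inverse_strong[where S=UNIV and f=W and x="T y" and f'="(*) (w (T y))"])
      show "(W has_derivative (*) (w (T y))) (at (T y))"
        using W by (simp add: has_field_derivative_def)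
      show "(*) (w (T y)) \<circ> (*) (inverse (w (T y))) = id"
        using w(2)[of "T y"] by (simp add: fun_eq_iff)
    qed (use contW injW in simp_all)
    then have "(inv W has_real_derivative inverse (w (T y))) (at (W c + q * (P y - P a)))"
      using T[OF y] by simp
    moreover have "((\<lambda>y. W c + q * (P y - P a)) has_real_derivative q * p y) (at y)"
      by (auto intro!: derivative_eq_intros P)
    ultimately have "(inv W \<circ> (\<lambda>y. W c + q * (P y - P a)) has_real_derivative inverse (w (T y)) * (q * p y)) (at y)"
      by (rule DERIV_chain)
    then show ?thesis
      unfolding T_def comp_def by (simp add: field_simps)
  qed
  have "q > 0" using pos q by simp
  with T dT that show ?thesis by blast
qed

text \<open>Insert x = T y into the constraint, where the Monge-Ampere equation reads v (T y) = ln q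
  + ln (p y) - ln (T' y), and integrate against \<open>p\<close>. Truncating source and target keeps
  all integrals finite. The price is the boundary term of the integration by parts, at most
  \<open>2 * \<theta> * R * p N\<close> because \<open>T\<close> takes values in
  \<open>{-R..R}\<close>; it disappears as N grows with R fixed.\<close>

lemma transport_entropy_compact:
  fixes v G :: "real \<Rightarrow> real"
  assumes \<theta>: "\<theta> > 0" and N: "N > 0" and R: "R > 0"
  defines "p \<equiv> normal_density 0 (sqrt \<theta>)"
  assumes v: "continuous_on UNIV v"
    and G: "integrable lborel (\<lambda>y. p y * G y)"
    and le: "AE y in lborel. \<forall>x. v x + x * y \<le> G y"
  defines "Z \<equiv> LBINT x:{-R..R}. exp (v x)" and "P \<equiv> LBINT x:{-N..N}. p x"
  shows "Z > 0" and "P > 0"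
    and "P * (ln (Z / P) + 1 + ln \<theta> - ln (2 * pi * \<theta>) / 2) - 2 * \<theta> * R * p N
      \<le> (LBINT y:{-N..N}. p y * (G y + y\<^sup>2 / (2 * \<theta>)))"
proof -
  have p_pos: "p y > 0" for y
    unfolding p_def using \<theta> by (simp add: normal_density_pos)
  have p_eq: "p y = exp (- ln (2 * pi * \<theta>) / 2 - y\<^sup>2 / (2 * \<theta>))" for y
  proof -
    have "sqrt (2 * pi * \<theta>) = exp (ln (2 * pi * \<theta>) / 2)"
      using \<theta> by (simp add: ln_sqrt[symmetric])
    then show ?thesis
      using \<theta> unfolding p_def normal_density_def diff_conv_add_uminus exp_add
      by (simp add: exp_minus inverse_eq_divide)
  qed
  have p_cont: "continuous_on S p" for S
    unfolding p_eq[abs_def] using \<theta> by (intro continuous_intros) auto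
  have dp: "(p has_real_derivative - (y / \<theta>) * p y) (at y)" for y
    unfolding p_eq[abs_def] using \<theta> by (auto intro!: derivative_eq_intros simp: field_simps)
  have [measurable]: "p \<in> borel_measurable borel" unfolding p_def by simp
  define w where "w x = exp (v x)" for x
  have w: "continuous_on UNIV w" "\<And>x. w x > 0"
    unfolding w_def using v by (auto intro!: continuous_intros)
  define q where "q = (LBINT x:{-R..R}. w x) / (LBINT x:{-N..N}. p x)"
  obtain T where T: "\<And>y. y \<in> {-N..N} \<Longrightarrow> T y \<in> {-R..R}"
    and dT: "\<And>y. y \<in> {-N..N} \<Longrightarrow> (T has_real_derivative q * p y / w (T y)) (at y)"
    and "q > 0"
    using monotone_transport[OF p_cont p_pos w, of "-N" N "-R" R] N R unfolding q_def by auto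
  have qZP: "q = Z / P" unfolding q_def Z_def P_def w_def ..
  have pint: "set_integrable lborel A p" if "A \<in> sets borel" for A
    unfolding set_integrable_def p_def using that \<theta> by (intro integrable_mult_indicator) auto
  have "P \<ge> 0" unfolding P_def using p_pos
    by (auto simp: set_lebesgue_integral_def less_imp_le intro!: Bochner_Integration.integral_nonneg)
  with \<open>q > 0\<close> show "P > 0" "Z > 0"
    unfolding qZP by (cases "P = 0"; auto simp: zero_less_divide_iff)+
  define c where "c = ln (Z / P) + 1 + ln \<theta> - ln (2 * pi * \<theta>) / 2"
  \<comment> \<open>Since p' y = - (y / \<theta>) * p y, this is the derivative of
    \<open>- \<theta> * (T y * p y)\<close>.\<close>
  define D where "D y = (y * T y - \<theta> * (q * p y / w (T y))) * p y" for y
  have "has_bochner_integral lborel (\<lambda>y. D y * indicator {-N..N} y)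
      (- \<theta> * (T N * p N) - (- \<theta> * (T (-N) * p (-N))))"
  proof (rule has_bochner_integral_FTC_Icc_real)
    fix y assume y: "-N \<le> y" "y \<le> N"
    show "((\<lambda>y. - \<theta> * (T y * p y)) has_real_derivative D y) (at y)"
      using y \<theta> unfolding D_def
      by (auto intro!: derivative_eq_intros dT dp simp: field_simps)
    have "isCont T y" "isCont p y" using dT[of y] dp y by (auto intro: DERIV_isCont)
    moreover have "isCont w (T y)" using w(1) by (simp add: continuous_on_eq_continuous_at)
    ultimately show "isCont D y"
      unfolding D_def using w(2)[of "T y"] by (intro continuous_intros isCont_o2[where f=T and g=w]) auto
  qed (use N in auto)
  then have Dint: "set_integrable lborel {-N..N} D"
    and Dval: "(LBINT y:{-N..N}. D y) = \<theta> * (T (-N) * p (-N) - T N * p N)"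
    by (auto simp: set_integrable_def set_lebesgue_integral_def has_bochner_integral_iff mult.commute algebra_simps)
  have p_sym: "p (-N) = p N" unfolding p_eq by simp
  have "T (-N) - T N \<ge> - 2 * R"
    using T[of N] T[of "-N"] N by auto
  then have "\<theta> * p N * (T (-N) - T N) \<ge> \<theta> * p N * (- 2 * R)"
    using \<theta> p_pos[of N] by (intro mult_left_mono) auto
  then have Dge: "(LBINT y:{-N..N}. D y) \<ge> - 2 * \<theta> * R * p N"
    unfolding Dval p_sym by (simp add: algebra_simps)
  have y2: "integrable lborel (\<lambda>y. p y * (y\<^sup>2 / (2 * \<theta>)))"
    using integrable_normal_moment[of "sqrt \<theta>" 0 2] \<theta> unfolding p_def
    by simp
  have Gint: "set_integrable lborel {-N..N} (\<lambda>y. p y * (G y + y\<^sup>2 / (2 * \<theta>)))"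
    unfolding set_integrable_def distrib_left
    by (intro integrable_mult_indicator Bochner_Integration.integrable_add G y2) auto
  have pw: "AE y\<in>{-N..N} in lborel. c * p y + D y \<le> p y * (G y + y\<^sup>2 / (2 * \<theta>))"
    using le
  proof eventually_elim
    case (elim y)
    show ?case
    proof
      assume y: "y \<in> {-N..N}"
      define d where "d = q * p y / w (T y)"
      have "d > 0" unfolding d_def using \<open>q > 0\<close> p_pos[of y] w(2)[of "T y"] by simp
      have "w (T y) = q * p y / d"
        unfolding d_def using \<open>q > 0\<close> p_pos[of y] w(2)[of "T y"] by simp
      then have "v (T y) = ln (q * p y / d)"
        unfolding w_def by (metis ln_exp)
      also have "\<dots> = ln q + ln (p y) - ln d"
        using \<open>q > 0\<close> p_pos[of y] \<open>d > 0\<close> by (simp add: ln_mult ln_div)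
      finally have 1: "v (T y) = ln q + (- ln (2 * pi * \<theta>) / 2 - y\<^sup>2 / (2 * \<theta>)) - ln d"
        unfolding p_eq by simp
      have "ln (\<theta> * d) \<le> \<theta> * d - 1"
        using \<theta> \<open>d > 0\<close> by (intro ln_le_minus_one) auto
      then have 2: "ln d \<le> \<theta> * d - 1 - ln \<theta>"
        using \<theta> \<open>d > 0\<close> by (simp add: ln_mult)
      have "v (T y) + T y * y \<le> G y" using elim by blast
      with 1 2 have "c - \<theta> * d + y * T y \<le> G y + y\<^sup>2 / (2 * \<theta>)"
        unfolding c_def qZP by (simp add: algebra_simps)
      then have "(c - \<theta> * d + y * T y) * p y \<le> (G y + y\<^sup>2 / (2 * \<theta>)) * p y"
        using p_pos[of y] by (intro mult_right_mono) auto
      then show "c * p y + D y \<le> p y * (G y + y\<^sup>2 / (2 * \<theta>))"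
        unfolding D_def d_def by (simp add: algebra_simps)
    qed
  qed
  have "c * P + (LBINT y:{-N..N}. D y) = (LBINT y:{-N..N}. c * p y + D y)"
    unfolding P_def using pint Dint by (subst set_integral_add) auto
  also have "\<dots> \<le> (LBINT y:{-N..N}. p y * (G y + y\<^sup>2 / (2 * \<theta>)))"
    using pint Dint Gint pw by (intro set_integral_mono_AE set_integral_add) auto
  finally show "P * (ln (Z / P) + 1 + ln \<theta> - ln (2 * pi * \<theta>) / 2) - 2 * \<theta> * R * p N
      \<le> (LBINT y:{-N..N}. p y * (G y + y\<^sup>2 / (2 * \<theta>)))"
    using Dge unfolding c_def[symmetric] by (simp add: mult.commute)
qed


lemma set_integral_Icc_tendsto:
  fixes f :: "real \<Rightarrow> real"
  assumes "integrable lborel f"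
  shows "(\<lambda>n. LBINT y:{- real (Suc n)..real (Suc n)}. f y) \<longlonglongrightarrow> (LBINT y. f y)"
  unfolding set_lebesgue_integral_def
proof (rule integral_dominated_convergence[where w="\<lambda>y. norm (f y)"])
  show "AE y in lborel. (\<lambda>n. indicat_real {- real (Suc n)..real (Suc n)} y *\<^sub>R f y) \<longlonglongrightarrow> f y"
  proof (rule AE_I2)
    fix y :: real
    obtain k :: nat where k: "\<bar>y\<bar> \<le> real k" using real_arch_simple by blast
    have "\<forall>\<^sub>F n in sequentially. indicat_real {- real (Suc n)..real (Suc n)} y *\<^sub>R f y = f y"
      using eventually_ge_at_top[of k]
    proof eventually_elim
      case (elim n)
      then have "y \<in> {- real (Suc n)..real (Suc n)}" using k by auto
      then show ?case by simp
    qed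
    then show "(\<lambda>n. indicat_real {- real (Suc n)..real (Suc n)} y *\<^sub>R f y) \<longlonglongrightarrow> f y"
      by (rule tendsto_eventually)
  qed
  show "AE y in lborel. norm (indicat_real {- real (Suc n)..real (Suc n)} y *\<^sub>R f y) \<le> norm (f y)" for n
    by (rule AE_I2) (auto simp: indicator_def)
qed (use assms in auto)

lemma not_AE_lborel_False: "\<not> (AE y in (lborel :: 'a::euclidean_space measure). False)"
proof
  assume "AE y in (lborel :: 'a measure). False"
  then have "emeasure (lborel :: 'a measure) (space lborel) = 0"
    by (subst (asm) AE_iff_measurable[where N="space lborel"]) auto
  then show False by simp
qed

lemma nn_integral_le_of_Icc:
  fixes f :: "real \<Rightarrow> real"
  assumes "continuous_on UNIV f" "\<And>x. f x \<ge> 0"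
    and "\<And>n. (LBINT x:{- real (Suc n)..real (Suc n)}. f x) \<le> K"
  shows "(\<integral>\<^sup>+x. ennreal (f x) \<partial>lborel) \<le> ennreal K"
proof -
  let ?I = "\<lambda>n. {- real (Suc n)..real (Suc n)}"
  have [measurable]: "f \<in> borel_measurable borel"
    using assms(1) by (rule borel_measurable_continuous_onI)
  have eq: "(SUP n. ennreal (f x) * indicator (?I n) x) = ennreal (f x)" for x
  proof (rule antisym)
    obtain k :: nat where k: "\<bar>x\<bar> \<le> real k" using real_arch_simple by blast
    have "ennreal (f x) = ennreal (f x) * indicator (?I k) x" using k by (auto simp: indicator_def)
    also have "\<dots> \<le> (SUP n. ennreal (f x) * indicator (?I n) x)" by (rule SUP_upper) simp
    finally show "ennreal (f x) \<le> (SUP n. ennreal (f x) * indicator (?I n) x)" .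
  qed (auto intro!: SUP_least simp: indicator_def)
  have "(\<integral>\<^sup>+x. ennreal (f x) \<partial>lborel) = (\<integral>\<^sup>+x. (SUP n. ennreal (f x) * indicator (?I n) x) \<partial>lborel)"
    unfolding eq ..
  also have "\<dots> = (SUP n. \<integral>\<^sup>+x. ennreal (f x) * indicator (?I n) x \<partial>lborel)"
    by (rule nn_integral_monotone_convergence_SUP) (auto simp: incseq_def le_fun_def indicator_def)
  also have "\<dots> \<le> ennreal K"
  proof (rule SUP_least)
    fix n
    have "set_integrable lborel (?I n) f"
      using assms(1) by (intro borel_integrable_atLeastAtMost') (auto intro: continuous_on_subset)
    then have "(\<integral>\<^sup>+x. ennreal (f x) * indicator (?I n) x \<partial>lborel) = ennreal (LBINT x:?I n. f x)"
      using assms(2) unfolding set_integrable_def set_lebesgue_integral_def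
      by (subst nn_integral_eq_integral[symmetric])
         (auto intro!: nn_integral_cong simp: ennreal_mult' ennreal_indicator mult.commute split: split_indicator)
    also have "\<dots> \<le> ennreal K" using assms(3) by (rule ennreal_leI)
    finally show "(\<integral>\<^sup>+x. ennreal (f x) * indicator (?I n) x \<partial>lborel) \<le> ennreal K" .
  qed
  finally show ?thesis .
qed

text \<open>No regularity of \<open>u\<close> is available, but only the constraint matters: the
  largest function satisfying it is an infimum of affine functions, hence concave and continuous,
  and can be transported. First N tends to infinity, which removes the boundary term, then R by
  monotone convergence. The constraint is asked only for almost every y, because that is what Fubini
  provides in the tensorization.\<close>

lemma transport_entropy_real:
  fixes u G :: "real \<Rightarrow> real"
  assumes \<theta>: "\<theta> > 0"
    and G: "integrable lborel (\<lambda>y. normal_density 0 (sqrt \<theta>) y * G y)"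
    and le: "AE y in lborel. \<forall>x. u x + x * y \<le> G y"
  shows "(\<integral>\<^sup>+x. ennreal (exp (u x)) \<partial>lborel)
    \<le> ennreal (exp ((ln (2 * pi) - 1 - ln \<theta>) / 2 + (LBINT y. normal_density 0 (sqrt \<theta>) y * G y)))"
proof -
  define p where "p = normal_density 0 (sqrt \<theta>)"
  \<comment> \<open>The exceptional null set is left out of the infimum; \<open>Y\<close> has to be
    nonempty for the real infimum to be meaningful.\<close>
  define Y where "Y = {y. \<forall>x. u x + x * y \<le> G y}"
  have "Y \<noteq> {}"
  proof
    assume "Y = {}"
    then have "AE y in (lborel :: real measure). False"
      using le unfolding Y_def by (auto elim!: eventually_mono)
    then show False using not_AE_lborel_False by blast
  qed
  define v where "v x = (INF y\<in>Y. G y - x * y)" for x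
  have bdd: "bdd_below ((\<lambda>y. G y - x * y) ` Y)" for x
    unfolding Y_def by (intro bdd_belowI2[where m="u x"]) (auto simp: algebra_simps)
  have v_le: "v x \<le> G y - x * y" if "y \<in> Y" for x y
    unfolding v_def using bdd that by (rule cINF_lower)
  have u_le: "u x \<le> v x" for x
    unfolding v_def using \<open>Y \<noteq> {}\<close> by (rule cINF_greatest) (auto simp: Y_def algebra_simps)
  have "convex_on UNIV (\<lambda>x. - v x)"
  proof (rule convex_onI)
    fix t a b :: real assume t: "0 < t" "t < 1"
    have "(1 - t) * v a + t * v b \<le> v ((1 - t) * a + t * b)"
      unfolding v_def[of "(1 - t) * a + t * b"]
    proof (rule cINF_greatest[OF \<open>Y \<noteq> {}\<close>])
      fix y assume "y \<in> Y"
      then have "(1 - t) * v a + t * v b \<le> (1 - t) * (G y - a * y) + t * (G y - b * y)"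
        using t v_le by (intro add_mono mult_left_mono) auto
      then show "(1 - t) * v a + t * v b \<le> G y - ((1 - t) * a + t * b) * y"
        by (simp add: algebra_simps)
    qed
    then show "- v ((1 - t) *\<^sub>R a + t *\<^sub>R b) \<le> (1 - t) * - v a + t * - v b"
      by simp
  qed auto
  then have "continuous_on UNIV (\<lambda>x. - v x)"
    by (intro convex_on_continuous) auto
  then have v: "continuous_on UNIV v"
    using continuous_on_minus by fastforce
  have vle: "AE y in lborel. \<forall>x. v x + x * y \<le> G y"
    using le by eventually_elim (use v_le in \<open>auto simp: Y_def le_diff_eq\<close>)
  have y2: "integrable lborel (\<lambda>y. p y * y\<^sup>2)" "(LBINT y. p y * y\<^sup>2) = \<theta>"
    using integrable_normal_moment[of "sqrt \<theta>" 0 2] integral_normal_moment_even[of "sqrt \<theta>" 0 1] \<theta>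
    unfolding p_def by (auto simp: fact_numeral)
  have int2: "integrable lborel (\<lambda>y. p y * (G y + y\<^sup>2 / (2 * \<theta>)))"
    unfolding distrib_left using G y2(1) by (auto simp: p_def)
  have val2: "(LBINT y. p y * (G y + y\<^sup>2 / (2 * \<theta>))) = (LBINT y. p y * G y) + 1 / 2"
    unfolding distrib_left using G y2 \<theta>
    by (subst Bochner_Integration.integral_add) (auto simp: p_def)
  have bound: "(LBINT x:{- real (Suc m)..real (Suc m)}. exp (v x))
      \<le> exp ((ln (2 * pi) - 1 - ln \<theta>) / 2 + (LBINT y. p y * G y))" for m
  proof -
    define R where "R = real (Suc m)"
    have R: "R > 0" unfolding R_def by simp
    define Z where "Z = (LBINT x:{-R..R}. exp (v x))"
    define P where "P n = (LBINT x:{- real (Suc n)..real (Suc n)}. p x)" for n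
    note te = transport_entropy_compact[OF \<theta> _ R v G vle, folded p_def, folded Z_def]
    have "Z > 0" using te(1)[of 1] by simp
    have Plim: "P \<longlonglongrightarrow> 1"
      using set_integral_Icc_tendsto[of p] \<theta> unfolding P_def p_def by simp
    have Ppos: "P n > 0" for n
      using te(2)[of "real (Suc n)"] unfolding P_def by simp
    have plim: "(\<lambda>n. p (real (Suc n))) \<longlonglongrightarrow> 0"
      unfolding p_def normal_density_def using \<theta> by real_asymp
    have "(\<lambda>n. P n * (ln (Z / P n) + 1 + ln \<theta> - ln (2 * pi * \<theta>) / 2) - 2 * \<theta> * R * p (real (Suc n)))
       \<longlonglongrightarrow> 1 * (ln (Z / 1) + 1 + ln \<theta> - ln (2 * pi * \<theta>) / 2) - 2 * \<theta> * R * 0"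
      using \<open>Z > 0\<close> by (intro tendsto_intros Plim plim) auto
    moreover have "(\<lambda>n. LBINT y:{- real (Suc n)..real (Suc n)}. p y * (G y + y\<^sup>2 / (2 * \<theta>)))
       \<longlonglongrightarrow> (LBINT y. p y * G y) + 1 / 2"
      using set_integral_Icc_tendsto[OF int2] unfolding val2 .
    moreover have "P n * (ln (Z / P n) + 1 + ln \<theta> - ln (2 * pi * \<theta>) / 2) - 2 * \<theta> * R * p (real (Suc n))
        \<le> (LBINT y:{- real (Suc n)..real (Suc n)}. p y * (G y + y\<^sup>2 / (2 * \<theta>)))" for n
      using te(3)[of "real (Suc n)"] unfolding P_def by simp
    ultimately have "1 * (ln (Z / 1) + 1 + ln \<theta> - ln (2 * pi * \<theta>) / 2) - 2 * \<theta> * R * 0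
        \<le> (LBINT y. p y * G y) + 1 / 2"
      by (intro LIMSEQ_le) auto
    then have "ln Z \<le> (ln (2 * pi) - 1 - ln \<theta>) / 2 + (LBINT y. p y * G y)"
      using \<theta> by (simp add: ln_mult field_simps)
    then show ?thesis
      using \<open>Z > 0\<close> unfolding Z_def R_def by (simp add: ln_le_cancel_iff[symmetric])
  qed
  have "(\<integral>\<^sup>+x. ennreal (exp (u x)) \<partial>lborel) \<le> (\<integral>\<^sup>+x. ennreal (exp (v x)) \<partial>lborel)"
    using u_le by (intro nn_integral_mono) (simp add: ennreal_leI)
  also have "\<dots> \<le> ennreal (exp ((ln (2 * pi) - 1 - ln \<theta>) / 2 + (LBINT y. p y * G y)))"
    using v bound by (intro nn_integral_le_of_Icc) (auto intro!: continuous_intros)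
  finally show ?thesis unfolding p_def .
qed

section \<open>Tensorization\<close>

lemma PiM_insert_pair:
  assumes N: "prob_space N" and I: "finite I" "i \<notin> I"
  shows "AE x in PiM (insert i I) (\<lambda>_. N). Q x
    \<Longrightarrow> AE y in PiM I (\<lambda>_. N). AE t in N. Q (y(i := t))"
    and "integrable (PiM (insert i I) (\<lambda>_. N)) G
    \<Longrightarrow> AE y in PiM I (\<lambda>_. N). integrable N (\<lambda>t. G (y(i := t)))"
    and "integrable (PiM (insert i I) (\<lambda>_. N)) G
    \<Longrightarrow> integrable (PiM I (\<lambda>_. N)) (\<lambda>y. \<integral>t. G (y(i := t)) \<partial>N)"
    and "integrable (PiM (insert i I) (\<lambda>_. N)) (G :: _ \<Rightarrow> real)
    \<Longrightarrow> (\<integral>y. (\<integral>t. G (y(i := t)) \<partial>N) \<partial>PiM I (\<lambda>_. N)) = (\<integral>y. G y \<partial>PiM (insert i I) (\<lambda>_. N))"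
proof -
  interpret N: prob_space N by fact
  interpret P: prob_space "PiM I (\<lambda>_. N)" by (intro prob_space_PiM N)
  interpret NP: pair_sigma_finite N "PiM I (\<lambda>_. N)" ..
  interpret PN: pair_sigma_finite "PiM I (\<lambda>_. N)" N ..
  have eq: "PiM (insert i I) (\<lambda>_. N)
      = distr (N \<Otimes>\<^sub>M PiM I (\<lambda>_. N)) (PiM (insert i I) (\<lambda>_. N)) (\<lambda>(t, y). y(i := t))"
    by (rule distr_pair_PiM_eq_PiM[symmetric]) (use N in auto)
  have meas[measurable]: "(\<lambda>(t, y). y(i := t)) \<in> N \<Otimes>\<^sub>M PiM I (\<lambda>_. N) \<rightarrow>\<^sub>M PiM (insert i I) (\<lambda>_. N)"
    by measurable
  show "AE y in PiM I (\<lambda>_. N). AE t in N. Q (y(i := t))" if "AE x in PiM (insert i I) (\<lambda>_. N). Q x"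
  proof -
    have "AE x in N \<Otimes>\<^sub>M PiM I (\<lambda>_. N). Q ((\<lambda>(t, y). y(i := t)) x)"
      using that by (subst (asm) eq) (rule AE_distrD[OF meas])
    then have "AE x in PiM I (\<lambda>_. N) \<Otimes>\<^sub>M N. Q ((\<lambda>(t, y). y(i := t)) ((\<lambda>(x, y). (y, x)) x))"
      by (subst (asm) NP.distr_pair_swap) (rule AE_distrD[OF measurable_pair_swap'])
    then show ?thesis
      using PN.AE_pair by fastforce
  qed
  assume G: "integrable (PiM (insert i I) (\<lambda>_. N)) G"
  have [measurable]: "G \<in> borel_measurable (PiM (insert i I) (\<lambda>_. N))"
    using G by simp
  have int: "integrable (N \<Otimes>\<^sub>M PiM I (\<lambda>_. N)) (\<lambda>(t, y). G (y(i := t)))"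
    using G by (subst (asm) eq, subst (asm) integrable_distr_eq) (simp_all add: split_def)
  show "AE y in PiM I (\<lambda>_. N). integrable N (\<lambda>t. G (y(i := t)))"
    using NP.AE_integrable_snd[OF int] .
  show "integrable (PiM I (\<lambda>_. N)) (\<lambda>y. \<integral>t. G (y(i := t)) \<partial>N)"
    using NP.integrable_snd[OF int] .
  have "(\<integral>y. (\<integral>t. G (y(i := t)) \<partial>N) \<partial>PiM I (\<lambda>_. N))
      = (\<integral>x. (case x of (t, y) \<Rightarrow> G (y(i := t))) \<partial>(N \<Otimes>\<^sub>M PiM I (\<lambda>_. N)))"
    using NP.integral_snd[OF int] .
  also have "\<dots> = (\<integral>y. G y \<partial>PiM (insert i I) (\<lambda>_. N))"
    by (subst eq, subst integral_distr) (simp_all add: split_def)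
  finally show "(\<integral>y. (\<integral>t. G (y(i := t)) \<partial>N) \<partial>PiM I (\<lambda>_. N)) = (\<integral>y. G y \<partial>PiM (insert i I) (\<lambda>_. N))" .
qed

lemma tensorize_dual_inequality:
  fixes N :: "real measure" and c :: real and u G :: "('i \<Rightarrow> real) \<Rightarrow> real"
  assumes N: "prob_space N"
    and one: "\<And>u G. integrable N G \<Longrightarrow> (AE y in N. \<forall>x. u x + x * y \<le> G y)
      \<Longrightarrow> (\<integral>\<^sup>+x. ennreal (exp (u x)) \<partial>lborel) \<le> ennreal (exp (c + (\<integral>y. G y \<partial>N)))"
    and "finite I"
    and "u \<in> borel_measurable (PiM I (\<lambda>_. lborel))"
    and "integrable (PiM I (\<lambda>_. N)) G"
    and "AE y in PiM I (\<lambda>_. N). \<forall>x\<in>space (PiM I (\<lambda>_. lborel :: real measure)).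
      u x + (\<Sum>i\<in>I. x i * y i) \<le> G y"
  shows "(\<integral>\<^sup>+x. ennreal (exp (u x)) \<partial>PiM I (\<lambda>_. lborel))
    \<le> ennreal (exp (card I * c + (\<integral>y. G y \<partial>PiM I (\<lambda>_. N))))"
  using assms(3-)
proof (induction I arbitrary: u G rule: finite_induct)
  case empty
  \<comment> \<open>The empty product measure is the point mass at the only extensional function on
    the empty set.\<close>
  have "u (\<lambda>_. undefined) \<le> G (\<lambda>_. undefined)"
    using empty.prems(3) unfolding PiM_empty by (simp add: AE_count_space)
  then show ?case
    by (simp add: PiM_empty nn_integral_count_space_finite
        lebesgue_integral_count_space_finite space_PiM ennreal_leI)
next
  case (insert i I)
  interpret N: prob_space N by fact
  interpret P: prob_space "PiM I (\<lambda>_. N)" by (intro prob_space_PiM N)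
  interpret L: product_sigma_finite "\<lambda>_ :: 'i. lborel :: real measure" ..
  note pair = PiM_insert_pair[OF N insert.hyps]
  note u[measurable] = insert.prems(1)
  have sl: "space (PiM I (\<lambda>_. lborel :: real measure)) = Pi\<^sub>E I (\<lambda>_. UNIV)"
    for I :: "'i set"
    by (simp add: space_PiM)
  define F where "F x = (\<integral>\<^sup>+t. ennreal (exp (u (x(i := t)))) \<partial>lborel)" for x
  define G' where "G' y = c + (\<integral>t. G (y(i := t)) \<partial>N)" for y
  have Fmeas[measurable]: "F \<in> borel_measurable (PiM I (\<lambda>_. lborel))"
    unfolding F_def using insert.hyps
    by (intro lborel.borel_measurable_nn_integral) measurable
  have key: "AE y in PiM I (\<lambda>_. N). \<forall>x\<in>space (PiM I (\<lambda>_. lborel)).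
      F x \<le> ennreal (exp (G' y - (\<Sum>j\<in>I. x j * y j)))"
    using pair(1)[OF insert.prems(3)] pair(2)[OF insert.prems(2)]
  proof eventually_elim
    case (elim y)
    show ?case
    proof
      fix x assume x: "x \<in> space (PiM I (\<lambda>_. lborel :: real measure))"
      let ?s = "\<Sum>j\<in>I. x j * y j"
      have "(\<integral>\<^sup>+t. ennreal (exp (u (x(i := t)))) \<partial>lborel)
          \<le> ennreal (exp (c + (\<integral>t. G (y(i := t)) - ?s \<partial>N)))"
      proof (rule one)
        show "AE t in N. \<forall>xa. u (x(i := xa)) + xa * t \<le> G (y(i := t)) - ?s"
          using elim(1)
        proof eventually_elim
          case (elim t)
          show ?case
          proof
            fix r
            have "x(i := r) \<in> space (PiM (insert i I) (\<lambda>_. lborel :: real measure))"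
              using x by (auto simp: sl PiE_def extensional_def)
            moreover have "(\<Sum>j\<in>insert i I. (x(i := r)) j * (y(i := t)) j) = r * t + ?s"
              using insert.hyps by (auto intro!: sum.cong)
            moreover have "u (x(i := r)) + (\<Sum>j\<in>insert i I. (x(i := r)) j * (y(i := t)) j) \<le> G (y(i := t))"
              using elim calculation(1) by (rule bspec)
            ultimately show "u (x(i := r)) + r * t \<le> G (y(i := t)) - ?s"
              by linarith
          qed
        qed
      qed (intro Bochner_Integration.integrable_diff elim(2) N.integrable_const)
      also have "c + (\<integral>t. G (y(i := t)) - ?s \<partial>N) = G' y - ?s"
        unfolding G'_def using elim(2)
        by (subst Bochner_Integration.integral_diff) (simp_all add: N.prob_space del: fun_upd_apply)
      finally show "F x \<le> ennreal (exp (G' y - ?s))"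
        unfolding F_def .
    qed
  qed
  \<comment> \<open>A single good y already bounds \<open>F\<close> at every x. So \<open>F\<close>
    is finite everywhere, as it must be before its logarithm is taken.\<close>
  have "\<exists>y. \<forall>x\<in>space (PiM I (\<lambda>_. lborel)). F x \<le> ennreal (exp (G' y - (\<Sum>j\<in>I. x j * y j)))"
  proof (rule ccontr)
    assume "\<not> ?thesis"
    then have "AE y in PiM I (\<lambda>_. N). \<not> (\<forall>x\<in>space (PiM I (\<lambda>_. lborel)).
        F x \<le> ennreal (exp (G' y - (\<Sum>j\<in>I. x j * y j))))"
      by simp
    then show False by (rule P.AE_contr[OF key])
  qed
  then obtain y0 where y0: "\<And>x. x \<in> space (PiM I (\<lambda>_. lborel)) \<Longrightarrow>
      F x \<le> ennreal (exp (G' y0 - (\<Sum>j\<in>I. x j * y0 j)))"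
    by blast
  have fin: "F x < \<infinity>" if "x \<in> space (PiM I (\<lambda>_. lborel))" for x
    using y0[OF that] by (simp add: order_le_less_trans)
  have pos: "F x > 0" if x: "x \<in> space (PiM I (\<lambda>_. lborel))" for x
  proof -
    have [measurable]: "(\<lambda>t. u (x(i := t))) \<in> borel_measurable lborel"
      using measurable_comp[OF measurable_component_update[OF x \<open>i \<notin> I\<close>] u] by (simp add: comp_def)
    have "F x \<noteq> 0"
      unfolding F_def using not_AE_lborel_False
      by (subst nn_integral_0_iff_AE) auto
    then show ?thesis by (simp add: zero_less_iff_neq_zero)
  qed
  define U where "U x = ln (enn2real (F x))" for x
  have expU: "ennreal (exp (U x)) = F x" if "x \<in> space (PiM I (\<lambda>_. lborel))" for x
    using fin[OF that] pos[OF that] unfolding U_def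
    by (simp add: enn2real_positive_iff)
  have "(\<integral>\<^sup>+x. ennreal (exp (u x)) \<partial>PiM (insert i I) (\<lambda>_. lborel)) = (\<integral>\<^sup>+x. F x \<partial>PiM I (\<lambda>_. lborel))"
    unfolding F_def using insert.hyps by (intro L.product_nn_integral_insert) auto
  also have "\<dots> = (\<integral>\<^sup>+x. ennreal (exp (U x)) \<partial>PiM I (\<lambda>_. lborel))"
    by (intro nn_integral_cong) (simp add: expU)
  also have "\<dots> \<le> ennreal (exp (card I * c + (\<integral>y. G' y \<partial>PiM I (\<lambda>_. N))))"
  proof (rule insert.IH)
    show "U \<in> borel_measurable (PiM I (\<lambda>_. lborel))"
      unfolding U_def by measurable
    show "integrable (PiM I (\<lambda>_. N)) G'"
      unfolding G'_def
      by (intro Bochner_Integration.integrable_add pair(3)[OF insert.prems(2)] P.integrable_const)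
    show "AE y in PiM I (\<lambda>_. N). \<forall>x\<in>space (PiM I (\<lambda>_. lborel)). U x + (\<Sum>i\<in>I. x i * y i) \<le> G' y"
      using key
    proof eventually_elim
      case (elim y)
      show ?case
      proof
        fix x assume x: "x \<in> space (PiM I (\<lambda>_. lborel :: real measure))"
        have "ennreal (exp (U x)) \<le> ennreal (exp (G' y - (\<Sum>j\<in>I. x j * y j)))"
          using elim x expU by simp
        then show "U x + (\<Sum>i\<in>I. x i * y i) \<le> G' y"
          by simp
      qed
    qed
  qed
  also have "(\<integral>y. G' y \<partial>PiM I (\<lambda>_. N)) = c + (\<integral>y. G y \<partial>PiM (insert i I) (\<lambda>_. N))"
    unfolding G'_def using pair(3,4)[OF insert.prems(2)]
    by (subst Bochner_Integration.integral_add) (simp_all add: P.prob_space del: fun_upd_apply)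
  also have "card I * c + (c + (\<integral>y. G y \<partial>PiM (insert i I) (\<lambda>_. N)))
      = card (insert i I) * c + (\<integral>y. G y \<partial>PiM (insert i I) (\<lambda>_. N))"
    using insert.hyps by (simp add: algebra_simps)
  finally show ?case .
qed


section \<open>Gaussian densities as products over the coordinates\<close>

definition gaussian :: "real \<Rightarrow> 'a::euclidean_space \<Rightarrow> real" where
  "gaussian t x = (\<Prod>b\<in>Basis. normal_density 0 (sqrt t) (x \<bullet> b))"

lemma gaussian_measurable [measurable]: "gaussian t \<in> borel_measurable borel"
  unfolding gaussian_def[abs_def] by measurable

lemma gaussian_pos: "t > 0 \<Longrightarrow> gaussian t x > 0"
  unfolding gaussian_def by (intro prod_pos) (simp add: normal_density_pos)

lemma power2_norm_eq_sum: "(norm (x :: 'a::euclidean_space))\<^sup>2 = (\<Sum>b\<in>Basis. (x \<bullet> b)\<^sup>2)"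
  unfolding power2_norm_eq_inner by (subst euclidean_inner) (simp add: power2_eq_square)

lemma gaussian_eq:
  assumes "t > 0"
  shows "gaussian t (x :: 'a::euclidean_space)
    = (2 * pi * t) powr (- (DIM('a) / 2)) * exp (- (norm x)\<^sup>2 / (2 * t))"
proof -
  have "gaussian t x = (\<Prod>b\<in>(Basis :: 'a set). (1 / sqrt (2 * pi * t)) * exp (- (x \<bullet> b)\<^sup>2 / (2 * t)))"
    unfolding gaussian_def normal_density_def using assms by simp
  also have "\<dots> = (1 / sqrt (2 * pi * t)) ^ DIM('a) * exp (\<Sum>b\<in>Basis. - (x \<bullet> b)\<^sup>2 / (2 * t))"
    by (simp only: prod.distrib prod_constant exp_sum finite_Basis)
  also have "(\<Sum>b\<in>Basis. - (x \<bullet> b)\<^sup>2 / (2 * t)) = - (norm x)\<^sup>2 / (2 * t)"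
    by (simp add: power2_norm_eq_sum sum_negf sum_divide_distrib)
  also have "(1 / sqrt (2 * pi * t)) ^ DIM('a) = (2 * pi * t) powr (- (DIM('a) / 2))"
  proof -
    have "(1 / sqrt (2 * pi * t)) ^ DIM('a) = ((2 * pi * t) powr (- (1 / 2))) powr DIM('a)"
      using assms by (simp add: powr_realpow powr_minus_divide powr_half_sqrt)
    then show ?thesis by (simp add: powr_powr)
  qed
  finally show ?thesis .
qed

lemma integral_lborel_PiM:
  fixes f :: "'a::euclidean_space \<Rightarrow> real"
  assumes [measurable]: "f \<in> borel_measurable borel"
  shows "integrable lborel f \<longleftrightarrow> integrable (\<Pi>\<^sub>M b\<in>Basis. lborel) (\<lambda>x. f (\<Sum>b\<in>Basis. x b *\<^sub>R b))"
    and "(\<integral>x. f x \<partial>lborel) = (\<integral>x. f (\<Sum>b\<in>Basis. x b *\<^sub>R b) \<partial>(\<Pi>\<^sub>M b\<in>Basis. lborel))"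
  by (subst lborel_eq, subst integrable_distr_eq; simp)
     (subst lborel_eq, subst integral_distr; simp)

lemma nn_integral_lborel_PiM:
  fixes f :: "'a::euclidean_space \<Rightarrow> ennreal"
  assumes [measurable]: "f \<in> borel_measurable borel"
  shows "(\<integral>\<^sup>+x. f x \<partial>lborel) = (\<integral>\<^sup>+x. f (\<Sum>b\<in>Basis. x b *\<^sub>R b) \<partial>(\<Pi>\<^sub>M b\<in>Basis. lborel))"
  by (subst lborel_eq, subst nn_integral_distr; simp)

lemma integral_lborel_prod:
  fixes f :: "'a::euclidean_space \<Rightarrow> real \<Rightarrow> real"
  assumes "\<And>b. b \<in> (Basis :: 'a set) \<Longrightarrow> integrable lborel (f b)"
  shows "integrable lborel (\<lambda>x :: 'a. \<Prod>b\<in>Basis. f b (x \<bullet> b))"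
    and "(\<integral>x. (\<Prod>b\<in>Basis. f b (x \<bullet> b)) \<partial>(lborel :: 'a measure)) = (\<Prod>b\<in>Basis. \<integral>s. f b s \<partial>lborel)"
proof -
  interpret product_sigma_finite "\<lambda>_ :: 'a. lborel :: real measure" ..
  have [measurable]: "f b \<in> borel_measurable borel" if "b \<in> Basis" for b
    using assms[OF that] by simp
  have meas: "(\<lambda>x :: 'a. \<Prod>b\<in>Basis. f b (x \<bullet> b)) \<in> borel_measurable borel"
    by (intro borel_measurable_prod) simp
  have eq: "(\<Prod>b\<in>(Basis :: 'a set). f b ((\<Sum>b\<in>Basis. x b *\<^sub>R b) \<bullet> b)) = (\<Prod>b\<in>Basis. f b (x b))" for x
    by (intro prod.cong) simp_all
  show "integrable lborel (\<lambda>x :: 'a. \<Prod>b\<in>Basis. f b (x \<bullet> b))"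
    unfolding integral_lborel_PiM(1)[OF meas] eq
    using assms by (intro product_integrable_prod) auto
  show "(\<integral>x. (\<Prod>b\<in>Basis. f b (x \<bullet> b)) \<partial>(lborel :: 'a measure)) = (\<Prod>b\<in>Basis. \<integral>s. f b s \<partial>lborel)"
    unfolding integral_lborel_PiM(2)[OF meas] eq
    using assms by (intro product_integral_prod) auto
qed

lemma PiM_density_lborel:
  fixes p :: "real \<Rightarrow> real"
  assumes p[measurable]: "p \<in> borel_measurable borel" and nn: "\<And>x. p x \<ge> 0"
    and prob: "prob_space (density lborel (\<lambda>x. ennreal (p x)))" and I: "finite I"
  shows "PiM I (\<lambda>_. density lborel (\<lambda>x. ennreal (p x)))
    = density (PiM I (\<lambda>_. lborel)) (\<lambda>x. ennreal (\<Prod>i\<in>I. p (x i)))"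
proof -
  interpret N: prob_space "density lborel (\<lambda>x. ennreal (p x))" by fact
  interpret P: product_sigma_finite "\<lambda>_. density lborel (\<lambda>x. ennreal (p x))" ..
  interpret L: product_sigma_finite "\<lambda>_ :: 'a. lborel :: real measure" ..
  show ?thesis
  proof (rule P.PiM_eqI[symmetric])
    show "sets (density (PiM I (\<lambda>_. lborel)) (\<lambda>x. ennreal (\<Prod>i\<in>I. p (x i))))
      = sets (PiM I (\<lambda>_. density lborel (\<lambda>x. ennreal (p x))))"
      by (simp cong: sets_PiM_cong)
    fix A :: "'a \<Rightarrow> real set" assume A: "\<And>i. i \<in> I \<Longrightarrow> A i \<in> sets (density lborel (\<lambda>x. ennreal (p x)))"
    then have [measurable]: "A i \<in> sets borel" if "i \<in> I" for i using that by simp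
    have "Pi\<^sub>E I A \<in> sets (PiM I (\<lambda>_. lborel))"
      using I by (intro sets_PiM_I_finite) auto
    moreover have "(\<lambda>x. ennreal (\<Prod>i\<in>I. p (x i))) \<in> borel_measurable (PiM I (\<lambda>_. lborel))"
      by measurable
    ultimately have "emeasure (density (PiM I (\<lambda>_. lborel)) (\<lambda>x. ennreal (\<Prod>i\<in>I. p (x i)))) (Pi\<^sub>E I A)
      = (\<integral>\<^sup>+x. ennreal (\<Prod>i\<in>I. p (x i)) * indicator (Pi\<^sub>E I A) x \<partial>PiM I (\<lambda>_. lborel))"
      by (subst emeasure_density) auto
    also have "\<dots> = (\<integral>\<^sup>+x. (\<Prod>i\<in>I. ennreal (p (x i)) * indicator (A i) (x i)) \<partial>PiM I (\<lambda>_. lborel))"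
    proof (rule nn_integral_cong)
      fix x assume x: "x \<in> space (PiM I (\<lambda>_. lborel :: real measure))"
      have "indicator (Pi\<^sub>E I A) x = (\<Prod>i\<in>I. indicator (A i) (x i) :: ennreal)"
        using I x by (induction I) (auto simp: indicator_def space_PiM PiE_def Pi_def)
      then show "ennreal (\<Prod>i\<in>I. p (x i)) * indicator (Pi\<^sub>E I A) x
        = (\<Prod>i\<in>I. ennreal (p (x i)) * indicator (A i) (x i))"
        by (simp add: prod.distrib prod_ennreal nn)
    qed
    also have "\<dots> = (\<Prod>i\<in>I. \<integral>\<^sup>+x. ennreal (p x) * indicator (A i) x \<partial>lborel)"
      using I by (intro L.product_nn_integral_prod) auto
    also have "\<dots> = (\<Prod>i\<in>I. emeasure (density lborel (\<lambda>x. ennreal (p x))) (A i))"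
      by (intro prod.cong refl, subst emeasure_density) auto
    finally show "emeasure (density (PiM I (\<lambda>_. lborel)) (\<lambda>x. ennreal (\<Prod>i\<in>I. p (x i)))) (Pi\<^sub>E I A)
      = (\<Prod>i\<in>I. emeasure (density lborel (\<lambda>x. ennreal (p x))) (A i))" .
  qed (fact I)
qed

theorem transport_entropy:
  fixes u G :: "'a::euclidean_space \<Rightarrow> real"
  assumes \<theta>: "\<theta> > 0"
    and u[measurable]: "u \<in> borel_measurable borel" and Gm[measurable]: "G \<in> borel_measurable borel"
    and G: "integrable lborel (\<lambda>y. gaussian \<theta> y * G y)"
    and le: "\<And>x y. u x + x \<bullet> y \<le> G y"
  shows "(\<integral>\<^sup>+x. ennreal (exp (u x)) \<partial>lborel)
    \<le> ennreal (exp (DIM('a) * ((ln (2 * pi) - 1 - ln \<theta>) / 2) + (\<integral>y. gaussian \<theta> y * G y \<partial>lborel)))"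
proof -
  define p where "p = normal_density 0 (sqrt \<theta>)"
  define N where "N = density lborel (\<lambda>x. ennreal (p x))"
  define L where "L = PiM (Basis :: 'a set) (\<lambda>_. lborel :: real measure)"
  \<comment> \<open>Coordinate functions become vectors; \<open>lborel\<close> is the image of the
    product measure under \<open>s\<close>.\<close>
  define s :: "('a \<Rightarrow> real) \<Rightarrow> 'a" where "s x = (\<Sum>b\<in>Basis. x b *\<^sub>R b)" for x
  have [measurable]: "p \<in> borel_measurable borel" unfolding p_def by simp
  have pnn: "p x \<ge> 0" for x unfolding p_def by simp
  have N: "prob_space N" unfolding N_def p_def using \<theta> by (intro prob_space_normal_density) simp
  have PN: "PiM Basis (\<lambda>_. N) = density L (\<lambda>x. ennreal (\<Prod>b\<in>Basis. p (x b)))"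
    unfolding N_def L_def using N pnn by (intro PiM_density_lborel) (auto simp: N_def)
  have s[measurable]: "s \<in> L \<rightarrow>\<^sub>M borel" unfolding s_def L_def by measurable
  have gs: "gaussian \<theta> (s x) = (\<Prod>b\<in>Basis. p (x b))" for x
    unfolding gaussian_def s_def p_def by (intro prod.cong) simp_all
  have [measurable]: "(\<lambda>x. \<Prod>b\<in>Basis. p (x b)) \<in> borel_measurable L"
    unfolding L_def by measurable
  have int: "integrable (PiM Basis (\<lambda>_. N)) (\<lambda>x. G (s x))"
    using G unfolding PN
    by (subst integrable_density) (auto simp: integral_lborel_PiM(1) gs[symmetric] less_imp_le gaussian_pos \<theta> L_def s_def)
  have val: "(\<integral>x. G (s x) \<partial>PiM Basis (\<lambda>_. N)) = (\<integral>y. gaussian \<theta> y * G y \<partial>lborel)"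
    unfolding PN
    by (subst integral_density) (auto simp: integral_lborel_PiM(2) gs[symmetric] less_imp_le gaussian_pos \<theta> L_def s_def)
  have "(\<integral>\<^sup>+x. ennreal (exp (u x)) \<partial>lborel) = (\<integral>\<^sup>+x. ennreal (exp (u (s x))) \<partial>L)"
    unfolding L_def s_def by (subst nn_integral_lborel_PiM) auto
  also have "\<dots> \<le> ennreal (exp (card (Basis :: 'a set) * ((ln (2 * pi) - 1 - ln \<theta>) / 2) + (\<integral>x. G (s x) \<partial>PiM Basis (\<lambda>_. N))))"
    unfolding L_def
  proof (rule tensorize_dual_inequality[OF N])
    fix u G :: "real \<Rightarrow> real"
    assume G: "integrable N G" and le: "AE y in N. \<forall>x. u x + x * y \<le> G y"
    have [measurable]: "G \<in> borel_measurable borel"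
      using borel_measurable_integrable[OF G] unfolding N_def by simp
    have p0: "p y > 0" for y unfolding p_def using \<theta> by (simp add: normal_density_pos)
    have "integrable lborel (\<lambda>y. p y * G y)"
      using G unfolding N_def by (subst (asm) integrable_density) (auto simp: pnn)
    moreover have "(\<integral>y. G y \<partial>N) = (LBINT y. p y * G y)"
      unfolding N_def by (subst integral_density) (auto simp: pnn)
    moreover have "AE y in lborel. \<forall>x. u x + x * y \<le> G y"
      using le p0 unfolding N_def by (subst (asm) AE_density) auto
    ultimately show "(\<integral>\<^sup>+x. ennreal (exp (u x)) \<partial>lborel)
        \<le> ennreal (exp ((ln (2 * pi) - 1 - ln \<theta>) / 2 + (\<integral>y. G y \<partial>N)))"
      using transport_entropy_real[OF \<theta>] unfolding p_def by simp
  next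
    show "AE y in PiM Basis (\<lambda>_. N). \<forall>x\<in>space (PiM Basis (\<lambda>_. lborel)).
        u (s x) + (\<Sum>b\<in>Basis. x b * y b) \<le> G (s y)"
    proof (intro AE_I2 ballI)
      fix x y :: "'a \<Rightarrow> real"
      have "s x \<bullet> s y = (\<Sum>b\<in>Basis. x b * y b)"
        unfolding s_def by (subst euclidean_inner) (auto intro!: sum.cong)
      then show "u (s x) + (\<Sum>b\<in>Basis. x b * y b) \<le> G (s y)"
        using le[of "s x" "s y"] by simp
    qed
  qed (use s int in \<open>auto simp: L_def\<close>)
  finally show ?thesis unfolding val .
qed

section \<open>Refinable B-splines\<close>

text \<open>\<open>spl 3\<close> is the centred cubic B-spline, supported in \<open>[-2, 2]\<close>; \<open>spl 2\<close> and \<open>spl 1\<close> are its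
  first two derivatives, and \<open>spl 4\<close> is an antiderivative.\<close>

definition spl :: "nat \<Rightarrow> real \<Rightarrow> real" where
  "spl m x = (max 0 (x + 2) ^ m - 4 * max 0 (x + 1) ^ m + 6 * max 0 x ^ m
    - 4 * max 0 (x - 1) ^ m + max 0 (x - 2) ^ m) / fact m"

lemma spl_cont [continuous_intros]:
  "continuous_on S f \<Longrightarrow> continuous_on S (\<lambda>x. spl m (f x))"
  unfolding spl_def by (intro continuous_intros) auto

lemma spl_measurable [measurable]: "spl m \<in> borel_measurable borel"
  by (intro borel_measurable_continuous_onI continuous_intros)

lemma max_power_deriv:
  fixes x :: real
  assumes "m > 0"
  shows "((\<lambda>x. max 0 x ^ Suc m) has_real_derivative real (Suc m) * max 0 x ^ m) (at x)"
proof -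
  consider "x < 0" | "x > 0" | "x = 0" by linarith
  then show ?thesis
  proof cases
    case 1
    have "((\<lambda>_. 0) has_real_derivative 0) (at x)" by simp
    then have "((\<lambda>x. max 0 x ^ Suc m) has_real_derivative 0) (at x)"
      by (rule has_field_derivative_transform_within_open[where S="{..<0}"]) (use 1 in auto)
    then show ?thesis using 1 assms by (simp add: zero_power del: power_Suc)
  next
    case 2
    have "((\<lambda>x. x ^ Suc m) has_real_derivative real (Suc m) * x ^ m) (at x)"
      using DERIV_pow[of "Suc m" x] by simp
    then have "((\<lambda>x. max 0 x ^ Suc m) has_real_derivative real (Suc m) * x ^ m) (at x)"
      by (rule has_field_derivative_transform_within_open[where S="{0<..}"]) (use 2 in auto)
    then show ?thesis using 2 by (simp del: power_Suc)
  next
    case 3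
    have "((\<lambda>h. \<bar>h\<bar> ^ m) \<longlongrightarrow> \<bar>0 :: real\<bar> ^ m) (at 0)"
      by (intro tendsto_intros)
    then have "((\<lambda>h :: real. \<bar>h\<bar> ^ m) \<longlongrightarrow> 0) (at 0)"
      by (simp only: abs_zero zero_power[OF assms])
    then have "((\<lambda>h. (max 0 h ^ Suc m - max 0 0 ^ Suc m) / h) \<longlongrightarrow> (0 :: real)) (at 0)"
    proof (rule Lim_null_comparison[rotated])
      show "\<forall>\<^sub>F h in at 0. norm ((max 0 h ^ Suc m - max 0 0 ^ Suc m) / h) \<le> \<bar>h :: real\<bar> ^ m"
        by (rule always_eventually) (auto simp: max_def abs_mult power_abs)
    qed
    then show ?thesis using 3 assms by (simp add: DERIV_def zero_power del: power_Suc)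
  qed
qed

lemma spl_deriv:
  assumes "m > 0"
  shows "(spl (Suc m) has_real_derivative spl m x) (at x)"
proof -
  have shift: "((\<lambda>x. max 0 (x + a) ^ Suc m) has_real_derivative real (Suc m) * max 0 (x + a) ^ m) (at x)" for a
    using max_power_deriv[OF assms, of "x + a"] by (simp only: DERIV_shift)
  have "((\<lambda>x. (max 0 (x + 2) ^ Suc m - 4 * max 0 (x + 1) ^ Suc m + 6 * max 0 (x + 0) ^ Suc m
    - 4 * max 0 (x + - 1) ^ Suc m + max 0 (x + - 2) ^ Suc m) / fact (Suc m)) has_real_derivative
     (real (Suc m) * max 0 (x + 2) ^ m - 4 * (real (Suc m) * max 0 (x + 1) ^ m) + 6 * (real (Suc m) * max 0 (x + 0) ^ m)
    - 4 * (real (Suc m) * max 0 (x + - 1) ^ m) + real (Suc m) * max 0 (x + - 2) ^ m) / fact (Suc m)) (at x)"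
    by (intro DERIV_cdivide DERIV_add DERIV_diff DERIV_cmult shift)
  moreover have "(real (Suc m) * max 0 (x + 2) ^ m - 4 * (real (Suc m) * max 0 (x + 1) ^ m) + 6 * (real (Suc m) * max 0 (x + 0) ^ m)
    - 4 * (real (Suc m) * max 0 (x + - 1) ^ m) + real (Suc m) * max 0 (x + - 2) ^ m) / fact (Suc m) = spl m x"
    unfolding spl_def fact_Suc by (simp add: divide_simps) (simp add: algebra_simps)
  ultimately show ?thesis unfolding spl_def[abs_def] by simp
qed

text \<open>To the right of 2 no truncation is active and the formula is a fourth difference of a
  polynomial of degree below four, which vanishes. This fails for m = 4, where the value there is
  1.\<close>

lemma spl_outside:
  assumes "m \<in> {1,2,3}" "\<bar>x\<bar> \<ge> 2"
  shows "spl m x = 0"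
proof (cases "x \<ge> 2")
  case True
  then show ?thesis
    using assms(1) by (auto simp: spl_def max_def power2_eq_square power3_eq_cube algebra_simps)
next
  case False
  then have "max 0 (x + 2) = 0" "max 0 (x + 1) = 0" "max 0 x = 0" "max 0 (x - 1) = 0" "max 0 (x - 2) = 0"
    using assms(2) by auto
  then show ?thesis using assms(1) unfolding spl_def by auto
qed

text \<open>The mask of the cubic B-spline, that is, the coefficients of (1 + z)^4 / 8 centred at 0.
  Only k in \<open>{-2..2}\<close> is meant: for k < -2 the truncation in \<open>nat\<close> yields
  1/8, not 0.\<close>

definition spl_coeff :: "int \<Rightarrow> real" where
  "spl_coeff k = real (4 choose nat (k + 2)) / 8"

lemma spl_coeff_nonneg: "spl_coeff k \<ge> 0"
  by (simp add: spl_coeff_def)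

lemma sum_m2_2: "(\<Sum>k\<in>{-2..2::int}. f k) = f (-2) + f (-1) + f 0 + f 1 + f 2" for f :: "int \<Rightarrow> real"
proof -
  have "{-2..2::int} = {-2,-1,0,1,2}" by auto
  then show ?thesis by simp
qed

lemma sum_spl_coeff: "(\<Sum>k\<in>{-2..2}. spl_coeff k) = 2"
  unfolding sum_m2_2 by (simp add: spl_coeff_def binomial_eq_0 numeral_eq_Suc)

text \<open>The two-scale relation comes from (1 - z^2)^4 = (1 + z)^4 * (1 - z)^4: a fourth
  difference of step 2 is a binomial combination of fourth differences of step 1. Two derivatives of
  x -> 2 * x account for the factor 4 at m = 1.\<close>

lemma spl_refine:
  assumes "m \<in> {1,3}"
  shows "spl m x = (if m = 1 then 4 else 1) * (\<Sum>k\<in>{-2..2}. spl_coeff k * spl m (2 * x - of_int k))"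
proof -
  \<comment> \<open>Every truncation on either side is a value of \<open>q\<close> at an integer;
    those on the left use even integers and are halved.\<close>
  define q where "q i = max 0 (2 * x + i)" for i :: real
  have ev: "max 0 (x + 2) = q 4 / 2" "max 0 (x + 1) = q 2 / 2" "max 0 x = q 0 / 2"
    "max 0 (x - 1) = q (-2) / 2" "max 0 (x - 2) = q (-4) / 2"
    unfolding q_def by (simp_all add: max_def)
  have c: "spl_coeff (-2) = 1/8" "spl_coeff (-1) = 4/8" "spl_coeff 0 = 6/8" "spl_coeff 1 = 4/8" "spl_coeff 2 = 1/8"
    by (simp_all add: spl_coeff_def numeral_eq_Suc)
  have od: "spl m (2 * x - of_int k) = (q (2 - of_int k) ^ m - 4 * q (1 - of_int k) ^ m + 6 * q (- of_int k) ^ m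
    - 4 * q (- 1 - of_int k) ^ m + q (- 2 - of_int k) ^ m) / fact m" for k
    unfolding spl_def q_def by (simp add: algebra_simps)
  have l: "spl m x = ((q 4 / 2) ^ m - 4 * (q 2 / 2) ^ m + 6 * (q 0 / 2) ^ m - 4 * (q (-2) / 2) ^ m + (q (-4) / 2) ^ m) / fact m"
    unfolding spl_def ev ..
  show ?thesis
    using assms unfolding l sum_m2_2 c od
    by (auto simp: power_divide fact_numeral) (simp_all add: field_simps)
qed

lemma spl_integral:
  assumes "\<And>x. (F has_real_derivative f x * spl m x) (at x)" "continuous_on UNIV f" "m \<in> {1,2,3}"
  shows "integrable lborel (\<lambda>x. f x * spl m x)" "(\<integral>x. f x * spl m x \<partial>lborel) = F 2 - F (-2)"
proof -
  have eq: "(f x * spl m x) * indicator {-2..2} x = f x * spl m x" for x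
    using spl_outside[OF assms(3), of x] by (cases "\<bar>x\<bar> \<ge> 2") (auto simp: indicator_def)
  have "has_bochner_integral lborel (\<lambda>x. (f x * spl m x) * indicator {-2..2} x) (F 2 - F (-2))"
    using assms(1) continuous_on_mult[OF assms(2) spl_cont[OF continuous_on_id, of UNIV m]]
    by (intro has_bochner_integral_FTC_Icc_real) (auto simp: continuous_on_eq_continuous_at)
  then show "integrable lborel (\<lambda>x. f x * spl m x)" "(\<integral>x. f x * spl m x \<partial>lborel) = F 2 - F (-2)"
    unfolding eq by (auto simp: has_bochner_integral_iff)
qed

lemma spl_integrable:
  assumes "continuous_on UNIV f" "m \<in> {1,2,3}"
  shows "integrable lborel (\<lambda>x. f x * spl m x)"
proof -
  obtain F where "\<And>x. (F has_real_derivative f x * spl m x) (at x)"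
    using continuous_antiderivative[of "\<lambda>x. f x * spl m x"] continuous_on_mult[OF assms(1) spl_cont[OF continuous_on_id, of UNIV m]]
    by blast
  from spl_integral(1)[OF this assms] show ?thesis .
qed

text \<open>Each integrand has an explicit primitive found by integration by parts. At -2 and 2 the
  functions \<open>spl 2\<close> and \<open>spl 3\<close> vanish, while \<open>spl 4\<close> rises
  from 0 to 1. Thus \<open>spl 1\<close>, being a second derivative, annihilates affine functions
  and sends x^2 to 2.\<close>

lemma spl_moments:
  "(\<integral>x. spl 3 x \<partial>lborel) = 1"
  "(\<integral>x. spl 1 x \<partial>lborel) = 0"
  "(\<integral>x. x * spl 1 x \<partial>lborel) = 0"
  "(\<integral>x. x\<^sup>2 * spl 1 x \<partial>lborel) = 2"
proof -
  have d: "(spl 2 has_real_derivative spl 1 x) (at x)" "(spl 3 has_real_derivative spl 2 x) (at x)"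
     "(spl 4 has_real_derivative spl 3 x) (at x)" for x
    using spl_deriv[of 1 x] spl_deriv[of 2 x] spl_deriv[of 3 x] by (simp_all add: numeral_eq_Suc)
  have z: "spl 2 2 = 0" "spl 2 (-2) = 0" "spl 3 2 = 0" "spl 3 (-2) = 0"
    using spl_outside[of 2 2] spl_outside[of 2 "-2"] spl_outside[of 3 2] spl_outside[of 3 "-2"] by auto
  have z4: "spl 4 2 = 1" "spl 4 (-2) = 0"
    by (simp_all add: spl_def fact_numeral max_def)
  show "(\<integral>x. spl 3 x \<partial>lborel) = 1"
    using spl_integral(2)[of "spl 4" "\<lambda>_. 1" 3] d z4 by simp
  show "(\<integral>x. spl 1 x \<partial>lborel) = 0"
    using spl_integral(2)[of "spl 2" "\<lambda>_. 1" 1] d z by simp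
  show "(\<integral>x. x * spl 1 x \<partial>lborel) = 0"
    by (subst spl_integral(2)[of "\<lambda>x. x * spl 2 x - spl 3 x" "\<lambda>x. x" 1])
       (auto intro!: derivative_eq_intros d continuous_intros simp: z)
  show "(\<integral>x. x\<^sup>2 * spl 1 x \<partial>lborel) = 2"
    by (subst spl_integral(2)[of "\<lambda>x. x\<^sup>2 * spl 2 x - 2 * x * spl 3 x + 2 * spl 4 x" "\<lambda>x. x\<^sup>2" 1])
       (auto intro!: derivative_eq_intros d continuous_intros simp: z z4 algebra_simps power2_eq_square)
qed

text \<open>The Laplacian of the tensor product of cubic B-splines (\<open>spl_kernel\<close> below).\<close>

definition lap_kernel :: "'a::euclidean_space \<Rightarrow> real" where
  "lap_kernel z = (\<Sum>i\<in>Basis. \<Prod>b\<in>Basis. spl (if b = i then 1 else 3) (z \<bullet> b))"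

lemma lap_kernel_cont: "continuous_on S lap_kernel"
  unfolding lap_kernel_def[abs_def] by (intro continuous_intros)

lemma lap_kernel_measurable [measurable]: "lap_kernel \<in> borel_measurable borel"
  by (intro borel_measurable_continuous_onI lap_kernel_cont)

lemma lap_kernel_outside:
  assumes "b \<in> Basis" "\<bar>z \<bullet> b\<bar> \<ge> 2"
  shows "lap_kernel z = 0"
  unfolding lap_kernel_def using assms
  by (intro sum.neutral ballI) (auto intro!: prod_zero bexI[of _ b] spl_outside)

lemma norm_le_of_Basis:
  fixes z :: "'a::euclidean_space"
  assumes "\<And>b. b \<in> Basis \<Longrightarrow> \<bar>z \<bullet> b\<bar> \<le> c"
  shows "norm z \<le> c * DIM('a)"
proof -
  have "norm z \<le> (\<Sum>b\<in>Basis. \<bar>z \<bullet> b\<bar>)" by (rule norm_le_l1)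
  also have "\<dots> \<le> (\<Sum>b\<in>(Basis :: 'a set). c)" using assms by (intro sum_mono) auto
  finally show ?thesis by (simp add: mult.commute)
qed

lemma lap_kernel_support:
  assumes "lap_kernel (z :: 'a::euclidean_space) \<noteq> 0"
  shows "norm z \<le> 2 * DIM('a)"
  using norm_le_of_Basis[of z 2] lap_kernel_outside[of _ z] assms by force

lemma integrable_compact_support:
  fixes F k :: "'a::euclidean_space \<Rightarrow> real"
  assumes "continuous_on UNIV F" "continuous_on UNIV k" "\<And>z. k z \<noteq> 0 \<Longrightarrow> norm z \<le> R"
  shows "integrable lborel (\<lambda>z. F z * k z)"
proof -
  have "integrable lborel (\<lambda>z. indicator (cball 0 R) z *\<^sub>R (F z * k z))"
    using assms(1,2) by (intro borel_integrable_compact continuous_on_mult) (auto intro: continuous_on_subset)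
  moreover have "indicator (cball 0 R) z *\<^sub>R (F z * k z) = F z * k z" for z
    using assms(3)[of z] by (cases "k z = 0") (simp_all add: indicator_def)
  ultimately show ?thesis by (simp only:)
qed

lemma lap_kernel_integrable:
  fixes F :: "'a::euclidean_space \<Rightarrow> real"
  assumes "continuous_on UNIV F"
  shows "integrable lborel (\<lambda>z. F z * lap_kernel z)"
  using assms lap_kernel_cont lap_kernel_support by (rule integrable_compact_support)

lemma integral_lborel_affine:
  fixes F :: "'a::euclidean_space \<Rightarrow> real"
  assumes "c > 0" and [measurable]: "F \<in> borel_measurable borel"
  shows "(\<integral>z. F z \<partial>lborel) = c ^ DIM('a) * (\<integral>w. F (t + c *\<^sub>R w) \<partial>lborel)"
proof -
  have "(\<integral>z. F z \<partial>lborel) = (\<integral>z. F z \<partial>density (distr lborel borel (\<lambda>x. t + c *\<^sub>R x)) (\<lambda>x. ennreal (\<bar>c\<bar> ^ DIM('a))))"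
    using lborel_affine[of c t] assms(1) by simp
  also have "\<dots> = c ^ DIM('a) * (\<integral>w. F (t + c *\<^sub>R w) \<partial>lborel)"
    using assms(1) by (subst integral_density) (auto simp: integral_distr)
  finally show ?thesis .
qed

text \<open>Multiply the two-scale relations over the coordinates. Every summand of the kernel has
  exactly one factor \<open>spl 1\<close>, so the factor 4 is common to all of them.\<close>

lemma lap_kernel_refine:
  fixes z :: "'a::euclidean_space"
  shows "lap_kernel z = 4 * (\<Sum>g\<in>Basis \<rightarrow>\<^sub>E {-2..2}. (\<Prod>b\<in>Basis. spl_coeff (g b))
    * lap_kernel (2 *\<^sub>R z - (\<Sum>b\<in>Basis. of_int (g b) *\<^sub>R b)))"
proof -
  let ?m = "\<lambda>i b :: 'a. if b = i then 1 else 3 :: nat"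
  have "(\<Prod>b\<in>Basis. spl (?m i b) (z \<bullet> b)) = 4 * (\<Sum>g\<in>Basis \<rightarrow>\<^sub>E {-2..2}. (\<Prod>b\<in>Basis. spl_coeff (g b)) *
     (\<Prod>b\<in>Basis. spl (?m i b) ((2 *\<^sub>R z - (\<Sum>b\<in>Basis. of_int (g b) *\<^sub>R b)) \<bullet> b)))" if i: "i \<in> Basis" for i
  proof -
    have "(\<Prod>b\<in>Basis. spl (?m i b) (z \<bullet> b))
      = (\<Prod>b\<in>Basis. (if b = i then 4 else 1) * (\<Sum>k\<in>{-2..2}. spl_coeff k * spl (?m i b) (2 * (z \<bullet> b) - of_int k)))"
      by (intro prod.cong refl, subst spl_refine) auto
    also have "\<dots> = 4 * (\<Prod>b\<in>Basis. \<Sum>k\<in>{-2..2}. spl_coeff k * spl (?m i b) (2 * (z \<bullet> b) - of_int k))"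
      using i by (simp add: prod.distrib)
    also have "(\<Prod>b\<in>Basis. \<Sum>k\<in>{-2..2}. spl_coeff k * spl (?m i b) (2 * (z \<bullet> b) - of_int k))
      = (\<Sum>g\<in>Basis \<rightarrow>\<^sub>E {-2..2}. \<Prod>b\<in>Basis. spl_coeff (g b) * spl (?m i b) (2 * (z \<bullet> b) - of_int (g b)))"
      by (rule prod_sum_PiE) auto
    also have "\<dots> = (\<Sum>g\<in>Basis \<rightarrow>\<^sub>E {-2..2}. (\<Prod>b\<in>Basis. spl_coeff (g b)) *
       (\<Prod>b\<in>Basis. spl (?m i b) ((2 *\<^sub>R z - (\<Sum>b\<in>Basis. of_int (g b) *\<^sub>R b)) \<bullet> b)))"
      by (simp add: prod.distrib inner_diff_left)
    finally show ?thesis .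
  qed
  then show ?thesis
    unfolding lap_kernel_def sum_distrib_left by (subst sum.swap, intro sum.cong) auto
qed

lemma sum_prod_spl_coeff:
  "(\<Sum>g\<in>Basis \<rightarrow>\<^sub>E {-2..2}. \<Prod>b\<in>(Basis :: 'a::euclidean_space set). spl_coeff (g b)) = 2 ^ DIM('a)"
  by (subst prod_sum_PiE[symmetric]) (auto simp: sum_spl_coeff)

text \<open>In the summand belonging to direction i, the factor \<open>spl 1\<close> has vanishing
  moments of order 0 and 1. A monomial of degree at most two therefore survives only if it is the
  square of coordinate i.\<close>

lemma lap_kernel_moments:
  fixes l m :: "'a::euclidean_space"
  shows "(\<integral>z. lap_kernel z \<partial>(lborel :: 'a measure)) = 0"
    and "l \<in> Basis \<Longrightarrow> (\<integral>z. (z \<bullet> l) * lap_kernel z \<partial>lborel) = 0"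
    and "l \<in> Basis \<Longrightarrow> m \<in> Basis \<Longrightarrow> (\<integral>z. (z \<bullet> l) * (z \<bullet> m) * lap_kernel z \<partial>lborel) = (if l = m then 2 else 0)"
proof -
  have I: "integrable lborel (\<lambda>s. s ^ e * spl k s)" if "k \<in> {1,3}" for e k
    using that by (intro spl_integrable continuous_intros) auto
  have term0: "(\<integral>z. (\<Prod>b\<in>Basis. (z \<bullet> b) ^ e b * spl (if b = i then 1 else 3) (z \<bullet> b)) \<partial>lborel)
      = (\<Prod>b\<in>Basis. \<integral>s. s ^ e b * spl (if b = i then 1 else 3) s \<partial>lborel)" for e and i :: 'a
    by (rule integral_lborel_prod(2)) (rule I, auto)
  have intg: "integrable lborel (\<lambda>z :: 'a. \<Prod>b\<in>Basis. (z \<bullet> b) ^ e b * spl (if b = i then 1 else 3) (z \<bullet> b))" for e and i :: 'a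
    by (rule integral_lborel_prod(1)) (rule I, auto)
  have main: "(\<integral>z. (\<Prod>b\<in>Basis. (z \<bullet> b) ^ e b) * lap_kernel z \<partial>(lborel :: 'a measure))
      = (\<Sum>i\<in>Basis. \<Prod>b\<in>Basis. \<integral>s. s ^ e b * spl (if b = i then 1 else 3) s \<partial>lborel)" for e :: "'a \<Rightarrow> nat"
    unfolding lap_kernel_def
    by (simp only: sum_distrib_left prod.distrib[symmetric] Bochner_Integration.integral_sum[OF intg] term0)
  have zero: "(\<Prod>b\<in>Basis. \<integral>s. s ^ e b * spl (if b = i then 1 else 3) s \<partial>lborel) = 0"
    if "i \<in> Basis" "e i \<in> {0,1}" for e and i :: 'a
    using that spl_moments by (intro prod_zero bexI[of _ i]) auto
  have pw: "(\<Prod>b\<in>Basis. (z \<bullet> b) ^ (if b = l then 1 else 0)) = z \<bullet> l" if "l \<in> Basis" for l z :: 'a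
    using that by (simp add: if_distrib[of "\<lambda>n. _ ^ n"] cong: if_cong)
  have sum0: "(\<Sum>i\<in>Basis. \<Prod>b\<in>Basis. \<integral>s. s ^ e b * spl (if b = i then 1 else 3) s \<partial>lborel) = 0"
    if "\<And>i. i \<in> Basis \<Longrightarrow> e i \<in> {0,1}" for e :: "'a \<Rightarrow> nat"
    using that by (intro sum.neutral ballI zero)
  show "(\<integral>z. lap_kernel z \<partial>(lborel :: 'a measure)) = 0"
    using main[of "\<lambda>_. 0"]
    by (subst (asm) sum0) auto
  show "(\<integral>z. (z \<bullet> l) * lap_kernel z \<partial>lborel) = 0" if "l \<in> Basis"
    using main[of "\<lambda>b. if b = l then 1 else 0"] unfolding pw[OF that]
    by (subst (asm) sum0) auto
  show "(\<integral>z. (z \<bullet> l) * (z \<bullet> m) * lap_kernel z \<partial>lborel) = (if l = m then 2 else 0)" if lm: "l \<in> Basis" "m \<in> Basis"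
  proof -
    let ?e = "\<lambda>b. (if b = l then 1 else 0) + (if b = m then 1 else 0) :: nat"
    have "(\<Prod>b\<in>Basis. (z \<bullet> b) ^ ?e b) = (z \<bullet> l) * (z \<bullet> m)" for z
      unfolding power_add prod.distrib pw[OF lm(1)] pw[OF lm(2)] ..
    then have eq: "(\<integral>z. (z \<bullet> l) * (z \<bullet> m) * lap_kernel z \<partial>lborel)
      = (\<Sum>i\<in>Basis. \<Prod>b\<in>Basis. \<integral>s. s ^ ?e b * spl (if b = i then 1 else 3) s \<partial>lborel)"
      using main[of ?e] by simp
    show ?thesis
    proof (cases "l = m")
      case False
      then show ?thesis unfolding eq by (subst sum0) auto
    next
      case True
      have "(\<Sum>i\<in>Basis. \<Prod>b\<in>Basis. \<integral>s. s ^ ?e b * spl (if b = i then 1 else 3) s \<partial>lborel)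
        = (\<Sum>i\<in>Basis. if i = l then \<Prod>b\<in>Basis. \<integral>s. s ^ ?e b * spl (if b = l then 1 else 3) s \<partial>lborel else 0)"
        using zero[of _ ?e] True by (intro sum.cong refl) auto
      also have "\<dots> = (\<Prod>b\<in>Basis. \<integral>s. s ^ ?e b * spl (if b = l then 1 else 3) s \<partial>lborel)"
        using lm by simp
      also have "\<dots> = (\<Prod>b\<in>(Basis :: 'a set). if b = l then 2 else 1)"
        using spl_moments(1,4) True by (intro prod.cong refl) (auto simp: numeral_2_eq_2)
      also have "\<dots> = 2" using lm by simp
      finally show ?thesis unfolding eq using True by simp
    qed
  qed
qed

section \<open>Pointwise subharmonicity\<close>

text \<open>By the moments, constant and linear terms drop out, including those created by the
  offset \<open>d\<close>, and the quadratic part contributes only its diagonal. Integrating against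
  the Laplacian of a bump of mass 1 gives the Laplacian of the quadratic polynomial.\<close>

lemma integral_quadratic_lap_kernel:
  fixes A :: "'a::euclidean_space \<Rightarrow> 'a"
  assumes "linear A"
  shows "(\<integral>z. (c + a \<bullet> (d + r *\<^sub>R z) + (A (d + r *\<^sub>R z) \<bullet> (d + r *\<^sub>R z)) / 2) * lap_kernel z \<partial>lborel)
    = r\<^sup>2 * (\<Sum>b\<in>Basis. A b \<bullet> b)"
proof -
  interpret linear A by fact
  define C where "C = c + a \<bullet> d + A d \<bullet> d / 2"
  define w where "w l = r * (a \<bullet> l) + r * (A d \<bullet> l + A l \<bullet> d) / 2" for l
  have Az: "A z = (\<Sum>l\<in>Basis. (z \<bullet> l) *\<^sub>R A l)" for z
    by (subst euclidean_representation[of z, symmetric]) (simp add: sum scale)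
  have lin: "v \<bullet> z = (\<Sum>l\<in>Basis. (z \<bullet> l) * (v \<bullet> l))" for v z :: 'a
    by (subst euclidean_inner) (simp add: mult.commute)
  have "c + a \<bullet> (d + r *\<^sub>R z) + (A (d + r *\<^sub>R z) \<bullet> (d + r *\<^sub>R z)) / 2
    = C + (\<Sum>l\<in>Basis. w l * (z \<bullet> l)) + (\<Sum>l\<in>Basis. \<Sum>m\<in>Basis. (r\<^sup>2 / 2 * (A l \<bullet> m)) * ((z \<bullet> l) * (z \<bullet> m)))" for z
  proof -
    have 1: "(\<Sum>l\<in>Basis. w l * (z \<bullet> l)) = r * (a \<bullet> z) + r * (A d \<bullet> z + A z \<bullet> d) / 2"
      unfolding w_def lin[of a z] lin[of "A d" z] Az[of z]
      by (simp add: sum.distrib sum_distrib_left inner_sum_left algebra_simps add_divide_distrib sum_divide_distrib)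
    have 2: "(\<Sum>l\<in>Basis. \<Sum>m\<in>Basis. (r\<^sup>2 / 2 * (A l \<bullet> m)) * ((z \<bullet> l) * (z \<bullet> m))) = r\<^sup>2 / 2 * (A z \<bullet> z)"
      unfolding Az[of z] inner_sum_left
      by (subst (2) lin) (simp add: lin[of _ z] sum_distrib_left algebra_simps)
    show ?thesis
      unfolding 1 2 C_def
      by (simp add: add scale inner_simps field_simps power2_eq_square)
  qed
  then have "(\<integral>z. (c + a \<bullet> (d + r *\<^sub>R z) + (A (d + r *\<^sub>R z) \<bullet> (d + r *\<^sub>R z)) / 2) * lap_kernel z \<partial>lborel)
    = (\<integral>z. C * lap_kernel z + (\<Sum>l\<in>Basis. w l * ((z \<bullet> l) * lap_kernel z))
      + (\<Sum>l\<in>Basis. \<Sum>m\<in>Basis. (r\<^sup>2 / 2 * (A l \<bullet> m)) * ((z \<bullet> l) * (z \<bullet> m) * lap_kernel z)) \<partial>lborel)"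
    by (intro Bochner_Integration.integral_cong) (auto simp: distrib_right sum_distrib_right mult.assoc)
  also have "\<dots> = C * (\<integral>z. lap_kernel z \<partial>(lborel :: 'a measure)) + (\<Sum>l\<in>Basis. w l * (\<integral>z. (z \<bullet> l) * lap_kernel z \<partial>lborel))
      + (\<Sum>l\<in>Basis. \<Sum>m\<in>Basis. (r\<^sup>2 / 2 * (A l \<bullet> m)) * (\<integral>z. (z \<bullet> l) * (z \<bullet> m) * lap_kernel z \<partial>lborel))"
  proof -
    have i0: "integrable lborel (lap_kernel :: 'a \<Rightarrow> real)"
      using lap_kernel_integrable[of "\<lambda>_. 1"] by simp
    have i1: "integrable lborel (\<lambda>z. (z \<bullet> l) * lap_kernel z)" for l :: 'a
      by (intro lap_kernel_integrable continuous_intros)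
    have i2: "integrable lborel (\<lambda>z. (z \<bullet> l) * (z \<bullet> m) * lap_kernel z)" for l m :: 'a
      by (intro lap_kernel_integrable continuous_intros)
    note ii = i0 i1 i2
    show ?thesis
      by (intro has_bochner_integral_integral_eq has_bochner_integral_add has_bochner_integral_sum
          has_bochner_integral_mult_right has_bochner_integral_integrable ii)
  qed
  also have "\<dots> = (\<Sum>l\<in>Basis. \<Sum>m\<in>Basis. (r\<^sup>2 / 2 * (A l \<bullet> m)) * (if l = m then 2 else 0))"
    by (simp add: lap_kernel_moments)
  also have "\<dots> = r\<^sup>2 * (\<Sum>b\<in>Basis. A b \<bullet> b)"
    by (simp add: sum_distrib_left if_distrib cong: if_cong)
  finally show ?thesis .
qed

text \<open>Second-order Peano expansions with nonnegative trace: the pointwise form of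
  \<open>\<Delta>h \<ge> 0\<close> available for a twice differentiable function.\<close>

definition peano_subharmonic :: "('a::euclidean_space \<Rightarrow> real) \<Rightarrow> bool" where
  "peano_subharmonic h \<longleftrightarrow> (\<forall>x. \<exists>a A. linear A \<and> (\<Sum>b\<in>Basis. A b \<bullet> b) \<ge> 0 \<and>
    (\<forall>\<epsilon>>0. \<exists>\<delta>>0. \<forall>v. norm v < \<delta> \<longrightarrow> \<bar>h (x + v) - (h x + a \<bullet> v + (A v \<bullet> v) / 2)\<bar> \<le> \<epsilon> * (norm v)\<^sup>2))"

text \<open>This is r^2 times the Laplacian at p of h mollified at scale r, with both derivatives
  moved onto the kernel.\<close>

definition lap_mean :: "('a::euclidean_space \<Rightarrow> real) \<Rightarrow> real \<Rightarrow> 'a \<Rightarrow> real" where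
  "lap_mean h r p = (\<integral>z. h (p + r *\<^sub>R z) * lap_kernel z \<partial>lborel)"

text \<open>Insert the two-scale relation and substitute w = 2 * z - s in each term. The Jacobian
  2^(-d) normalises the weights to total mass 1, and the remaining 4 is the ratio of the squared
  scales.\<close>

lemma lap_mean_refine:
  fixes h :: "'a::euclidean_space \<Rightarrow> real"
  assumes h: "continuous_on UNIV h"
  shows "lap_mean h r p = 4 * (\<Sum>g\<in>Basis \<rightarrow>\<^sub>E {-2..2}. (\<Prod>b\<in>Basis. spl_coeff (g b)) / 2 ^ DIM('a)
    * lap_mean h (r / 2) (p + (r / 2) *\<^sub>R (\<Sum>b\<in>Basis. of_int (g b) *\<^sub>R b)))"
proof -
  have [measurable]: "h \<in> borel_measurable borel" using h by (rule borel_measurable_continuous_onI)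
  let ?s = "\<lambda>g. (\<Sum>b\<in>Basis. of_int (g b) *\<^sub>R b) :: 'a"
  have chg: "(\<integral>z. h (p + r *\<^sub>R z) * lap_kernel (2 *\<^sub>R z - s) \<partial>lborel)
     = (1 / 2) ^ DIM('a) * lap_mean h (r / 2) (p + (r / 2) *\<^sub>R s)" for s
    unfolding lap_mean_def
    by (subst integral_lborel_affine[where c="1/2" and t="(1/2) *\<^sub>R s"])
       (auto simp: algebra_simps)
  have int: "integrable lborel (\<lambda>z. h (p + r *\<^sub>R z) * lap_kernel (2 *\<^sub>R z - s))" for s
  proof -
    have "integrable lborel (\<lambda>w. h (p + (r / 2) *\<^sub>R (w + s)) * lap_kernel w)"
      by (intro lap_kernel_integrable continuous_on_compose2[OF h] continuous_intros) auto
    then have "integrable lborel (\<lambda>z. h (p + (r / 2) *\<^sub>R ((- s + 2 *\<^sub>R z) + s)) * lap_kernel (- s + 2 *\<^sub>R z))"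
      by (subst (asm) lborel_affine[of 2 "-s"], simp,
          subst (asm) integrable_density, simp, simp, simp, subst (asm) integrable_distr_eq) auto
    then show ?thesis by (simp add: algebra_simps)
  qed
  have "lap_mean h r p = (\<integral>z. (\<Sum>g\<in>Basis \<rightarrow>\<^sub>E {-2..2}. 4 * (\<Prod>b\<in>Basis. spl_coeff (g b)) *
      (h (p + r *\<^sub>R z) * lap_kernel (2 *\<^sub>R z - ?s g))) \<partial>lborel)"
    unfolding lap_mean_def
    by (subst lap_kernel_refine) (simp add: sum_distrib_left algebra_simps)
  also have "\<dots> = (\<Sum>g\<in>Basis \<rightarrow>\<^sub>E {-2..2}. 4 * (\<Prod>b\<in>Basis. spl_coeff (g b)) *
     ((1 / 2) ^ DIM('a) * lap_mean h (r / 2) (p + (r / 2) *\<^sub>R ?s g)))"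
    using int by (subst Bochner_Integration.integral_sum) (auto simp: chg)
  also have "\<dots> = 4 * (\<Sum>g\<in>Basis \<rightarrow>\<^sub>E {-2..2}. (\<Prod>b\<in>Basis. spl_coeff (g b)) / 2 ^ DIM('a)
    * lap_mean h (r / 2) (p + (r / 2) *\<^sub>R ?s g))"
    by (simp add: sum_distrib_left power_one_over field_simps)
  finally show ?thesis .
qed

text \<open>If every child were above c * (r / 2)^2, then so would be their weighted average, which
  is a quarter of the parent. The displacement bound holds because each coordinate of the shift is
  at most 2 in absolute value before scaling by r / 2.\<close>

lemma lap_mean_child:
  fixes h :: "'a::euclidean_space \<Rightarrow> real"
  assumes h: "continuous_on UNIV h" and r: "r > 0" and le: "lap_mean h r p \<le> c * r\<^sup>2"
  obtains p' where "norm (p' - p) \<le> (r / 2) * (2 * DIM('a))" "lap_mean h (r / 2) p' \<le> c * (r / 2)\<^sup>2"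
proof -
  let ?s = "\<lambda>g. (\<Sum>b\<in>Basis. of_int (g b) *\<^sub>R b) :: 'a"
  let ?w = "\<lambda>g. (\<Prod>b\<in>(Basis :: 'a set). spl_coeff (g b)) / 2 ^ DIM('a)"
  let ?J = "(Basis :: 'a set) \<rightarrow>\<^sub>E {-2..2::int}"
  have fin: "finite ?J" by (intro finite_PiE) auto
  have w1: "(\<Sum>g\<in>?J. ?w g) = 1"
    using sum_prod_spl_coeff[where 'a='a] by (simp add: sum_divide_distrib[symmetric])
  have w0: "?w g \<ge> 0" for g
    by (intro divide_nonneg_pos prod_nonneg) (auto simp: spl_coeff_nonneg)
  have "\<exists>g\<in>?J. lap_mean h (r / 2) (p + (r / 2) *\<^sub>R ?s g) \<le> c * (r / 2)\<^sup>2"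
  proof (rule ccontr)
    assume "\<not> ?thesis"
    then have gt: "c * (r / 2)\<^sup>2 < lap_mean h (r / 2) (p + (r / 2) *\<^sub>R ?s g)" if "g \<in> ?J" for g
      using that by force
    have "\<exists>g\<in>?J. ?w g > 0"
    proof (rule ccontr)
      assume "\<not> (\<exists>g\<in>?J. ?w g > 0)"
      then have "(\<Sum>g\<in>?J. ?w g) \<le> 0" by (intro sum_nonpos) force
      then show False using w1 by simp
    qed
    then obtain g0 where g0: "g0 \<in> ?J" "?w g0 > 0" by blast
    have "c * (r / 2)\<^sup>2 = (\<Sum>g\<in>?J. ?w g * (c * (r / 2)\<^sup>2))"
      unfolding sum_distrib_right[symmetric] w1 by simp
    also have "\<dots> < (\<Sum>g\<in>?J. ?w g * lap_mean h (r / 2) (p + (r / 2) *\<^sub>R ?s g))"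
    proof (rule sum_strict_mono_ex1[OF fin])
      show "\<forall>g\<in>?J. ?w g * (c * (r / 2)\<^sup>2) \<le> ?w g * lap_mean h (r / 2) (p + (r / 2) *\<^sub>R ?s g)"
        using gt w0 by (intro ballI mult_left_mono) (auto intro: less_imp_le)
      show "\<exists>g\<in>?J. ?w g * (c * (r / 2)\<^sup>2) < ?w g * lap_mean h (r / 2) (p + (r / 2) *\<^sub>R ?s g)"
        using g0 gt[OF g0(1)] by (intro bexI[of _ g0] mult_strict_left_mono)
    qed
    also have "\<dots> = lap_mean h r p / 4"
      by (subst (2) lap_mean_refine[OF h]) simp
    finally show False using le by (simp add: power_divide)
  qed
  then obtain g where g: "g \<in> ?J" "lap_mean h (r / 2) (p + (r / 2) *\<^sub>R ?s g) \<le> c * (r / 2)\<^sup>2" by blast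
  have "norm (?s g) \<le> (\<Sum>b\<in>(Basis :: 'a set). norm (of_int (g b) *\<^sub>R b))" by (rule norm_sum)
  also have "\<dots> \<le> (\<Sum>b\<in>(Basis :: 'a set). 2)"
  proof (rule sum_mono)
    fix b :: 'a assume b: "b \<in> Basis"
    then have "g b \<in> {-2..2}" using g(1) by auto
    then show "norm (of_int (g b) *\<^sub>R b) \<le> 2" using b by auto
  qed
  finally have "norm (?s g) \<le> 2 * DIM('a)" by simp
  then have "norm ((p + (r / 2) *\<^sub>R ?s g) - p) \<le> (r / 2) * (2 * DIM('a))"
    using r by (simp add: mult_left_mono)
  then show ?thesis using g(2) that by blast
qed

text \<open>A Goursat-type argument: a negative mean would persist, relative to the squared scale, along a
  nested sequence of supports shrinking to a point, where the Peano expansion contradicts it.\<close>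

lemma lap_mean_nonneg:
  fixes h :: "'a::euclidean_space \<Rightarrow> real"
  assumes h: "continuous_on UNIV h" and sub: "peano_subharmonic h" and r: "r > 0"
  shows "lap_mean h r p \<ge> 0"
proof (rule ccontr)
  assume "\<not> ?thesis"
  then have neg: "lap_mean h r p < 0" by simp
  define c where "c = lap_mean h r p / r\<^sup>2"
  define R where "R = real (2 * DIM('a))"
  have c: "c < 0" using neg r by (simp add: c_def divide_neg_pos)
  have R: "R > 0" unfolding R_def by simp
  define rr where "rr k = r / 2 ^ k" for k :: nat
  have rr: "rr k > 0" for k using r by (simp add: rr_def)
  have rrS: "rr (Suc k) = rr k / 2" for k by (simp add: rr_def)
  have "\<exists>q. \<forall>k. lap_mean h (rr k) (q k) \<le> c * (rr k)\<^sup>2 \<and> norm (q (Suc k) - q k) \<le> rr (Suc k) * R"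
  proof (rule dependent_nat_choice)
    show "\<exists>x. lap_mean h (rr 0) x \<le> c * (rr 0)\<^sup>2"
      using r by (intro exI[of _ p]) (simp add: c_def rr_def)
    fix x k assume "lap_mean h (rr k) x \<le> c * (rr k)\<^sup>2"
    from lap_mean_child[OF h rr this]
    show "\<exists>y. lap_mean h (rr (Suc k)) y \<le> c * (rr (Suc k))\<^sup>2 \<and> norm (y - x) \<le> rr (Suc k) * R"
      unfolding rrS R_def by (metis of_nat_mult of_nat_numeral)
  qed
  then obtain q where q: "\<And>k. lap_mean h (rr k) (q k) \<le> c * (rr k)\<^sup>2"
    "\<And>k. norm (q (Suc k) - q k) \<le> rr (Suc k) * R" by blast
  \<comment> \<open>The centre moves by at most half of the old radius and the radius is halved, so
    the balls are nested.\<close>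
  have sub1: "cball (q (Suc k)) (R * rr (Suc k)) \<subseteq> cball (q k) (R * rr k)" for k
  proof
    fix x assume "x \<in> cball (q (Suc k)) (R * rr (Suc k))"
    then have "dist (q (Suc k)) x \<le> R * rr (Suc k)" by simp
    moreover have "dist (q k) (q (Suc k)) \<le> R * rr (Suc k)"
      using q(2)[of k] by (simp add: dist_norm norm_minus_commute mult.commute)
    ultimately have "dist (q k) x \<le> 2 * (R * rr (Suc k))"
      using dist_triangle[of "q k" x "q (Suc k)"] by linarith
    then show "x \<in> cball (q k) (R * rr k)" by (simp add: rrS)
  qed
  have "decseq (\<lambda>k. cball (q k) (R * rr k))"
    by (rule decseq_SucI) (rule sub1)
  then have "\<Inter> (range (\<lambda>k. cball (q k) (R * rr k))) \<noteq> {}"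
    using mult_nonneg_nonneg[OF less_imp_le[OF R] less_imp_le[OF rr]]
    by (intro compact_nest) (auto simp: decseq_def not_less[symmetric])
  then obtain x where x: "\<And>k. x \<in> cball (q k) (R * rr k)" by blast
  obtain a A where A: "linear A" "(\<Sum>b\<in>Basis. A b \<bullet> b) \<ge> 0"
    and pe: "\<And>\<epsilon>. \<epsilon> > 0 \<Longrightarrow> \<exists>\<delta>>0. \<forall>v. norm v < \<delta> \<longrightarrow>
      \<bar>h (x + v) - (h x + a \<bullet> v + (A v \<bullet> v) / 2)\<bar> \<le> \<epsilon> * (norm v)\<^sup>2"
    using sub unfolding peano_subharmonic_def by blast
  define M where "M = (\<integral>z. \<bar>lap_kernel z\<bar> \<partial>(lborel :: 'a measure))"
  have M: "M \<ge> 0" unfolding M_def by simp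
  \<comment> \<open>On the support of the kernel the Peano error is at most \<epsilon> * (2 * R *
    s)^2, hence at most \<epsilon> * X * s^2 after integration; the summand 1 keeps \<open>X\<close>
    positive. The choice of \<open>\<epsilon>\<close> makes this half of |c| * s^2.\<close>
  define X where "X = 4 * R\<^sup>2 * (M + 1)"
  have X: "X > 0" unfolding X_def using R M by simp
  define \<epsilon> where "\<epsilon> = - c / (2 * X)"
  have \<epsilon>: "\<epsilon> > 0" unfolding \<epsilon>_def using c X by (simp add: divide_neg_pos)
  obtain \<delta> where \<delta>: "\<delta> > 0" "\<And>v. norm v < \<delta> \<Longrightarrow>
      \<bar>h (x + v) - (h x + a \<bullet> v + (A v \<bullet> v) / 2)\<bar> \<le> \<epsilon> * (norm v)\<^sup>2"
    using pe[OF \<epsilon>] by blast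
  have "(\<lambda>k. 2 * R * rr k) \<longlonglongrightarrow> 0"
    unfolding rr_def by real_asymp
  then obtain k where k: "2 * R * rr k < \<delta>"
    using \<delta>(1) by (metis (no_types, lifting) eventually_happens' order_tendstoD(2) sequentially_bot)
  \<comment> \<open>The expansion is centred at the limit point x, whereas the mean is centred at
    \<open>q k\<close>; \<open>d\<close> is the offset, bounded by R * s because x lies in the
    ball.\<close>
  define d where "d = q k - x"
  define s where "s = rr k"
  have s: "s > 0" unfolding s_def by (rule rr)
  have d: "norm d \<le> R * s" using x[of k] by (simp add: d_def s_def dist_norm)
  define T where "T z = h x + a \<bullet> (d + s *\<^sub>R z) + (A (d + s *\<^sub>R z) \<bullet> (d + s *\<^sub>R z)) / 2" for z
  have Acont: "continuous_on S A" for S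
    using A(1) by (simp add: linear_continuous_on linear_conv_bounded_linear)
  have Tcont: "continuous_on UNIV T"
    unfolding T_def by (intro continuous_intros continuous_on_compose2[OF Acont[of UNIV]]) auto
  have hcont: "continuous_on UNIV (\<lambda>z. h (q k + s *\<^sub>R z))"
    by (intro continuous_on_compose2[OF h] continuous_intros) auto
  have i1: "integrable lborel (\<lambda>z. h (q k + s *\<^sub>R z) * lap_kernel z)"
    by (intro lap_kernel_integrable hcont)
  have i2: "integrable lborel (\<lambda>z. T z * lap_kernel z)"
    by (intro lap_kernel_integrable Tcont)
  have i3: "integrable lborel (\<lambda>z. \<bar>lap_kernel z :: real\<bar>)"
    using integrable_abs[OF lap_kernel_integrable[of "\<lambda>_. 1"]] by simp
  have bound: "\<bar>h (q k + s *\<^sub>R z) * lap_kernel z - T z * lap_kernel z\<bar> \<le> \<epsilon> * (2 * R * s)\<^sup>2 * \<bar>lap_kernel z\<bar>" for z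
  proof (cases "lap_kernel z = 0")
    case False
    let ?v = "d + s *\<^sub>R z"
    have "norm z \<le> R" using lap_kernel_support[OF False] by (simp add: R_def)
    then have "norm (s *\<^sub>R z) \<le> R * s" using s by (simp add: mult.commute mult_left_mono)
    then have v: "norm ?v \<le> 2 * R * s" using d norm_triangle_ineq[of d "s *\<^sub>R z"] by simp
    have e: "x + ?v = q k + s *\<^sub>R z" by (simp add: d_def)
    have "norm ?v < \<delta>" using v k by (simp add: s_def)
    from \<delta>(2)[OF this] have "\<bar>h (q k + s *\<^sub>R z) - T z\<bar> \<le> \<epsilon> * (norm ?v)\<^sup>2"
      unfolding T_def e .
    also have "\<dots> \<le> \<epsilon> * (2 * R * s)\<^sup>2"
      using v \<epsilon> by (intro mult_left_mono power_mono) auto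
    finally show ?thesis
      by (simp add: left_diff_distrib[symmetric] abs_mult mult_right_mono)
  qed simp
  have "\<bar>lap_mean h s (q k) - s\<^sup>2 * (\<Sum>b\<in>Basis. A b \<bullet> b)\<bar>
    = \<bar>\<integral>z. h (q k + s *\<^sub>R z) * lap_kernel z - T z * lap_kernel z \<partial>lborel\<bar>"
    unfolding lap_mean_def integral_quadratic_lap_kernel[OF A(1), of "h x" a d s, symmetric] T_def[symmetric]
    by (subst Bochner_Integration.integral_diff[OF i1 i2]) simp
  also have "\<dots> \<le> (\<integral>z. \<bar>h (q k + s *\<^sub>R z) * lap_kernel z - T z * lap_kernel z\<bar> \<partial>lborel)"
    by (rule integral_abs_bound)
  also have "\<dots> \<le> (\<integral>z. \<epsilon> * (2 * R * s)\<^sup>2 * \<bar>lap_kernel z\<bar> \<partial>(lborel :: 'a measure))"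
    using i1 i2 i3 bound by (intro integral_mono) auto
  also have "\<dots> = \<epsilon> * (4 * R\<^sup>2) * M * s\<^sup>2"
    unfolding M_def by (simp add: power_mult_distrib algebra_simps)
  also have "\<dots> \<le> \<epsilon> * (4 * R\<^sup>2) * (M + 1) * s\<^sup>2"
    using \<epsilon> M by (intro mult_right_mono mult_left_mono) auto
  also have "\<dots> = \<epsilon> * X * s\<^sup>2" by (simp add: X_def)
  also have "\<dots> = - c / 2 * s\<^sup>2" unfolding \<epsilon>_def using X by simp
  finally have "lap_mean h s (q k) \<ge> s\<^sup>2 * (\<Sum>b\<in>Basis. A b \<bullet> b) - (- c / 2 * s\<^sup>2)" by linarith
  moreover have "s\<^sup>2 * (\<Sum>b\<in>Basis. A b \<bullet> b) \<ge> 0" using A(2) by simp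
  moreover have "lap_mean h s (q k) \<le> c * s\<^sup>2" using q(1)[of k] by (simp add: s_def)
  moreover have "c * s\<^sup>2 < 0" using c s by (simp add: mult_neg_pos)
  ultimately show False by simp
qed

section \<open>Gaussian means\<close>

text \<open>The normal density of variance t with its normalisation inside the exponent, which makes
  it easy to differentiate in t.\<close>

definition heat_kernel :: "real \<Rightarrow> real \<Rightarrow> real" where
  "heat_kernel t u = exp (- (u\<^sup>2 / (2 * t)) - ln (2 * pi * t) / 2)"

lemma heat_kernel_eq:
  assumes "t > 0"
  shows "normal_density 0 (sqrt t) u = heat_kernel t u"
proof -
  have "sqrt (2 * pi * t) = exp (ln (2 * pi * t) / 2)"
    using assms by (simp add: ln_sqrt[symmetric])
  then show ?thesis
    using assms unfolding heat_kernel_def normal_density_def diff_conv_add_uminus exp_add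
    by (simp add: exp_minus inverse_eq_divide)
qed

text \<open>The first and third formulas together are the heat equation: the derivative in t is half
  the second derivative in u.\<close>

lemma heat_kernel_deriv:
  assumes "t > 0"
  shows "((\<lambda>t. heat_kernel t u) has_real_derivative (u\<^sup>2 / t\<^sup>2 - 1 / t) / 2 * heat_kernel t u) (at t)"
    and "(heat_kernel t has_real_derivative - (u / t) * heat_kernel t u) (at u)"
    and "((\<lambda>u. - (u / t) * heat_kernel t u) has_real_derivative (u\<^sup>2 / t\<^sup>2 - 1 / t) * heat_kernel t u) (at u)"
  unfolding heat_kernel_def using assms
  by (auto intro!: derivative_eq_intros simp: field_simps power2_eq_square)

definition spl_heat :: "nat \<Rightarrow> real \<Rightarrow> real \<Rightarrow> real \<Rightarrow> real" where
  "spl_heat m r t s = (\<integral>w. heat_kernel t (s - r * w) * spl m w \<partial>lborel)"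

lemma heat_kernel_cont [continuous_intros]:
  "continuous_on S f \<Longrightarrow> continuous_on S g \<Longrightarrow> (\<And>x. x \<in> S \<Longrightarrow> f x > 0) \<Longrightarrow>
    continuous_on S (\<lambda>x. heat_kernel (f x) (g x))"
  unfolding heat_kernel_def by (intro continuous_intros) (auto simp: less_imp_neq[symmetric])

text \<open>Passage to gauge integrals over a compact interval, where continuity in a parameter and
  differentiation under the integral sign are applied.\<close>

lemma spl_integral_Icc:
  assumes "continuous_on UNIV f" "m \<in> {1,2,3}"
  shows "(\<integral>w. f w * spl m w \<partial>lborel) = integral (cbox (-2) 2) (\<lambda>w. f w * spl m w)"
proof -
  have eq: "indicator {-2..2} x *\<^sub>R (f x * spl m x) = f x * spl m x" for x
    using spl_outside[OF assms(2), of x] by (cases "\<bar>x\<bar> \<ge> 2") (auto simp: indicator_def)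
  have "set_integrable lborel {-2..2} (\<lambda>w. f w * spl m w)"
    unfolding set_integrable_def eq using assms by (rule spl_integrable)
  from set_borel_integral_eq_integral(2)[OF this] show ?thesis
    unfolding set_lebesgue_integral_def eq by simp
qed

lemma spl_heat_Icc:
  assumes "t > 0" "m \<in> {1,2,3}"
  shows "spl_heat m r t s = integral (cbox (-2) 2) (\<lambda>w. heat_kernel t (s - r * w) * spl m w)"
  unfolding spl_heat_def using assms by (intro spl_integral_Icc continuous_intros) auto

lemma spl_heat_cont_t:
  assumes "m \<in> {1,2,3}"
  shows "continuous_on {0<..} (\<lambda>t. spl_heat m r t s)"
proof -
  have "continuous_on {0<..} (\<lambda>t. integral (cbox (-2) 2) (\<lambda>w. heat_kernel t (s - r * w) * spl m w))"
    by (intro integral_continuous_on_param) (auto simp: split_def intro!: continuous_intros)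
  then show ?thesis
    using assms by (subst continuous_on_cong[OF refl spl_heat_Icc]) auto
qed

lemma spl_heat_cont_r:
  assumes "m \<in> {1,2,3}" "t > 0"
  shows "continuous_on UNIV (\<lambda>r. spl_heat m r t s)"
  unfolding spl_heat_Icc[OF assms(2,1)] using assms(2)
  by (intro integral_continuous_on_param) (auto simp: split_def intro!: continuous_intros)

text \<open>Differentiate under the integral, use the heat equation, and move the two space
  derivatives onto the spline. Each derivative in w of the composed kernel brings out one factor r,
  hence the denominator 2 * r^2.\<close>

lemma spl_heat_deriv:
  assumes t: "t > 0" and r: "r \<noteq> 0"
  shows "((\<lambda>t. spl_heat 3 r t s) has_real_derivative spl_heat 1 r t s / (2 * r\<^sup>2)) (at t)"
proof -
  let ?p = "\<lambda>w. heat_kernel t (s - r * w)"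
  let ?d = "\<lambda>t w. ((s - r * w)\<^sup>2 / t\<^sup>2 - 1 / t) / 2 * heat_kernel t (s - r * w)"
  have "((\<lambda>t. integral (cbox (-2) 2) (\<lambda>w. heat_kernel t (s - r * w) * spl 3 w)) has_real_derivative
      integral (cbox (-2) 2) (\<lambda>w. ?d t w * spl 3 w)) (at t within {0<..})"
  proof (rule leibniz_rule_field_derivative)
    fix x w :: real assume "x \<in> {0<..}"
    then show "((\<lambda>t. heat_kernel t (s - r * w) * spl 3 w) has_real_derivative ?d x w * spl 3 w) (at x within {0<..})"
      using heat_kernel_deriv(1)[of x "s - r * w"]
      by (intro DERIV_cmult_right) (auto intro: has_field_derivative_at_within)
  next
    fix x :: real assume "x \<in> {0<..}"
    then show "(\<lambda>w. heat_kernel x (s - r * w) * spl 3 w) integrable_on cbox (-2) 2"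
      by (intro integrable_continuous continuous_intros) auto
  next
    show "continuous_on ({0<..} \<times> cbox (-2) 2) (\<lambda>(x, w). ?d x w * spl 3 w)"
      by (auto simp: split_def intro!: continuous_intros)
  qed (use t in auto)
  then have "((\<lambda>t. integral (cbox (-2) 2) (\<lambda>w. heat_kernel t (s - r * w) * spl 3 w)) has_real_derivative
      integral (cbox (-2) 2) (\<lambda>w. ?d t w * spl 3 w)) (at t)"
    using t by (simp add: at_within_open[of t "{0<..}"])
  then have 1: "((\<lambda>t. spl_heat 3 r t s) has_real_derivative
      integral (cbox (-2) 2) (\<lambda>w. ?d t w * spl 3 w)) (at t)"
    by (rule has_field_derivative_transform_within_open[where S="{0<..}"]) (use t in \<open>auto simp: spl_heat_Icc\<close>)
  have i2: "integral (cbox (-2) 2) (\<lambda>w. ?d t w * spl 3 w) = (\<integral>w. ?d t w * spl 3 w \<partial>lborel)"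
    using t by (intro spl_integral_Icc[symmetric] continuous_intros) auto
  have dspl: "(spl 2 has_real_derivative spl 1 w) (at w)" "(spl 3 has_real_derivative spl 2 w) (at w)" for w
    using spl_deriv[of 1 w] spl_deriv[of 2 w] by (simp_all add: numeral_eq_Suc)
  have dp: "(?p has_real_derivative r * ((s - r * w) / t * ?p w)) (at w)" for w
  proof -
    have "((\<lambda>w. heat_kernel t (s - r * w)) has_real_derivative
        (- ((s - r * w) / t) * heat_kernel t (s - r * w)) * (- r)) (at w)"
      by (rule DERIV_chain2[where f="heat_kernel t" and g="\<lambda>w. s - r * w"])
         (rule heat_kernel_deriv(2)[OF t], auto intro!: derivative_eq_intros)
    then show ?thesis by (simp add: mult_ac)
  qed
  have dp2: "((\<lambda>w. (s - r * w) / t * ?p w) has_real_derivative r * (2 * ?d t w)) (at w)" for w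
  proof -
    have "((\<lambda>w. - ((s - r * w) / t) * ?p w) has_real_derivative
       (((s - r * w)\<^sup>2 / t\<^sup>2 - 1 / t) * ?p w) * (- r)) (at w)"
      by (rule DERIV_chain2[where f="\<lambda>u. - (u / t) * heat_kernel t u" and g="\<lambda>w. s - r * w"])
         (rule heat_kernel_deriv(3)[OF t], auto intro!: derivative_eq_intros)
    from DERIV_minus[OF this] show ?thesis by (simp add: mult_ac)
  qed
  \<comment> \<open>Green's identity: the primitive of ?p * spl 1 - ?p'' * spl 3, where the primes
    denote derivatives in w. It vanishes at -2 and 2 along with \<open>spl 2\<close> and
    \<open>spl 3\<close>.\<close>
  define F where "F w = ?p w * spl 2 w - r * ((s - r * w) / t * ?p w) * spl 3 w" for w
  have dF: "(F has_real_derivative ?p w * spl 1 w - 2 * r\<^sup>2 * (?d t w * spl 3 w)) (at w)" for w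
    unfolding F_def
    by (rule DERIV_cong[OF DERIV_diff[OF DERIV_mult[OF dp dspl(1)] DERIV_mult[OF DERIV_cmult[OF dp2] dspl(2)]]])
       (simp add: algebra_simps power2_eq_square)
  have "F 2 = 0" "F (-2) = 0"
    unfolding F_def using spl_outside[of 2] spl_outside[of 3] by auto
  have "((\<lambda>w. ?p w * spl 1 w - 2 * r\<^sup>2 * (?d t w * spl 3 w)) has_integral F 2 - F (-2)) {-2..2}"
    using dF by (intro fundamental_theorem_of_calculus)
      (auto simp: has_real_derivative_iff_has_vector_derivative[symmetric] intro: has_field_derivative_at_within)
  then have "integral (cbox (-2) 2) (\<lambda>w. ?p w * spl 1 w - 2 * r\<^sup>2 * (?d t w * spl 3 w)) = 0"
    using \<open>F 2 = 0\<close> \<open>F (-2) = 0\<close> by (simp add: integral_unique)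
  moreover have "integral (cbox (-2) 2) (\<lambda>w. ?p w * spl 1 w - 2 * r\<^sup>2 * (?d t w * spl 3 w))
    = integral (cbox (-2) 2) (\<lambda>w. ?p w * spl 1 w) - 2 * r\<^sup>2 * integral (cbox (-2) 2) (\<lambda>w. ?d t w * spl 3 w)"
  proof -
    have "(\<lambda>w. ?p w * spl 1 w) integrable_on cbox (-2) 2" "(\<lambda>w. ?d t w * spl 3 w) integrable_on cbox (-2) 2"
      using t by (intro integrable_continuous continuous_intros; simp)+
    from Henstock_Kurzweil_Integration.integral_diff[OF this(1) integrable_on_cmult_left[OF this(2), of "2 * r\<^sup>2"]]
    show ?thesis by (simp only: integral_mult_right of_real_eq_id id_apply)
  qed
  ultimately have "integral (cbox (-2) 2) (\<lambda>w. ?d t w * spl 3 w) = spl_heat 1 r t s / (2 * r\<^sup>2)"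
    using r t by (simp add: spl_heat_Icc)
  from 1[unfolded this] show ?thesis .
qed

definition spl_kernel :: "'a::euclidean_space \<Rightarrow> real" where
  "spl_kernel z = (\<Prod>b\<in>Basis. spl 3 (z \<bullet> b))"

lemma gaussian_heat: "t > 0 \<Longrightarrow> gaussian t x = (\<Prod>b\<in>Basis. heat_kernel t (x \<bullet> b))"
  unfolding gaussian_def by (simp add: heat_kernel_eq)

lemma spl_heat_integrable: "t > 0 \<Longrightarrow> m \<in> {1,2,3} \<Longrightarrow> integrable lborel (\<lambda>w. heat_kernel t (s - r * w) * spl m w)"
  by (intro spl_integrable continuous_intros) auto

lemma gaussian_smooth:
  fixes y :: "'a::euclidean_space"
  assumes t: "t > 0"
  shows "(\<integral>z. gaussian t (y - r *\<^sub>R z) * spl_kernel z \<partial>lborel) = (\<Prod>b\<in>Basis. spl_heat 3 r t (y \<bullet> b))"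
    and "(\<integral>z. gaussian t (y - r *\<^sub>R z) * lap_kernel z \<partial>lborel)
      = (\<Sum>i\<in>Basis. spl_heat 1 r t (y \<bullet> i) * (\<Prod>b\<in>Basis - {i}. spl_heat 3 r t (y \<bullet> b)))"
proof -
  have G: "gaussian t (y - r *\<^sub>R z) * (\<Prod>b\<in>Basis. spl (m b) (z \<bullet> b))
    = (\<Prod>b\<in>Basis. heat_kernel t (y \<bullet> b - r * (z \<bullet> b)) * spl (m b) (z \<bullet> b))" for z m
    using t by (simp add: gaussian_heat inner_diff_left prod.distrib)
  have I: "integrable lborel (\<lambda>z. gaussian t (y - r *\<^sub>R z) * (\<Prod>b\<in>Basis. spl (m b) (z \<bullet> b)))"
    and V: "(\<integral>z. gaussian t (y - r *\<^sub>R z) * (\<Prod>b\<in>Basis. spl (m b) (z \<bullet> b)) \<partial>lborel)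
      = (\<Prod>b\<in>Basis. spl_heat (m b) r t (y \<bullet> b))" if "\<And>b. m b \<in> {1,2,3}" for m
    unfolding G spl_heat_def using t that
    by (intro integral_lborel_prod spl_heat_integrable; blast)+
  show "(\<integral>z. gaussian t (y - r *\<^sub>R z) * spl_kernel z \<partial>lborel) = (\<Prod>b\<in>Basis. spl_heat 3 r t (y \<bullet> b))"
    unfolding spl_kernel_def using V[of "\<lambda>_. 3"] by simp
  have "(\<integral>z. gaussian t (y - r *\<^sub>R z) * lap_kernel z \<partial>lborel)
    = (\<Sum>i\<in>Basis. \<Prod>b\<in>Basis. spl_heat (if b = i then 1 else 3) r t (y \<bullet> b))"
    unfolding lap_kernel_def sum_distrib_left using I V
    by (subst Bochner_Integration.integral_sum) auto
  also have "\<dots> = (\<Sum>i\<in>Basis. spl_heat 1 r t (y \<bullet> i) * (\<Prod>b\<in>Basis - {i}. spl_heat 3 r t (y \<bullet> b)))"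
  proof (rule sum.cong[OF refl])
    fix i :: 'a assume "i \<in> Basis"
    then show "(\<Prod>b\<in>Basis. spl_heat (if b = i then 1 else 3) r t (y \<bullet> b))
      = spl_heat 1 r t (y \<bullet> i) * (\<Prod>b\<in>Basis - {i}. spl_heat 3 r t (y \<bullet> b))"
      by (subst prod.remove[of _ i]) (auto intro!: prod.cong)
  qed
  finally show "(\<integral>z. gaussian t (y - r *\<^sub>R z) * lap_kernel z \<partial>lborel)
      = (\<Sum>i\<in>Basis. spl_heat 1 r t (y \<bullet> i) * (\<Prod>b\<in>Basis - {i}. spl_heat 3 r t (y \<bullet> b)))" .
qed

text \<open>The product rule differentiates one coordinate factor at a time, which reassembles
  \<open>lap_kernel\<close>: the mollified Gaussian solves the heat equation with the Laplacian
  acting on the mollifier.\<close>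

lemma gaussian_smooth_deriv:
  fixes y :: "'a::euclidean_space"
  assumes t: "t > 0" and r: "r \<noteq> 0"
  shows "((\<lambda>t. \<Prod>b\<in>Basis. spl_heat 3 r t (y \<bullet> b)) has_real_derivative
    (\<integral>z. gaussian t (y - r *\<^sub>R z) * lap_kernel z \<partial>lborel) / (2 * r\<^sup>2)) (at t)"
  by (rule DERIV_cong[OF has_field_derivative_prod[OF spl_heat_deriv[OF t r]]])
     (simp add: gaussian_smooth(2)[OF t] sum_divide_distrib)

lemma gaussian_smooth_diff:
  fixes y :: "'a::euclidean_space"
  assumes \<theta>: "0 < \<theta>" "\<theta> \<le> 1" and r: "r \<noteq> 0"
  shows "(\<integral>t. ((\<integral>z. gaussian t (y - r *\<^sub>R z) * lap_kernel z \<partial>lborel) / (2 * r\<^sup>2)) * indicator {\<theta>..1} t \<partial>lborel)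
    = (\<integral>z. gaussian 1 (y - r *\<^sub>R z) * spl_kernel z \<partial>lborel) - (\<integral>z. gaussian \<theta> (y - r *\<^sub>R z) * spl_kernel z \<partial>lborel)"
proof -
  have c: "isCont (\<lambda>t. spl_heat m r t s) t" if "t > 0" "m \<in> {1,2,3}" for m t s
    using spl_heat_cont_t[OF that(2)] that(1) by (simp add: continuous_on_eq_continuous_at)
  have "isCont (\<lambda>t. (\<Sum>i\<in>Basis. spl_heat 1 r t (y \<bullet> i) * (\<Prod>b\<in>Basis - {i}. spl_heat 3 r t (y \<bullet> b)))) t" if "t > 0" for t
    using that by (intro continuous_intros c) auto
  then have "isCont (\<lambda>t. \<integral>z. gaussian t (y - r *\<^sub>R z) * lap_kernel z \<partial>lborel) t" if "t > 0" for t
  proof (rule iffD1[OF isCont_cong, rotated])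
    show "\<forall>\<^sub>F t in nhds t. (\<Sum>i\<in>Basis. spl_heat 1 r t (y \<bullet> i) * (\<Prod>b\<in>Basis - {i}. spl_heat 3 r t (y \<bullet> b)))
      = (\<integral>z. gaussian t (y - r *\<^sub>R z) * lap_kernel z \<partial>lborel)"
      using eventually_nhds_in_open[of "{0<..}" t] that by (auto elim!: eventually_mono simp: gaussian_smooth(2))
  qed (fact that)
  then show ?thesis
    using \<theta> r by (subst integral_FTC_Icc_real[OF _ gaussian_smooth_deriv])
      (auto intro!: continuous_intros simp: gaussian_smooth(1))
qed

section \<open>Translation and domination of Gaussian densities\<close>

lemma gaussian_measurable2 [measurable (raw)]:
  "f \<in> borel_measurable M \<Longrightarrow> g \<in> borel_measurable M \<Longrightarrow> (\<lambda>x. gaussian (f x) (g x)) \<in> borel_measurable M"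
  unfolding gaussian_def normal_density_def by simp

lemma gaussian_integrable:
  assumes "t > 0"
  shows "integrable lborel (gaussian t :: 'a::euclidean_space \<Rightarrow> real)" "(\<integral>x. gaussian t x \<partial>(lborel :: 'a measure)) = 1"
  unfolding gaussian_def[abs_def] using assms
  by (subst integral_lborel_prod; simp)+

lemma gaussian_cont: "t > 0 \<Longrightarrow> continuous_on S f \<Longrightarrow> continuous_on S (\<lambda>x. gaussian t (f x))"
  by (simp add: gaussian_heat) (intro continuous_intros; simp)

lemma lborel_translate:
  fixes F :: "'a::euclidean_space \<Rightarrow> real"
  assumes [measurable]: "F \<in> borel_measurable borel"
  shows "integrable lborel (\<lambda>x. F (x + v)) \<longleftrightarrow> integrable lborel F"
    and "(\<integral>x. F (x + v) \<partial>lborel) = (\<integral>x. F x \<partial>lborel)"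
proof -
  show "integrable lborel (\<lambda>x. F (x + v)) \<longleftrightarrow> integrable lborel F"
    by (subst (2) lborel_distr_plus[of v, symmetric], subst integrable_distr_eq) (auto simp: add.commute)
  show "(\<integral>x. F (x + v) \<partial>lborel) = (\<integral>x. F x \<partial>lborel)"
    by (subst (2) lborel_distr_plus[of v, symmetric], subst integral_distr) (auto simp: add.commute)
qed

lemma integrable_pair_mult:
  fixes f :: "'a::euclidean_space \<Rightarrow> real" and g :: "'b::euclidean_space \<Rightarrow> real"
  assumes f: "integrable lborel f" and g: "integrable lborel g"
  shows "integrable (lborel \<Otimes>\<^sub>M lborel) (\<lambda>(x, y). f x * g y)"
proof -
  have [measurable]: "f \<in> borel_measurable borel" "g \<in> borel_measurable borel" using f g by auto
  show ?thesis
  proof (rule lborel_pair.Fubini_integrable)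
    show "integrable lborel (\<lambda>x. \<integral>y. norm (case (x, y) of (x, y) \<Rightarrow> f x * g y) \<partial>lborel)"
      using f by (simp add: abs_mult)
    show "AE x in lborel. integrable lborel (\<lambda>y. case (x, y) of (x, y) \<Rightarrow> f x * g y)"
      using g by simp
  qed measurable
qed

text \<open>Shifting a Gaussian of variance at most 1 by at most \<open>\<rho>\<close> costs a
  factor exp (\<rho> * norm y), which is unbounded. It is absorbed by |h| * E \<le> h^2 + E^2: the
  first term is integrable by hypothesis, and in the second 2 * \<rho> * |y| \<le> 4 * \<rho>^2 +
  |y|^2 / 4 leaves a multiple of the Gaussian of variance 2.\<close>

lemma gaussian_shift_dominated:
  fixes h :: "'a::euclidean_space \<Rightarrow> real"
  assumes h2: "integrable lborel (\<lambda>y. gaussian 1 y * (h y)\<^sup>2)" and \<theta>: "\<theta> > 0" and \<rho>: "\<rho> \<ge> 0"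
  obtains D where "integrable lborel D" "\<And>y. D y \<ge> 0"
    "\<And>t v y. t \<in> {\<theta>..1} \<Longrightarrow> norm v \<le> \<rho> \<Longrightarrow> \<bar>h y\<bar> * gaussian t (y - v) \<le> D y"
proof -
  define C where "C s = (2 * pi * s) powr (- (DIM('a) / 2))" for s
  have C: "C s > 0" if "s > 0" for s unfolding C_def using that by simp
  define D where "D y = C \<theta> / C 1 * (gaussian 1 y * (h y)\<^sup>2) + C \<theta> * exp (4 * \<rho>\<^sup>2) / C 2 * gaussian 2 y" for y
  have "integrable lborel D"
    unfolding D_def using h2 by (intro Bochner_Integration.integrable_add integrable_mult_right gaussian_integrable) auto
  moreover have D0: "D y \<ge> 0" for y
  proof -
    have "gaussian 1 y > 0" "gaussian 2 y > 0" by (simp_all add: gaussian_pos)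
    then show ?thesis
      unfolding D_def using C[of 1] C[of 2] C[OF \<theta>]
      by (intro add_nonneg_nonneg mult_nonneg_nonneg divide_nonneg_nonneg) simp_all
  qed
  moreover have "\<bar>h y\<bar> * gaussian t (y - v) \<le> D y" if t: "t \<in> {\<theta>..1}" and v: "norm v \<le> \<rho>" for t v y
  proof -
    have t0: "t > 0" using t \<theta> by simp
    have "C t \<le> C \<theta>" unfolding C_def using t \<theta> by (intro powr_mono2') auto
    moreover have "- (norm (y - v))\<^sup>2 / (2 * t) \<le> - (norm (y - v))\<^sup>2 / 2"
      using t t0 mult_right_mono[of t 1 "(norm (y - v))\<^sup>2"] by (simp add: field_simps)
    ultimately have g: "gaussian t (y - v) \<le> C \<theta> * exp (- (norm (y - v))\<^sup>2 / 2)"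
      unfolding gaussian_eq[OF t0] C_def[symmetric] using C[OF \<theta>] by (intro mult_mono) auto
    have n: "norm (y - v) \<ge> norm y - \<rho>" using norm_triangle_ineq2[of y v] v by linarith
    have "(norm y)\<^sup>2 - 2 * \<rho> * norm y \<le> (norm (y - v))\<^sup>2"
    proof (cases "norm y \<ge> \<rho>")
      case True
      then have "(norm y - \<rho>)\<^sup>2 \<le> (norm (y - v))\<^sup>2" using n by (intro power_mono) auto
      then have "(norm y)\<^sup>2 + \<rho>\<^sup>2 - 2 * norm y * \<rho> \<le> (norm (y - v))\<^sup>2" by (simp only: power2_diff)
      moreover have "0 \<le> \<rho>\<^sup>2" "2 * norm y * \<rho> = 2 * \<rho> * norm y" by simp_all
      ultimately show ?thesis by linarith
    next
      case False
      then have "norm y * norm y \<le> \<rho> * norm y" using \<rho> by (intro mult_right_mono) auto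
      moreover have "0 \<le> \<rho> * norm y" "0 \<le> (norm (y - v))\<^sup>2" using \<rho> by simp_all
      ultimately show ?thesis
        unfolding power2_eq_square[of "norm y"] by linarith
    qed
    then have "exp (- (norm (y - v))\<^sup>2 / 2) \<le> exp (- (norm y)\<^sup>2 / 2 + \<rho> * norm y)" by simp
    then have "\<bar>h y\<bar> * gaussian t (y - v) \<le> \<bar>h y\<bar> * (C \<theta> * exp (- (norm y)\<^sup>2 / 2 + \<rho> * norm y))"
      using g C[OF \<theta>] by (intro mult_left_mono order_trans[OF g]) auto
    also have "\<dots> = C \<theta> * exp (- (norm y)\<^sup>2 / 2) * (\<bar>h y\<bar> * exp (\<rho> * norm y))"
      unfolding exp_add by (simp only: mult_ac)
    also have "\<bar>h y\<bar> * exp (\<rho> * norm y) \<le> (h y)\<^sup>2 + (exp (\<rho> * norm y))\<^sup>2"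
    proof -
      have "0 \<le> (\<bar>h y\<bar> - exp (\<rho> * norm y))\<^sup>2" by simp
      then have "2 * (\<bar>h y\<bar> * exp (\<rho> * norm y)) \<le> (h y)\<^sup>2 + (exp (\<rho> * norm y))\<^sup>2"
        by (simp add: power2_diff)
      moreover have "0 \<le> \<bar>h y\<bar> * exp (\<rho> * norm y)" by simp
      ultimately show ?thesis by linarith
    qed
    also have "(exp (\<rho> * norm y))\<^sup>2 \<le> exp (4 * \<rho>\<^sup>2) * exp ((norm y)\<^sup>2 / 4)"
    proof -
      have "0 \<le> (norm y / 2 - 2 * \<rho>)\<^sup>2" by simp
      then have "2 * (\<rho> * norm y) \<le> 4 * \<rho>\<^sup>2 + (norm y)\<^sup>2 / 4"
        by (simp add: power2_diff power_divide power_mult_distrib algebra_simps)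
      then show ?thesis by (simp add: exp_add[symmetric] exp_double[symmetric])
    qed
    also have "C \<theta> * exp (- (norm y)\<^sup>2 / 2) * ((h y)\<^sup>2 + exp (4 * \<rho>\<^sup>2) * exp ((norm y)\<^sup>2 / 4)) = D y"
    proof -
      have "exp (- (norm y)\<^sup>2 / 2) * exp ((norm y)\<^sup>2 / 4) = exp (- (norm y)\<^sup>2 / 4)"
        by (simp add: exp_add[symmetric])
      moreover have "gaussian 1 y = C 1 * exp (- (norm y)\<^sup>2 / 2)" "gaussian 2 y = C 2 * exp (- (norm y)\<^sup>2 / 4)"
        unfolding C_def by (simp_all add: gaussian_eq)
      ultimately show ?thesis
        unfolding D_def using C[of 1] C[of 2] by (simp add: distrib_left mult_ac)
    qed
    finally show ?thesis using C[OF \<theta>] by (simp add: mult_left_mono)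
  qed
  ultimately show ?thesis using that by blast
qed

section \<open>Mollified Gaussian means\<close>

lemma spl_kernel_cont: "continuous_on S spl_kernel"
  unfolding spl_kernel_def[abs_def] by (intro continuous_intros)

lemma spl_kernel_support:
  assumes "spl_kernel (z :: 'a::euclidean_space) \<noteq> 0"
  shows "norm z \<le> 2 * DIM('a)"
proof -
  have "\<bar>z \<bullet> b\<bar> \<le> 2" if "b \<in> Basis" for b
  proof -
    have "spl 3 (z \<bullet> b) \<noteq> 0" using assms that by (auto simp: spl_kernel_def)
    then show ?thesis using spl_outside[of 3 "z \<bullet> b"] by force
  qed
  then show ?thesis using norm_le_of_Basis[of z 2] by simp
qed

text \<open>Shared by the mollifiers \<open>spl_kernel\<close> and \<open>lap_kernel\<close>. One
  function \<open>D\<close> controls all variances in \<open>{\<theta>..1}\<close> and all shifts up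
  to the radius of the support, hence all scales r up to 1 at once.\<close>

locale gaussian_smoothing =
  fixes h k :: "'a::euclidean_space \<Rightarrow> real" and D :: "'a \<Rightarrow> real" and \<theta> r :: real
  assumes h_cont: "continuous_on UNIV h" and k_cont: "continuous_on UNIV k"
    and k_supp: "\<And>z. k z \<noteq> 0 \<Longrightarrow> norm z \<le> 2 * DIM('a)"
    and D_int: "integrable lborel D"
    and D: "\<And>t v y. t \<in> {\<theta>..1} \<Longrightarrow> norm v \<le> 2 * DIM('a) \<Longrightarrow> \<bar>h y\<bar> * gaussian t (y - v) \<le> D y"
    and r: "0 < r" "r \<le> 1" and \<theta>: "0 < \<theta>" "\<theta> \<le> 1"
begin

lemma h_meas [measurable]: "h \<in> borel_measurable borel"
  using h_cont by (rule borel_measurable_continuous_onI)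

lemma k_meas [measurable]: "k \<in> borel_measurable borel"
  using k_cont by (rule borel_measurable_continuous_onI)

lemma D_meas [measurable]: "D \<in> borel_measurable borel"
  using D_int by simp

lemma k_int: "integrable lborel (\<lambda>z. \<bar>k z\<bar>)"
  using integrable_abs[OF integrable_compact_support[OF continuous_on_const[of UNIV 1] k_cont k_supp]] by simp

lemma bound:
  assumes "t \<in> {\<theta>..1}"
  shows "\<bar>h y * (gaussian t (y - r *\<^sub>R z) * k z)\<bar> \<le> D y * \<bar>k z\<bar>"
proof (cases "k z = 0")
  case False
  have "norm (r *\<^sub>R z) \<le> 1 * norm z" using r by (simp add: mult_left_le_one_le)
  then have "\<bar>h y\<bar> * gaussian t (y - r *\<^sub>R z) \<le> D y"
    using k_supp[OF False] assms by (intro D) auto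
  moreover have "gaussian t (y - r *\<^sub>R z) > 0" using assms \<theta> by (intro gaussian_pos) auto
  ultimately show ?thesis by (simp add: abs_mult mult_right_mono flip: mult.assoc)
qed simp

lemma section_integrable:
  assumes "t \<in> {\<theta>..1}"
  shows "integrable lborel (\<lambda>z. gaussian t (y - r *\<^sub>R z) * k z)"
  using assms \<theta> k_cont k_supp
  by (intro integrable_compact_support gaussian_cont continuous_intros) auto

lemma pair_integrable:
  assumes "t \<in> {\<theta>..1}"
  shows "integrable (lborel \<Otimes>\<^sub>M lborel) (\<lambda>(y, z). h y * (gaussian t (y - r *\<^sub>R z) * k z))"
proof (rule Bochner_Integration.integrable_bound[OF integrable_pair_mult[OF D_int k_int]])
  show "AE x in lborel \<Otimes>\<^sub>M lborel. norm (case x of (y, z) \<Rightarrow> h y * (gaussian t (y - r *\<^sub>R z) * k z))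
    \<le> norm (case x of (y, z) \<Rightarrow> D y * \<bar>k z\<bar>)"
    using bound[OF assms] by (intro AE_I2) (auto intro: order_trans[OF _ abs_ge_self])
qed measurable

lemma bound_integral:
  assumes "t \<in> {\<theta>..1}"
  shows "\<bar>h y * (\<integral>z. gaussian t (y - r *\<^sub>R z) * k z \<partial>lborel)\<bar> \<le> D y * (\<integral>z. \<bar>k z\<bar> \<partial>lborel)"
proof -
  have "\<bar>h y * (\<integral>z. gaussian t (y - r *\<^sub>R z) * k z \<partial>lborel)\<bar> = \<bar>\<integral>z. h y * (gaussian t (y - r *\<^sub>R z) * k z) \<partial>lborel\<bar>"
    by simp
  also have "\<dots> \<le> (\<integral>z. \<bar>h y * (gaussian t (y - r *\<^sub>R z) * k z)\<bar> \<partial>lborel)"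
    by (rule integral_abs_bound)
  also have "\<dots> \<le> (\<integral>z. D y * \<bar>k z\<bar> \<partial>lborel)"
    using bound[OF assms] section_integrable[OF assms] k_int by (intro integral_mono) auto
  finally show ?thesis by simp
qed

lemma smooth_integrable:
  assumes "t \<in> {\<theta>..1}"
  shows "integrable lborel (\<lambda>y. h y * (\<integral>z. gaussian t (y - r *\<^sub>R z) * k z \<partial>lborel))"
proof (rule Bochner_Integration.integrable_bound)
  show "integrable lborel (\<lambda>y. D y * (\<integral>z. \<bar>k z\<bar> \<partial>lborel))" using D_int by simp
  show "AE y in lborel. norm (h y * (\<integral>z. gaussian t (y - r *\<^sub>R z) * k z \<partial>lborel)) \<le> norm (D y * (\<integral>z. \<bar>k z\<bar> \<partial>lborel))"
    using bound_integral[OF assms] by (intro AE_I2) (auto intro: order_trans[OF _ abs_ge_self])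
qed measurable

text \<open>Fubini and the translation y = x + r * z move the mollification from the Gaussian onto
  \<open>h\<close>. For k = \<open>lap_kernel\<close> the inner integral on the right becomes
  \<open>lap_mean h r x\<close>.\<close>

lemma smooth_eq:
  assumes t: "t \<in> {\<theta>..1}"
  shows "(\<integral>y. h y * (\<integral>z. gaussian t (y - r *\<^sub>R z) * k z \<partial>lborel) \<partial>lborel)
    = (\<integral>x. gaussian t x * (\<integral>z. h (x + r *\<^sub>R z) * k z \<partial>lborel) \<partial>lborel)"
proof -
  let ?f = "\<lambda>y z. h y * (gaussian t (y - r *\<^sub>R z) * k z)"
  let ?g = "\<lambda>z x. gaussian t x * (h (x + r *\<^sub>R z) * k z)"
  have fg: "?g z x = ?f (x + r *\<^sub>R z) z" for x z by simp
  note P = pair_integrable[OF t]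
  have fm[measurable]: "(\<lambda>y. ?f y z) \<in> borel_measurable borel" for z by measurable
  have trans_int: "integrable lborel (?g z) \<longleftrightarrow> integrable lborel (\<lambda>y. ?f y z)" for z
    unfolding fg[abs_def] by (rule lborel_translate(1)) measurable
  have trans: "(\<integral>x. ?g z x \<partial>lborel) = (\<integral>y. ?f y z \<partial>lborel)" for z
    unfolding fg by (rule lborel_translate(2)) measurable
  have trans_abs: "(\<integral>x. norm (?g z x) \<partial>lborel) = (\<integral>y. norm (?f y z) \<partial>lborel)" for z
    unfolding fg by (rule lborel_translate(2)[where F="\<lambda>y. norm (?f y z)"]) measurable
  \<comment> \<open>Joint integrability is inherited from \<open>P\<close>: for each fixed z the two
    sections differ by a translation.\<close>
  have Q: "integrable (lborel \<Otimes>\<^sub>M lborel) (\<lambda>(z, x). ?g z x)"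
  proof (rule lborel_pair.Fubini_integrable)
    have "integrable (lborel \<Otimes>\<^sub>M lborel) (\<lambda>(y, z). norm (?f y z))"
      using integrable_norm[OF P] by (simp add: split_def)
    from lborel_pair.integrable_snd[OF this]
    show "integrable lborel (\<lambda>z. \<integral>x. norm (case (z, x) of (z, x) \<Rightarrow> ?g z x) \<partial>lborel)"
      by (simp only: prod.case trans_abs)
    show "AE z in lborel. integrable lborel (\<lambda>x. case (z, x) of (z, x) \<Rightarrow> ?g z x)"
      using lborel_pair.AE_integrable_snd[OF P] by (simp only: prod.case trans_int)
  qed measurable
  have "(\<integral>y. h y * (\<integral>z. gaussian t (y - r *\<^sub>R z) * k z \<partial>lborel) \<partial>lborel) = (\<integral>y. (\<integral>z. ?f y z \<partial>lborel) \<partial>lborel)"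
    by simp
  also have "\<dots> = (\<integral>z. (\<integral>y. ?f y z \<partial>lborel) \<partial>lborel)"
    by (rule lborel_pair.Fubini_integral[OF P, symmetric])
  also have "\<dots> = (\<integral>z. (\<integral>x. ?g z x \<partial>lborel) \<partial>lborel)" by (simp only: trans)
  also have "\<dots> = (\<integral>x. (\<integral>z. ?g z x \<partial>lborel) \<partial>lborel)"
    by (rule lborel_pair.Fubini_integral[OF Q, symmetric])
  finally show ?thesis by simp
qed

end

text \<open>In t, the mollified mean has derivative 1 / (2 * r^2) times a Gaussian mean of
  \<open>lap_mean h r\<close>, which is nonnegative. Formally the fundamental theorem is used for
  each fixed y, and Fubini takes the place of differentiating under the integral over y.\<close>

lemma gaussian_smoothed_mono:
  fixes h :: "'a::euclidean_space \<Rightarrow> real"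
  assumes "gaussian_smoothing h lap_kernel D \<theta> r" and "gaussian_smoothing h spl_kernel D \<theta> r"
    and sub: "peano_subharmonic h"
  shows "(\<integral>y. h y * (\<integral>z. gaussian \<theta> (y - r *\<^sub>R z) * spl_kernel z \<partial>lborel) \<partial>lborel)
    \<le> (\<integral>y. h y * (\<integral>z. gaussian 1 (y - r *\<^sub>R z) * spl_kernel z \<partial>lborel) \<partial>lborel)"
proof -
  interpret K: gaussian_smoothing h lap_kernel D \<theta> r by fact
  interpret S: gaussian_smoothing h spl_kernel D \<theta> r by fact
  define L where "L t y = (\<integral>z. gaussian t (y - r *\<^sub>R z) * lap_kernel z \<partial>lborel)" for t and y :: 'a
  define m where "m t y = (\<integral>z. gaussian t (y - r *\<^sub>R z) * spl_kernel z \<partial>lborel)" for t and y :: 'a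
  define M where "M = (\<integral>z. \<bar>lap_kernel z\<bar> \<partial>(lborel :: 'a measure))"
  let ?\<Phi> = "\<lambda>y t. h y * (L t y / (2 * r\<^sup>2)) * indicator {\<theta>..1} t"
  have [measurable]: "(\<lambda>(y, t). L t y) \<in> borel_measurable (borel \<Otimes>\<^sub>M borel)"
    unfolding L_def by measurable
  have int_ind: "integrable lborel (\<lambda>t. M / (2 * r\<^sup>2) * indicator {\<theta>..1} t :: real)"
    using K.\<theta> by (intro integrable_mult_right integrable_real_indicator) simp_all
  have P: "integrable (lborel \<Otimes>\<^sub>M lborel) (\<lambda>(y, t). ?\<Phi> y t)"
  proof (rule Bochner_Integration.integrable_bound[OF integrable_pair_mult[OF K.D_int int_ind]])
    show "AE x in lborel \<Otimes>\<^sub>M lborel. norm (case x of (y, t) \<Rightarrow> ?\<Phi> y t)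
      \<le> norm (case x of (y, t) \<Rightarrow> D y * (M / (2 * r\<^sup>2) * indicator {\<theta>..1} t))"
    proof (rule AE_I2, clarify)
      fix y :: 'a and t :: real
      show "norm (?\<Phi> y t) \<le> norm (D y * (M / (2 * r\<^sup>2) * indicator {\<theta>..1} t))"
      proof (cases "t \<in> {\<theta>..1}")
        case True
        have "\<bar>h y * L t y\<bar> / (2 * r\<^sup>2) \<le> D y * M / (2 * r\<^sup>2)"
          using K.bound_integral[OF True, of y] K.r unfolding L_def M_def
          by (intro divide_right_mono) auto
        also have "\<dots> \<le> \<bar>D y * M / (2 * r\<^sup>2)\<bar>" by (rule abs_ge_self)
        finally show ?thesis using True by (simp add: abs_mult)
      qed simp
    qed
  qed measurable
  have hL: "(\<integral>y. h y * L t y \<partial>lborel) \<ge> 0" if t: "t \<in> {\<theta>..1}" for t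
  proof -
    have "gaussian t x * lap_mean h r x \<ge> 0" for x
      using t K.\<theta> K.r lap_mean_nonneg[OF K.h_cont sub] gaussian_pos[of t x]
      by (intro mult_nonneg_nonneg) auto
    then show ?thesis
      unfolding L_def K.smooth_eq[OF t] lap_mean_def by (rule Bochner_Integration.integral_nonneg)
  qed
  have diff: "(\<integral>t. ?\<Phi> y t \<partial>lborel) = h y * m 1 y - h y * m \<theta> y" for y
  proof -
    have "(\<integral>t. ?\<Phi> y t \<partial>lborel) = h y * (\<integral>t. (L t y / (2 * r\<^sup>2)) * indicator {\<theta>..1} t \<partial>lborel)"
      by (simp only: integral_mult_right_zero mult.assoc)
    also have "\<dots> = h y * (m 1 y - m \<theta> y)"
      unfolding L_def m_def using K.\<theta> K.r by (subst gaussian_smooth_diff) auto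
    finally show ?thesis by (simp add: right_diff_distrib)
  qed
  have "0 \<le> (\<integral>t. (\<integral>y. ?\<Phi> y t \<partial>lborel) \<partial>lborel)"
  proof (rule Bochner_Integration.integral_nonneg)
    fix t :: real
    show "0 \<le> (\<integral>y. ?\<Phi> y t \<partial>lborel)"
      using hL[of t] K.r by (cases "t \<in> {\<theta>..1}") simp_all
  qed
  also have "\<dots> = (\<integral>y. (\<integral>t. ?\<Phi> y t \<partial>lborel) \<partial>lborel)"
    by (rule lborel_pair.Fubini_integral[OF P])
  also have "\<dots> = (\<integral>y. h y * m 1 y \<partial>lborel) - (\<integral>y. h y * m \<theta> y \<partial>lborel)"
    unfolding diff m_def using K.\<theta> by (intro Bochner_Integration.integral_diff S.smooth_integrable) auto
  finally show ?thesis unfolding m_def by simp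
qed

text \<open>At r = 0 the function \<open>spl_heat 3 r t\<close> is the heat kernel itself, because
  \<open>spl 3\<close> has integral 1. The limit is then continuity in r, coordinate by
  coordinate.\<close>

lemma gaussian_smoothed_tendsto:
  fixes y :: "'a::euclidean_space"
  assumes t: "t > 0"
  shows "(\<lambda>n. \<integral>z. gaussian t (y - (1 / real (Suc n)) *\<^sub>R z) * spl_kernel z \<partial>lborel) \<longlonglongrightarrow> gaussian t y"
proof -
  have "(\<lambda>n. spl_heat 3 (1 / real (Suc n)) t s) \<longlonglongrightarrow> spl_heat 3 0 t s" for s
  proof (rule isCont_tendsto_compose[where g="\<lambda>r. spl_heat 3 r t s" and f="\<lambda>n. 1 / real (Suc n)"])
    show "isCont (\<lambda>r. spl_heat 3 r t s) 0"
      using spl_heat_cont_r[of 3 t s] t by (simp add: continuous_on_eq_continuous_at)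
    show "(\<lambda>n. 1 / real (Suc n)) \<longlonglongrightarrow> 0" by real_asymp
  qed
  then have "(\<lambda>n. \<Prod>b\<in>Basis. spl_heat 3 (1 / real (Suc n)) t (y \<bullet> b)) \<longlonglongrightarrow> (\<Prod>b\<in>Basis. spl_heat 3 0 t (y \<bullet> b))"
    by (intro tendsto_prod)
  moreover have "spl_heat 3 0 t s = heat_kernel t s" for s
    unfolding spl_heat_def by (simp add: spl_moments(1))
  ultimately show ?thesis
    unfolding gaussian_smooth(1)[OF t] gaussian_heat[OF t, of y] by simp
qed

text \<open>The monotonicity holds at every scale 1 / Suc n and passes to the limit by dominated
  convergence, since the bound through \<open>D\<close> does not depend on the scale.\<close>

theorem gaussian_mean_mono:
  fixes h :: "'a::euclidean_space \<Rightarrow> real"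
  assumes h: "continuous_on UNIV h" and sub: "peano_subharmonic h"
    and h2: "integrable lborel (\<lambda>y. gaussian 1 y * (h y)\<^sup>2)" and \<theta>: "0 < \<theta>" "\<theta> \<le> 1"
  shows "\<And>t. t \<in> {\<theta>..1} \<Longrightarrow> integrable lborel (\<lambda>y. gaussian t y * h y)"
    and "(\<integral>y. gaussian \<theta> y * h y \<partial>lborel) \<le> (\<integral>y. gaussian 1 y * h y \<partial>lborel)"
proof -
  have [measurable]: "h \<in> borel_measurable borel" using h by (rule borel_measurable_continuous_onI)
  have "real (2 * DIM('a)) \<ge> 0" by simp
  from gaussian_shift_dominated[OF h2 \<theta>(1) this] obtain D where D: "integrable lborel D" "\<And>y. D y \<ge> 0"
    "\<And>t v y. t \<in> {\<theta>..1} \<Longrightarrow> norm v \<le> real (2 * DIM('a)) \<Longrightarrow> \<bar>h y\<bar> * gaussian t (y - v) \<le> D y" by blast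
  show int: "integrable lborel (\<lambda>y. gaussian t y * h y)" if t: "t \<in> {\<theta>..1}" for t
  proof (rule Bochner_Integration.integrable_bound[OF D(1)])
    have "gaussian t y > 0" for y :: 'a using t \<theta> by (intro gaussian_pos) auto
    then show "AE y in lborel. norm (gaussian t y * h y) \<le> norm (D y)"
      using D(3)[OF t, of 0] D(2) by (intro AE_I2) (simp add: abs_mult abs_of_pos mult.commute)
  qed measurable
  let ?r = "\<lambda>n. 1 / real (Suc n)"
  have r: "0 < ?r n" "?r n \<le> 1" for n by auto
  have K: "gaussian_smoothing h lap_kernel D \<theta> (?r n)" and S: "gaussian_smoothing h spl_kernel D \<theta> (?r n)" for n
    using h D \<theta> r[of n] lap_kernel_cont spl_kernel_cont lap_kernel_support spl_kernel_support
    by (unfold_locales; blast)+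
  have lim: "(\<lambda>n. \<integral>y. h y * (\<integral>z. gaussian t (y - ?r n *\<^sub>R z) * spl_kernel z \<partial>lborel) \<partial>lborel)
    \<longlonglongrightarrow> (\<integral>y. gaussian t y * h y \<partial>lborel)" if t: "t \<in> {\<theta>..1}" for t
  proof (rule integral_dominated_convergence[where w="\<lambda>y. D y * (\<integral>z. \<bar>spl_kernel z\<bar> \<partial>(lborel :: 'a measure))"])
    show "AE y in lborel. (\<lambda>n. h y * (\<integral>z. gaussian t (y - ?r n *\<^sub>R z) * spl_kernel z \<partial>lborel)) \<longlonglongrightarrow> gaussian t y * h y"
      using t \<theta> by (intro AE_I2) (subst mult.commute, intro tendsto_intros gaussian_smoothed_tendsto, auto)
    show "AE y in lborel. norm (h y * (\<integral>z. gaussian t (y - ?r n *\<^sub>R z) * spl_kernel z \<partial>lborel))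
       \<le> D y * (\<integral>z. \<bar>spl_kernel z\<bar> \<partial>(lborel :: 'a measure))" for n
      using gaussian_smoothing.bound_integral[OF S t] by (intro AE_I2) simp
    show "(\<lambda>y. h y * (\<integral>z. gaussian t (y - ?r n *\<^sub>R z) * spl_kernel z \<partial>lborel)) \<in> borel_measurable lborel" for n
      using gaussian_smoothing.smooth_integrable[OF S t] by simp
  qed (use D(1) in auto)
  show "(\<integral>y. gaussian \<theta> y * h y \<partial>lborel) \<le> (\<integral>y. gaussian 1 y * h y \<partial>lborel)"
    using lim[of \<theta>] lim[of 1] \<theta> gaussian_smoothed_mono[OF K S sub]
    by (intro LIMSEQ_le[of _ _ _ "\<integral>y. gaussian 1 y * h y \<partial>lborel"]) auto
qed

section \<open>Application to twice differentiable functions\<close>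

text \<open>Apply the mean value theorem along the segment to f minus its quadratic expansion. The
  derivative of that difference is the first-order error of the gradient, paired with v, so
  differentiability of the gradient at the single point x gives the estimate.\<close>

lemma peano_of_gradient:
  fixes f :: "'a::euclidean_space \<Rightarrow> real" and g :: "'a \<Rightarrow> 'a"
  assumes f: "\<And>x. (f has_derivative (\<lambda>v. g x \<bullet> v)) (at x)" and g: "(g has_derivative A) (at x)" and "\<epsilon> > 0"
  obtains \<delta> where "\<delta> > 0" "\<And>v. norm v < \<delta> \<Longrightarrow> \<bar>f (x + v) - (f x + g x \<bullet> v + (A v \<bullet> v) / 2)\<bar> \<le> \<epsilon> * (norm v)\<^sup>2"
proof -
  interpret A: bounded_linear A using g by (rule has_derivative_bounded_linear)
  obtain \<delta> where \<delta>: "\<delta> > 0" "\<And>y. norm (y - x) < \<delta> \<Longrightarrow> norm (g y - g x - A (y - x)) \<le> \<epsilon> * norm (y - x)"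
    using g \<open>\<epsilon> > 0\<close> unfolding has_derivative_at_alt by blast
  show ?thesis
  proof (rule that[OF \<delta>(1)])
    fix v :: 'a assume v: "norm v < \<delta>"
    define \<phi> where "\<phi> s = f (x + s *\<^sub>R v) - s * (g x \<bullet> v) - s\<^sup>2 / 2 * (A v \<bullet> v)" for s
    have d: "(\<phi> has_real_derivative (g (x + s *\<^sub>R v) - g x - A (s *\<^sub>R v)) \<bullet> v) (at s)" for s
    proof -
      have "((\<lambda>s. f (x + s *\<^sub>R v)) has_derivative (\<lambda>h. g (x + s *\<^sub>R v) \<bullet> (h *\<^sub>R v))) (at s)"
        by (rule has_derivative_compose[where g=f, OF _ f]) (auto intro!: derivative_eq_intros)
      then have "((\<lambda>s. f (x + s *\<^sub>R v)) has_real_derivative g (x + s *\<^sub>R v) \<bullet> v) (at s)"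
        by (simp add: has_field_derivative_def mult_commute_abs)
      then show ?thesis
        unfolding \<phi>_def by (auto intro!: derivative_eq_intros simp: inner_diff_left A.scale)
    qed
    obtain s where s: "0 < s" "s < 1" "\<phi> 1 - \<phi> 0 = (1 - 0) * ((g (x + s *\<^sub>R v) - g x - A (s *\<^sub>R v)) \<bullet> v)"
      using MVT2[of 0 1 \<phi>, OF _ d] by auto
    have ns: "norm (s *\<^sub>R v) \<le> norm v" using s by (simp add: mult_left_le_one_le)
    then have "norm (g (x + s *\<^sub>R v) - g x - A (s *\<^sub>R v)) \<le> \<epsilon> * norm (s *\<^sub>R v)"
      using \<delta>(2)[of "x + s *\<^sub>R v"] v by simp
    also have "\<dots> \<le> \<epsilon> * norm v" using ns \<open>\<epsilon> > 0\<close> by (intro mult_left_mono) auto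
    finally have "norm (g (x + s *\<^sub>R v) - g x - A (s *\<^sub>R v)) * norm v \<le> \<epsilon> * norm v * norm v"
      by (rule mult_right_mono) simp
    then have "\<bar>\<phi> 1 - \<phi> 0\<bar> \<le> \<epsilon> * (norm v)\<^sup>2"
      unfolding s(3) using Cauchy_Schwarz_ineq2[of "g (x + s *\<^sub>R v) - g x - A (s *\<^sub>R v)" v]
      by (simp add: power2_eq_square)
    then show "\<bar>f (x + v) - (f x + g x \<bullet> v + (A v \<bullet> v) / 2)\<bar> \<le> \<epsilon> * (norm v)\<^sup>2"
      by (simp add: \<phi>_def algebra_simps)
  qed
qed

lemma sum_Basis_vec: "(\<Sum>b\<in>(Basis :: (real ^ 'n) set). F b) = (\<Sum>i\<in>UNIV. F (axis i 1))"
proof -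
  have B: "(Basis :: (real ^ 'n) set) = (\<lambda>i. axis i 1) ` UNIV"
    by (auto simp: Basis_vec_def)
  have inj: "inj (\<lambda>i. axis i 1 :: real ^ 'n)" by (auto simp: inj_on_def axis_eq_axis)
  show ?thesis unfolding B sum.reindex[OF inj] comp_def ..
qed

lemma twice_differentiable_derivs:
  assumes "twice_differentiable f"
  shows "(f has_derivative (\<lambda>v. grad f x \<bullet> v)) (at x)"
    and "(grad f has_derivative frechet_derivative (grad f) (at x)) (at x)"
    and "(\<Sum>b\<in>Basis. frechet_derivative (grad f) (at x) b \<bullet> b) = laplacian f x"
proof -
  show "(grad f has_derivative frechet_derivative (grad f) (at x)) (at x)"
    using assms by (simp add: twice_differentiable_def frechet_derivative_works[symmetric])
  have d: "(f has_derivative frechet_derivative f (at x)) (at x)"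
    using assms by (simp add: twice_differentiable_def frechet_derivative_works[symmetric])
  interpret bounded_linear "frechet_derivative f (at x)"
    using d by (rule has_derivative_bounded_linear)
  have "frechet_derivative f (at x) v = grad f x \<bullet> v" for v
  proof -
    have "frechet_derivative f (at x) v = frechet_derivative f (at x) (\<Sum>b\<in>Basis. (v \<bullet> b) *\<^sub>R b)"
      by (simp add: euclidean_representation)
    also have "\<dots> = (\<Sum>i\<in>UNIV. v $ i * frechet_derivative f (at x) (axis i 1))"
      by (simp add: sum scale sum_Basis_vec inner_axis)
    also have "\<dots> = grad f x \<bullet> v"
      by (simp add: grad_def inner_vec_def mult.commute)
    finally show ?thesis .
  qed
  then show "(f has_derivative (\<lambda>v. grad f x \<bullet> v)) (at x)"
    using d by presburger
  show "(\<Sum>b\<in>Basis. frechet_derivative (grad f) (at x) b \<bullet> b) = laplacian f x"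
    by (simp add: laplacian_def sum_Basis_vec inner_axis)
qed

lemma peano_subharmonic_shift:
  fixes f :: "real ^ 'n \<Rightarrow> real" and \<kappa> :: real
  assumes f: "twice_differentiable f" and lap: "\<And>x. laplacian f x \<ge> CARD('n) * \<kappa>"
  shows "peano_subharmonic (\<lambda>x. f x - \<kappa> / 2 * (norm x)\<^sup>2)"
  unfolding peano_subharmonic_def
proof
  fix x :: "real ^ 'n"
  note d = twice_differentiable_derivs[OF f]
  let ?A = "frechet_derivative (grad f) (at x)"
  interpret A: bounded_linear ?A using d(2) by (rule has_derivative_bounded_linear)
  define A' where "A' v = ?A v - \<kappa> *\<^sub>R v" for v
  have "linear A'" unfolding A'_def
    by (intro linearI) (simp_all add: A.add A.scale algebra_simps)
  moreover have "(\<Sum>b\<in>Basis. A' b \<bullet> b) \<ge> 0"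
  proof -
    have "(\<Sum>b\<in>Basis. A' b \<bullet> b) = laplacian f x - CARD('n) * \<kappa>"
      unfolding A'_def by (simp add: inner_diff_left sum_subtractf d(3))
    then show ?thesis using lap[of x] by simp
  qed
  moreover have "\<exists>\<delta>>0. \<forall>v. norm v < \<delta> \<longrightarrow> \<bar>(f (x + v) - \<kappa> / 2 * (norm (x + v))\<^sup>2)
      - ((f x - \<kappa> / 2 * (norm x)\<^sup>2) + (grad f x - \<kappa> *\<^sub>R x) \<bullet> v + (A' v \<bullet> v) / 2)\<bar> \<le> \<epsilon> * (norm v)\<^sup>2"
    if \<epsilon>: "\<epsilon> > 0" for \<epsilon>
  proof -
    have eq: "(f (x + v) - \<kappa> / 2 * (norm (x + v))\<^sup>2)
      - ((f x - \<kappa> / 2 * (norm x)\<^sup>2) + (grad f x - \<kappa> *\<^sub>R x) \<bullet> v + (A' v \<bullet> v) / 2)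
      = f (x + v) - (f x + grad f x \<bullet> v + (?A v \<bullet> v) / 2)" for v
      unfolding A'_def power2_norm_eq_inner by (simp add: inner_simps inner_commute field_simps)
    from peano_of_gradient[OF d(1,2) \<epsilon>] show ?thesis unfolding eq by metis
  qed
  ultimately show "\<exists>a A. linear A \<and> (\<Sum>b\<in>Basis. A b \<bullet> b) \<ge> 0 \<and>
    (\<forall>\<epsilon>>0. \<exists>\<delta>>0. \<forall>v. norm v < \<delta> \<longrightarrow> \<bar>(f (x + v) - \<kappa> / 2 * (norm (x + v))\<^sup>2)
      - ((f x - \<kappa> / 2 * (norm x)\<^sup>2) + a \<bullet> v + (A v \<bullet> v) / 2)\<bar> \<le> \<epsilon> * (norm v)\<^sup>2)"
    by blast
qed

section \<open>Moments, integrability and the Hopf-Lax transform\<close>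

lemma gaussian_second_moment:
  fixes t :: real
  assumes t: "t > 0"
  shows "integrable lborel (\<lambda>x :: 'a::euclidean_space. gaussian t x * (norm x)\<^sup>2)"
    and "(\<integral>x. gaussian t x * (norm x)\<^sup>2 \<partial>(lborel :: 'a measure)) = DIM('a) * t"
proof -
  let ?n = "normal_density 0 (sqrt t)"
  have y2: "integrable lborel (\<lambda>y. ?n y * y\<^sup>2)" "(LBINT y. ?n y * y\<^sup>2) = t"
    using integrable_normal_moment[of "sqrt t" 0 2] integral_normal_moment_even[of "sqrt t" 0 1] t
    by (auto simp: fact_numeral)
  have eq: "gaussian t x * (x \<bullet> c)\<^sup>2 = (\<Prod>b\<in>Basis. ?n (x \<bullet> b) * (if b = c then (x \<bullet> b)\<^sup>2 else 1))"
    if "c \<in> Basis" for x c :: 'a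
    using that by (simp add: gaussian_def prod.distrib)
  have int1: "integrable lborel (\<lambda>s. ?n s * (if b = c then s\<^sup>2 else 1))" for b c :: 'a
    using y2(1) t by (cases "b = c") auto
  have int: "integrable lborel (\<lambda>x. gaussian t x * (x \<bullet> c)\<^sup>2)"
    and val: "(\<integral>x. gaussian t x * (x \<bullet> c)\<^sup>2 \<partial>lborel) = t" if c: "c \<in> Basis" for c :: 'a
  proof -
    show "integrable lborel (\<lambda>x. gaussian t x * (x \<bullet> c)\<^sup>2)"
      unfolding eq[OF c] by (rule integral_lborel_prod(1)[OF int1])
    have "(\<integral>x. gaussian t x * (x \<bullet> c)\<^sup>2 \<partial>lborel) = (\<Prod>b\<in>Basis. \<integral>s. ?n s * (if b = c then s\<^sup>2 else 1) \<partial>lborel)"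
      unfolding eq[OF c] by (rule integral_lborel_prod(2)[OF int1])
    also have "\<dots> = (\<Prod>b\<in>(Basis :: 'a set). if b = c then t else 1)"
      using y2(2) t by (intro prod.cong) auto
    finally show "(\<integral>x. gaussian t x * (x \<bullet> c)\<^sup>2 \<partial>lborel) = t" using c by simp
  qed
  have s: "gaussian t x * (norm x)\<^sup>2 = (\<Sum>c\<in>Basis. gaussian t x * (x \<bullet> c)\<^sup>2)" for x :: 'a
    by (simp add: power2_norm_eq_sum sum_distrib_left)
  show "integrable lborel (\<lambda>x :: 'a. gaussian t x * (norm x)\<^sup>2)"
    unfolding s by (intro Bochner_Integration.integrable_sum int)
  show "(\<integral>x. gaussian t x * (norm x)\<^sup>2 \<partial>(lborel :: 'a measure)) = DIM('a) * t"
    unfolding s by (subst Bochner_Integration.integral_sum) (simp_all add: int val)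
qed

text \<open>The exponent in \<open>E\<close> is 2 * a * w with w = f - \<kappa> * |x|^2 / 4. Where w
  is nonnegative, the exponential controls w^2. Where w is negative, f lies between the linear lower
  bound and \<kappa> * |x|^2 / 4, and the polynomial growth is absorbed by exp (|x|^2 / 4), which is
  still integrable against the standard Gaussian.\<close>

lemma square_integrable_of_exponential:
  fixes f :: "'a::euclidean_space \<Rightarrow> real"
  assumes a: "a > 0" and C: "C \<ge> 0" and \<kappa>: "\<kappa> \<ge> 0" and [measurable]: "f \<in> borel_measurable borel"
    and lower: "\<And>x. f x \<ge> - C * (1 + norm x)"
    and E: "integrable lborel (\<lambda>x. gaussian 1 x * exp (2 * a * f x - a * \<kappa> / 2 * (norm x)\<^sup>2))"
  shows "integrable lborel (\<lambda>x. gaussian 1 x * (f x - \<kappa> / 2 * (norm x)\<^sup>2)\<^sup>2)"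
proof -
  \<comment> \<open>With e = exp (q^2 / 8), the bounds 1 + q \<le> 10 * e and \<kappa> * q^2 / 2
    \<le> 4 * \<kappa> * e explain the two summands.\<close>
  define B where "B = 10 * C + 4 * \<kappa>"
  define c where "c s = (2 * pi * s) powr (- (DIM('a) / 2))" for s
  have c: "c s > 0" if "s > 0" for s using that by (simp add: c_def)
  let ?E = "\<lambda>x. exp (2 * a * f x - a * \<kappa> / 2 * (norm x)\<^sup>2)"
  have le: "(f x - \<kappa> / 2 * (norm x)\<^sup>2)\<^sup>2 \<le> ?E x / a\<^sup>2 + 2 * B\<^sup>2 * exp ((norm x)\<^sup>2 / 4)" for x
  proof -
    define q where "q = norm x"
    define e where "e = exp (q\<^sup>2 / 8)"
    define w where "w = f x - \<kappa> / 4 * q\<^sup>2"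
    have q: "q \<ge> 0" by (simp add: q_def)
    have e1: "1 + q\<^sup>2 / 8 \<le> e" unfolding e_def by (rule exp_ge_add_one_self)
    have "0 \<le> (q - 1 / 2)\<^sup>2" by simp
    then have "1 + q \<le> 2 + q\<^sup>2" by (simp add: power2_diff power_divide)
    then have "1 + q \<le> 10 * e" using e1 zero_le_power2[of q] by linarith
    then have C1: "C * (1 + q) \<le> C * (10 * e)" using C by (intro mult_left_mono)
    have "\<kappa> * q\<^sup>2 \<le> \<kappa> * (8 * e)" using e1 \<kappa> by (intro mult_left_mono) auto
    then have K1: "\<kappa> / 2 * q\<^sup>2 \<le> 4 * \<kappa> * e" by simp
    have e0: "e > 0" by (simp add: e_def)
    have kq: "0 \<le> \<kappa> * q\<^sup>2" using \<kappa> by simp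
    have Ce: "0 \<le> C * e" using C e0 by simp
    have e2: "e\<^sup>2 = exp (q\<^sup>2 / 4)" by (simp add: e_def exp_double[symmetric])
    have Eq: "?E x = exp (2 * a * w)" unfolding w_def q_def by (simp add: algebra_simps)
    have hw: "f x - \<kappa> / 2 * q\<^sup>2 = w - \<kappa> / 4 * q\<^sup>2" by (simp add: w_def)
    show ?thesis
    proof (cases "w \<ge> 0")
      case True
      have "(2 * a * w)\<^sup>2 / 2 \<le> exp (2 * a * w)"
      proof -
        have "0 \<le> 2 * a * w" using a True by simp
        with exp_lower_Taylor_quadratic[OF this] show ?thesis by linarith
      qed
      then have "2 * w\<^sup>2 \<le> ?E x / a\<^sup>2" unfolding Eq using a by (simp add: power_mult_distrib field_simps)
      moreover have "(\<kappa> / 4 * q\<^sup>2)\<^sup>2 \<le> (B * e)\<^sup>2"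
        using K1 kq Ce unfolding B_def by (intro power_mono) (simp_all add: algebra_simps)
      moreover have "(w - \<kappa> / 4 * q\<^sup>2)\<^sup>2 \<le> 2 * w\<^sup>2 + 2 * (\<kappa> / 4 * q\<^sup>2)\<^sup>2"
      proof -
        have "0 \<le> (w + \<kappa> / 4 * q\<^sup>2)\<^sup>2" by simp
        then show ?thesis by (simp add: power2_sum power2_diff)
      qed
      ultimately show ?thesis
        unfolding q_def[symmetric] hw e2[symmetric] by (simp add: power_mult_distrib)
    next
      case False
      have "- (C * (1 + q)) \<le> f x" using lower[of x] by (simp add: q_def)
      then have "\<bar>f x - \<kappa> / 2 * q\<^sup>2\<bar> \<le> C * (1 + q) + \<kappa> / 2 * q\<^sup>2"
        using False kq mult_nonneg_nonneg[OF C, of "1 + q"] q unfolding w_def by (simp add: abs_le_iff)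
      also have "\<dots> \<le> B * e" using C1 K1 unfolding B_def by (simp add: algebra_simps)
      finally have "\<bar>f x - \<kappa> / 2 * q\<^sup>2\<bar>\<^sup>2 \<le> (B * e)\<^sup>2" by (intro power_mono) auto
      then have "(f x - \<kappa> / 2 * q\<^sup>2)\<^sup>2 \<le> B\<^sup>2 * exp (q\<^sup>2 / 4)" by (simp add: power_mult_distrib e2)
      moreover have "0 \<le> B\<^sup>2 * exp (q\<^sup>2 / 4)" "0 \<le> ?E x / a\<^sup>2" by simp_all
      ultimately show ?thesis unfolding q_def[symmetric] by linarith
    qed
  qed
  have "integrable lborel (\<lambda>x. (gaussian 1 x * ?E x) * (1 / a\<^sup>2) + 2 * B\<^sup>2 * c 1 / c 2 * gaussian 2 x)"
    using E by (intro Bochner_Integration.integrable_add integrable_mult_left integrable_mult_right gaussian_integrable) auto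
  then show ?thesis
  proof (rule Bochner_Integration.integrable_bound)
    show "AE x in lborel. norm (gaussian 1 x * (f x - \<kappa> / 2 * (norm x)\<^sup>2)\<^sup>2)
      \<le> norm ((gaussian 1 x * ?E x) * (1 / a\<^sup>2) + 2 * B\<^sup>2 * c 1 / c 2 * gaussian 2 x)"
    proof (rule AE_I2)
      fix x :: 'a
      have g1: "gaussian 1 x = c 1 * exp (- (norm x)\<^sup>2 / 2)" and g2: "gaussian 2 x = c 2 * exp (- (norm x)\<^sup>2 / 4)"
        unfolding c_def by (simp_all add: gaussian_eq)
      have "exp (- (norm x)\<^sup>2 / 2) * exp ((norm x)\<^sup>2 / 4) = exp (- (norm x)\<^sup>2 / 4)"
        by (simp add: exp_add[symmetric])
      then have "gaussian 1 x * exp ((norm x)\<^sup>2 / 4) = c 1 / c 2 * gaussian 2 x"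
        unfolding g1 g2 using c[of 2] by (simp add: mult.assoc)
      then have eq: "gaussian 1 x * (?E x / a\<^sup>2 + 2 * B\<^sup>2 * exp ((norm x)\<^sup>2 / 4))
        = (gaussian 1 x * ?E x) * (1 / a\<^sup>2) + 2 * B\<^sup>2 * c 1 / c 2 * gaussian 2 x"
      proof -
        have "gaussian 1 x * (?E x / a\<^sup>2 + 2 * B\<^sup>2 * exp ((norm x)\<^sup>2 / 4))
          = (gaussian 1 x * ?E x) * (1 / a\<^sup>2) + 2 * B\<^sup>2 * (gaussian 1 x * exp ((norm x)\<^sup>2 / 4))"
          by (simp add: algebra_simps)
        then show ?thesis using \<open>gaussian 1 x * exp _ = _\<close> by simp
      qed
      have p: "gaussian 1 x > 0" by (simp add: gaussian_pos)
      have "norm (gaussian 1 x * (f x - \<kappa> / 2 * (norm x)\<^sup>2)\<^sup>2) = gaussian 1 x * (f x - \<kappa> / 2 * (norm x)\<^sup>2)\<^sup>2"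
        using p by simp
      also have "\<dots> \<le> gaussian 1 x * (?E x / a\<^sup>2 + 2 * B\<^sup>2 * exp ((norm x)\<^sup>2 / 4))"
        using le[of x] p by (intro mult_left_mono) auto
      also have "\<dots> \<le> norm \<dots>" by simp
      finally show "norm (gaussian 1 x * (f x - \<kappa> / 2 * (norm x)\<^sup>2)\<^sup>2)
        \<le> norm ((gaussian 1 x * ?E x) * (1 / a\<^sup>2) + 2 * B\<^sup>2 * c 1 / c 2 * gaussian 2 x)"
        unfolding eq .
    qed
  qed measurable
qed

text \<open>The quadratic cost beats the linear decrease of f by C * d \<le> C^2 * \<tau> / 2 + d^2
  / (2 * \<tau>). This makes the real infimum in \<open>hopf_lax\<close> a genuine one.\<close>

lemma hopf_lax_bdd_below:
  fixes f :: "real ^ 'n \<Rightarrow> real"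
  assumes \<tau>: "\<tau> > 0" and C: "C \<ge> 0" and lower: "\<And>x. f x \<ge> - C * (1 + norm x)"
  shows "bdd_below (range (\<lambda>y. f y + 1 / (2 * \<tau>) * (norm (x - y))\<^sup>2))"
proof (rule bdd_belowI2)
  fix y
  define d where "d = norm (x - y)"
  have "norm y \<le> norm x + d" unfolding d_def using norm_triangle_ineq2[of y x] by (simp add: norm_minus_commute)
  then have "C * (1 + norm y) \<le> C * (1 + norm x + d)" using C by (intro mult_left_mono) auto
  moreover have "C * d \<le> C\<^sup>2 * \<tau> / 2 + 1 / (2 * \<tau>) * d\<^sup>2"
  proof -
    have "0 \<le> (C * \<tau> - d)\<^sup>2 / (2 * \<tau>)" using \<tau> by simp
    also have "\<dots> = C\<^sup>2 * \<tau> / 2 + 1 / (2 * \<tau>) * d\<^sup>2 - C * d"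
      using \<tau> by (simp add: power2_eq_square field_simps)
    finally show ?thesis by simp
  qed
  ultimately show "- C * (1 + norm x) - C\<^sup>2 * \<tau> / 2 \<le> f y + 1 / (2 * \<tau>) * (norm (x - y))\<^sup>2"
    using lower[of y] unfolding d_def[symmetric] by (simp add: algebra_simps)
qed

text \<open>An infimum of functions continuous in x is upper semicontinuous, whatever f is: its
  strict sublevel sets are unions of open sets.\<close>

lemma hopf_lax_measurable:
  fixes f :: "real ^ 'n \<Rightarrow> real"
  assumes bdd: "\<And>x. bdd_below (range (\<lambda>y. f y + 1 / (2 * \<tau>) * (norm (x - y))\<^sup>2))"
  shows "hopf_lax \<tau> f \<in> borel_measurable borel"
proof (rule borel_measurableI_less)
  fix c :: real
  have "{x. hopf_lax \<tau> f x < c} = (\<Union>y. {x. f y + 1 / (2 * \<tau>) * (norm (x - y))\<^sup>2 < c})"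
    unfolding hopf_lax_def using cINF_less_iff[OF _ bdd] by auto
  also have "open \<dots>"
    by (intro open_UN ballI open_Collect_less continuous_intros)
  finally show "{x \<in> space borel. hopf_lax \<tau> f x < c} \<in> sets borel" by simp
qed

lemma gauss_density_eq_gaussian: "\<alpha> > 0 \<Longrightarrow> gauss_density \<alpha> x = gaussian \<alpha> (x :: real ^ 'n)"
  by (simp add: gauss_density_def gaussian_eq)

lemma gauss_measure_eq: "gauss_measure = density lborel (\<lambda>x :: real ^ 'n. ennreal (gaussian 1 x))"
  by (simp add: gauss_measure_def gauss_density_eq_gaussian)

lemma gauss_measure_integral:
  fixes F :: "real ^ 'n \<Rightarrow> real"
  assumes [measurable]: "F \<in> borel_measurable borel"
  shows "integrable gauss_measure F \<longleftrightarrow> integrable lborel (\<lambda>x. gaussian 1 x * F x)"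
    and "(\<integral>x. F x \<partial>gauss_measure) = (\<integral>x. gaussian 1 x * F x \<partial>lborel)"
proof -
  have p: "AE x :: real ^ 'n in lborel. 0 \<le> gaussian 1 x" by (intro AE_I2 less_imp_le gaussian_pos) simp
  show "integrable gauss_measure F \<longleftrightarrow> integrable lborel (\<lambda>x. gaussian 1 x * F x)"
    unfolding gauss_measure_eq using p by (subst integrable_density) auto
  show "(\<integral>x. F x \<partial>gauss_measure) = (\<integral>x. gaussian 1 x * F x \<partial>lborel)"
    unfolding gauss_measure_eq using p by (subst integral_density) auto
qed

lemma T_const_eq:
  assumes "\<tau> > 0" "\<beta> > 1"
  shows "T_const n \<tau> \<beta> = exp (real n / (2 * \<tau>) * (ln (1 + \<tau> * (1 - 1 / \<beta>)) - \<tau> * (1 - 1 / \<beta>)))"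
proof -
  define \<kappa> where "\<kappa> = 1 - 1 / \<beta>"
  have \<kappa>: "\<kappa> > 0" using assms by (simp add: \<kappa>_def)
  have s: "1 + \<tau> * \<kappa> > 0" using assms \<kappa> by (simp add: add_pos_pos)
  have "T_const n \<tau> \<beta> = exp (real n / 2 * \<kappa> * (- 1 + 1 / (\<tau> * \<kappa>) * ln (1 + \<tau> * \<kappa>)))"
    unfolding T_const_def \<kappa>_def[symmetric] using s by (simp add: powr_def exp_add[symmetric] ln_mult)
  also have "real n / 2 * \<kappa> * (- 1 + 1 / (\<tau> * \<kappa>) * ln (1 + \<tau> * \<kappa>)) = real n / (2 * \<tau>) * (ln (1 + \<tau> * \<kappa>) - \<tau> * \<kappa>)"
    using assms \<kappa> by (simp add: field_simps)
  finally show ?thesis unfolding \<kappa>_def .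
qed

lemma T_const_bounds:
  assumes "\<tau> > 0" "\<beta> > 1" "n > 0"
  shows "T_const n \<tau> \<beta> \<in> {0<..<1}"
proof -
  have s: "\<tau> * (1 - 1 / \<beta>) > 0" using assms by simp
  then have "ln (1 + \<tau> * (1 - 1 / \<beta>)) < \<tau> * (1 - 1 / \<beta>)"
    using ln_add_one_self_less_self by blast
  then have "real n / (2 * \<tau>) * (ln (1 + \<tau> * (1 - 1 / \<beta>)) - \<tau> * (1 - 1 / \<beta>)) < 0"
    using assms by (intro mult_pos_neg) auto
  then show ?thesis unfolding T_const_eq[OF assms(1,2)] by simp
qed

text \<open>Expanding |x - y|^2 in the infimum turns its definition into the duality constraint. In
  the constant, the term n * \<theta> / 2 is the Gaussian mean of |y|^2 / 2 and the powers of 2 * pi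
  cancel against the normalisation of the measure.\<close>

lemma exp_hopf_lax_integral:
  fixes f :: "real ^ 'n \<Rightarrow> real"
  assumes \<tau>: "\<tau> > 0" and \<theta>: "\<theta> > 0" and [measurable]: "f \<in> borel_measurable borel"
    and bdd: "\<And>x. bdd_below (range (\<lambda>y. f y + 1 / (2 * \<tau>) * (norm (x - y))\<^sup>2))"
    and int: "integrable lborel (\<lambda>y. gaussian \<theta> y * f y)"
  shows "(\<integral>\<^sup>+x. ennreal (exp (\<tau> * hopf_lax \<tau> f x)) \<partial>gauss_measure)
    \<le> ennreal (exp (CARD('n) / 2 * (\<theta> - 1 - ln \<theta>) + \<tau> * (\<integral>y. gaussian \<theta> y * f y \<partial>lborel)))"
proof -
  note Qm[measurable] = hopf_lax_measurable[OF bdd]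
  define n where "n = real CARD('n)"
  define u where "u x = \<tau> * hopf_lax \<tau> f x - (norm x)\<^sup>2 / 2" for x
  define G where "G y = \<tau> * f y + (norm y)\<^sup>2 / 2" for y
  have G_eq: "gaussian \<theta> y * G y = \<tau> * (gaussian \<theta> y * f y) + 1 / 2 * (gaussian \<theta> y * (norm y)\<^sup>2)" for y
    by (simp add: G_def algebra_simps)
  have Gint: "integrable lborel (\<lambda>y. gaussian \<theta> y * G y)"
    unfolding G_eq using int \<theta>
    by (intro Bochner_Integration.integrable_add integrable_mult_right gaussian_second_moment(1)) auto
  have Gval: "(\<integral>y. gaussian \<theta> y * G y \<partial>lborel) = \<tau> * (\<integral>y. gaussian \<theta> y * f y \<partial>lborel) + n * \<theta> / 2"
    unfolding G_eq n_def using int gaussian_second_moment[where 'a="real ^ 'n", OF \<theta>]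
    by (subst Bochner_Integration.integral_add) auto
  have [measurable]: "u \<in> borel_measurable borel" "G \<in> borel_measurable borel"
    unfolding u_def G_def by measurable
  have le: "u x + x \<bullet> y \<le> G y" for x y
  proof -
    have "hopf_lax \<tau> f x \<le> f y + 1 / (2 * \<tau>) * (norm (x - y))\<^sup>2"
      unfolding hopf_lax_def by (rule cINF_lower[OF bdd]) simp
    then have "\<tau> * hopf_lax \<tau> f x \<le> \<tau> * (f y + 1 / (2 * \<tau>) * (norm (x - y))\<^sup>2)"
      using \<tau> by (intro mult_left_mono) auto
    also have "\<dots> = \<tau> * f y + (norm (x - y))\<^sup>2 / 2" using \<tau> by (simp add: field_simps)
    also have "(norm (x - y))\<^sup>2 = (norm x)\<^sup>2 + (norm y)\<^sup>2 - 2 * (x \<bullet> y)"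
      by (simp add: power2_norm_eq_inner inner_simps inner_commute)
    finally show ?thesis unfolding u_def G_def by (simp add: field_simps)
  qed
  have dens: "gaussian 1 x * exp (\<tau> * hopf_lax \<tau> f x) = (2 * pi) powr (- (n / 2)) * exp (u x)" for x
  proof -
    have "exp (u x) = exp (- (norm x)\<^sup>2 / (2 * 1)) * exp (\<tau> * hopf_lax \<tau> f x)"
      unfolding u_def by (simp add: exp_add[symmetric])
    then show ?thesis by (simp add: gaussian_eq n_def)
  qed
  have "(\<integral>\<^sup>+x. ennreal (exp (\<tau> * hopf_lax \<tau> f x)) \<partial>gauss_measure)
    = (\<integral>\<^sup>+x. ennreal ((2 * pi) powr (- (n / 2))) * ennreal (exp (u x)) \<partial>lborel)"
    unfolding gauss_measure_eq
    by (subst nn_integral_density)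
       (auto simp: ennreal_mult'[symmetric] dens less_imp_le[OF gaussian_pos])
  also have "\<dots> = ennreal ((2 * pi) powr (- (n / 2))) * (\<integral>\<^sup>+x. ennreal (exp (u x)) \<partial>lborel)"
    by (rule nn_integral_cmult) measurable
  also have "\<dots> \<le> ennreal ((2 * pi) powr (- (n / 2))) *
      ennreal (exp (n * ((ln (2 * pi) - 1 - ln \<theta>) / 2) + (\<integral>y. gaussian \<theta> y * G y \<partial>lborel)))"
    using transport_entropy[OF \<theta> _ _ Gint le] unfolding n_def by (intro mult_left_mono) auto
  also have "\<dots> = ennreal (exp (n / 2 * (\<theta> - 1 - ln \<theta>) + \<tau> * (\<integral>y. gaussian \<theta> y * f y \<partial>lborel)))"
    unfolding Gval
    by (simp add: ennreal_mult'[symmetric] powr_def exp_add[symmetric]) (simp add: field_simps)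
  finally show ?thesis unfolding n_def .
qed

theorem corollary6p3:
  fixes f :: "real ^ 'n \<Rightarrow> real" and \<tau> \<beta> :: real
  assumes "\<tau> > 0" and "\<beta> > 1"
    and "twice_differentiable f"
    and "\<exists>C>0. \<forall>x. f x \<ge> - C * (1 + norm x)"
    and "\<forall>x. laplacian f x \<ge> real CARD('n) * (1 - 1 / \<beta>)"
    and "\<forall>\<^sub>F a in at_right 0. integrable gauss_measure
           (\<lambda>x. exp (2 * a * f x) * (gauss_density 1 x / gauss_density (beta_a \<beta> a) x))"
  shows "gauss_Lr \<tau> (\<lambda>x. exp (hopf_lax \<tau> f x)) \<and>
    gauss_norm \<tau> (\<lambda>x. exp (hopf_lax \<tau> f x))
      \<le> T_const CARD('n) \<tau> \<beta> * exp (\<integral>x. f x \<partial>gauss_measure) \<and>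
    T_const CARD('n) \<tau> \<beta> \<in> {0<..<1}"
proof -
  define \<kappa> where "\<kappa> = 1 - 1 / \<beta>"
  define n where "n = real CARD('n)"
  define s where "s = \<tau> * \<kappa>"
  \<comment> \<open>The minimiser of \<theta> - 1 - ln \<theta> - s * (1 - \<theta>), by 1 - 1 /
    \<theta> + s = 0.\<close>
  define \<theta> where "\<theta> = 1 / (1 + s)"
  have \<tau>: "\<tau> > 0" by fact
  have \<kappa>: "0 < \<kappa>" "\<kappa> < 1" using \<open>\<beta> > 1\<close> by (simp_all add: \<kappa>_def)
  have s: "s > 0" using \<tau> \<kappa> by (simp add: s_def)
  have \<theta>: "0 < \<theta>" "\<theta> \<le> 1" and \<theta>s: "\<theta> * (1 + s) = 1" and ln\<theta>: "ln \<theta> = - ln (1 + s)"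
    using s by (simp_all add: \<theta>_def ln_div)
  obtain C where C: "C > 0" "\<And>x. f x \<ge> - C * (1 + norm x)" using assms(4) by blast
  note d = twice_differentiable_derivs[OF assms(3)]
  have cont: "continuous_on UNIV f"
    using d(1) by (intro continuous_at_imp_continuous_on ballI has_derivative_continuous)
  then have fm[measurable]: "f \<in> borel_measurable borel" by (rule borel_measurable_continuous_onI)
  \<comment> \<open>With a < 1 the number 1 - a * \<kappa> is positive, so that
    \<open>beta_a\<close> is a genuine variance.\<close>
  have "\<forall>\<^sub>F a in at_right (0::real). 0 < a \<and> a < 1"
    by (auto simp: eventually_at_right[of 0 1] intro: exI[of _ 1])
  then have "\<exists>a. 0 < a \<and> a < 1 \<and> integrable gauss_measure
           (\<lambda>x. exp (2 * a * f x) * (gauss_density 1 x / gauss_density (beta_a \<beta> a) x))"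
    using eventually_happens'[OF trivial_limit_at_right_real eventually_conj[OF _ assms(6)]] by blast
  then obtain a where a: "0 < a" "a < 1" and Ea: "integrable gauss_measure
           (\<lambda>x. exp (2 * a * f x) * (gauss_density 1 x / gauss_density (beta_a \<beta> a) x))"
    by blast
  have ak: "a * \<kappa> < 1" using a \<kappa> mult_strict_mono[of a 1 \<kappa> 1] by simp
  define b where "b = beta_a \<beta> a"
  have b: "b > 0" "1 / b = 1 - a * \<kappa>" using ak by (simp_all add: b_def beta_a_def \<kappa>_def)
  \<comment> \<open>As 1 / b = 1 - a * \<kappa>, the quotient of the densities is a constant times
    exp (- a * \<kappa> * |x|^2 / 2).\<close>
  have ratio: "exp (2 * a * f x) * (gauss_density 1 x / gauss_density b x)
      = b powr (n / 2) * exp (2 * a * f x - a * \<kappa> / 2 * (norm x)\<^sup>2)" for x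
  proof -
    have "(norm x)\<^sup>2 / (2 * b) = (1 / b) * (norm x)\<^sup>2 / 2" by simp
    also have "\<dots> = (norm x)\<^sup>2 / 2 - a * \<kappa> / 2 * (norm x)\<^sup>2" unfolding b(2) by (simp add: field_simps)
    finally have e: "2 * a * f x - a * \<kappa> / 2 * (norm x)\<^sup>2 = 2 * a * f x + - (norm x)\<^sup>2 / 2 - - (norm x)\<^sup>2 / (2 * b)"
      by simp
    have "(2 * pi * 1) powr (- (n / 2)) / (2 * pi * b) powr (- (n / 2)) = b powr (n / 2)"
      using b(1) by (simp add: powr_mult powr_minus field_simps)
    moreover have "F * ((A * e1) / (B * e2)) = (A / B) * (F * e1 / e2)" for F A B e1 e2 :: real
      by simp
    ultimately show ?thesis
      unfolding e exp_add exp_diff gauss_density_def n_def by (simp only: mult_1_right)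
  qed
  have "integrable gauss_measure (\<lambda>x. b powr (n / 2) * exp (2 * a * f x - a * \<kappa> / 2 * (norm x)\<^sup>2))"
    using Ea unfolding b_def[symmetric] ratio .
  then have "integrable gauss_measure (\<lambda>x. exp (2 * a * f x - a * \<kappa> / 2 * (norm x)\<^sup>2))"
    using b(1) by simp
  then have E: "integrable lborel (\<lambda>x. gaussian 1 x * exp (2 * a * f x - a * \<kappa> / 2 * (norm x)\<^sup>2))"
    by (subst (asm) gauss_measure_integral(1)) auto
  define h where "h x = f x - \<kappa> / 2 * (norm x)\<^sup>2" for x
  have hcont: "continuous_on UNIV h"
    unfolding h_def by (intro continuous_intros cont)
  have hsub: "peano_subharmonic h"
    unfolding h_def using assms(5) by (intro peano_subharmonic_shift assms(3)) (simp add: \<kappa>_def)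
  have h2: "integrable lborel (\<lambda>x. gaussian 1 x * (h x)\<^sup>2)"
    unfolding h_def using a C \<kappa> E
    by (intro square_integrable_of_exponential[where a=a and C=C]) auto
  note mono = gaussian_mean_mono[OF hcont hsub h2 \<theta>]
  have f_eq: "gaussian t x * f x = gaussian t x * h x + \<kappa> / 2 * (gaussian t x * (norm x)\<^sup>2)" for t x
    by (simp add: h_def algebra_simps)
  have fint: "integrable lborel (\<lambda>x. gaussian t x * f x)"
    and fval: "(\<integral>x. gaussian t x * f x \<partial>lborel) = (\<integral>x. gaussian t x * h x \<partial>lborel) + \<kappa> / 2 * (n * t)"
    if t: "t \<in> {\<theta>..1}" for t
  proof -
    have "t > 0" using t \<theta> by simp
    note m2 = gaussian_second_moment[where 'a="real ^ 'n", OF this]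
    show "integrable lborel (\<lambda>x. gaussian t x * f x)"
      unfolding f_eq by (intro Bochner_Integration.integrable_add integrable_mult_right mono(1)[OF t] m2(1))
    show "(\<integral>x. gaussian t x * f x \<partial>lborel) = (\<integral>x. gaussian t x * h x \<partial>lborel) + \<kappa> / 2 * (n * t)"
      unfolding f_eq using mono(1)[OF t] m2
      by (subst Bochner_Integration.integral_add) (auto simp: n_def)
  qed
  \<comment> \<open>By \<open>fint\<close> at t = 1 the function f is integrable here, so
    \<open>I\<close> is not the default value 0.\<close>
  define I where "I = (\<integral>x. f x \<partial>gauss_measure)"
  have I: "I = (\<integral>x. gaussian 1 x * f x \<partial>lborel)" unfolding I_def by (rule gauss_measure_integral(2)) measurable
  have fle: "(\<integral>x. gaussian \<theta> x * f x \<partial>lborel) \<le> I - \<kappa> / 2 * n * (1 - \<theta>)"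
  proof -
    have "\<kappa> / 2 * (n * \<theta>) = \<kappa> / 2 * (n * 1) - \<kappa> / 2 * n * (1 - \<theta>)" by (simp add: field_simps)
    moreover have "\<theta> \<in> {\<theta>..1}" "1 \<in> {\<theta>..1}" using \<theta> by simp_all
    ultimately show ?thesis using fval[of \<theta>] fval[of 1] mono(2) unfolding I by linarith
  qed
  have bdd: "bdd_below (range (\<lambda>y. f y + 1 / (2 * \<tau>) * (norm (x - y))\<^sup>2))" for x
    using C by (intro hopf_lax_bdd_below[OF \<tau>, of C]) auto
  note Qm[measurable] = hopf_lax_measurable[OF bdd]
  have exponent: "n / 2 * (\<theta> - 1 - ln \<theta>) + \<tau> * (\<integral>y. gaussian \<theta> y * f y \<partial>lborel) \<le> n / 2 * (ln (1 + s) - s) + \<tau> * I"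
  proof -
    have "\<tau> * (\<integral>y. gaussian \<theta> y * f y \<partial>lborel) \<le> \<tau> * (I - \<kappa> / 2 * n * (1 - \<theta>))"
      using fle \<tau> by (intro mult_left_mono) auto
    also have "\<dots> = \<tau> * I - n / 2 * (s - s * \<theta>)" by (simp add: s_def field_simps)
    \<comment> \<open>Now the terms linear in \<theta> cancel and only the logarithm depends on
      it.\<close>
    also have "s - s * \<theta> = s + \<theta> - 1" using \<theta>s by (simp add: algebra_simps)
    finally show ?thesis unfolding ln\<theta> by (simp add: field_simps)
  qed
  let ?F = "\<lambda>x. exp (\<tau> * hopf_lax \<tau> f x)"
  have nn: "(\<integral>\<^sup>+x. ennreal (?F x) \<partial>gauss_measure) \<le> ennreal (exp (n / 2 * (ln (1 + s) - s) + \<tau> * I))"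
    using exp_hopf_lax_integral[OF \<tau> \<theta>(1) fm bdd fint[of \<theta>]] \<theta> exponent unfolding n_def
    by (auto intro: order_trans simp: ennreal_leI)
  have F_eq: "\<bar>exp (hopf_lax \<tau> f x)\<bar> powr \<tau> = ?F x" for x
    by (simp add: powr_def)
  have Fm: "?F \<in> borel_measurable gauss_measure"
    unfolding gauss_measure_def by simp
  \<comment> \<open>The bound was obtained for the nonnegative integral, so it yields integrability
    as well, which the Bochner integral in \<open>gauss_norm\<close> could not reveal.\<close>
  have Fint: "integrable gauss_measure ?F"
    using Fm nn by (intro integrableI_nonneg) (auto intro: le_less_trans)
  have Lr: "gauss_Lr \<tau> (\<lambda>x. exp (hopf_lax \<tau> f x))"
    unfolding gauss_Lr_def F_eq using Fint by simp
  have "ennreal (\<integral>x. ?F x \<partial>gauss_measure) \<le> ennreal (exp (n / 2 * (ln (1 + s) - s) + \<tau> * I))"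
    using nn nn_integral_eq_integral[OF Fint] by simp
  then have Fle: "(\<integral>x. ?F x \<partial>gauss_measure) \<le> exp (n / 2 * (ln (1 + s) - s) + \<tau> * I)"
    by simp
  have "gauss_norm \<tau> (\<lambda>x. exp (hopf_lax \<tau> f x)) = (\<integral>x. ?F x \<partial>gauss_measure) powr (1 / \<tau>)"
    unfolding gauss_norm_def F_eq ..
  also have "\<dots> \<le> exp (n / 2 * (ln (1 + s) - s) + \<tau> * I) powr (1 / \<tau>)"
    using Fle \<tau> by (intro powr_mono2) auto
  also have "\<dots> = exp (n / (2 * \<tau>) * (ln (1 + s) - s)) * exp I"
    using \<tau> by (simp add: powr_def exp_add[symmetric] add_divide_distrib)
  also have "exp (n / (2 * \<tau>) * (ln (1 + s) - s)) = T_const CARD('n) \<tau> \<beta>"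
    unfolding T_const_eq[OF assms(1,2)] n_def s_def \<kappa>_def ..
  finally have "gauss_norm \<tau> (\<lambda>x. exp (hopf_lax \<tau> f x)) \<le> T_const CARD('n) \<tau> \<beta> * exp (\<integral>x. f x \<partial>gauss_measure)"
    unfolding I_def .
  with Lr T_const_bounds[OF assms(1,2), of "CARD('n)"] show ?thesis by simp
qed

end
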